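(* Let $f\in L^2(\Omega)$, $g_D\in H^{1/2}(\Gamma_D)$, $g_N\in H^{-1/2}(\Gamma_N)$. The variational problem: find $(\boldsymbol\eta,w)\in H_N(\mathrm{div};\Omega)\times H^1_D(\Omega)$ such that $$b(\boldsymbol\eta,w;\boldsymbol\tau,v)=f(\boldsymbol\tau,v)\qquad\text{for all }(\boldsymbol\tau,v)\in H_N(\mathrm{div};\Omega)\times H^1_D(\Omega)$$ has a unique solution $(\boldsymbol\eta,w)\in H_N(\mathrm{div};\Omega)\times H^1_D(\Omega)$, and it satisfies the a priori estimate $$|\!|\!|(\boldsymbol\eta,w)|\!|\!|\le C\left(\|f\|_{-1,\Omega}+\|g_D\|_{1/2,\Gamma_D}+\|g_N\|_{-1/2,\Gamma_N}\right),$$ with a constant $C>0$ independent of the data $f,g_D,g_N$ (it may depend on the domain and the coefficients).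
   Context: $\Omega\subset\mathbb R^d$ ($d=2$ or $3$) is a bounded, open, connected set with Lipschitz continuous boundary and outward unit normal $\mathbf n$. $\partial\Omega=\bar\Gamma_D\cup\bar\Gamma_N$ with $\Gamma_D,\Gamma_N$ open and disjoint, $\Gamma_D$ of positive measure and connected. $(\cdot,\cdot)$ and $\|\cdot\|$ are the $L^2(\Omega)$ inner product and norm. Coefficients: $A$ is a $d\times d$ symmetric matrix-valued function with $\Lambda_0\boldsymbol\xi^T\boldsymbol\xi\le\boldsymbol\xi^TA(x)\boldsymbol\xi\le\Lambda_1\boldsymbol\xi^T\boldsymbol\xi$ for all $\boldsymbol\xi\in\mathbb R^d$ and almost all $x\in\overline\Omega$, where $0<\Lambda_0\le\Lambda_1$ are constants; $\mathbf b\in L^\infty(\Omega)^d$; $a\in L^\infty(\Omega)$ is a scalar function with $a\neq0$. Spaces: $H^1_D(\Omega)=\{v\in H^1(\Omega): v=0 \text{ on }\Gamma_D\}$; $H_N(\mathrm{div};\Omega)=\{\boldsymbol\tau\in L^2(\Omega)^d:\nabla\cdot\boldsymbol\tau\in L^2(\Omega),\ \mathbf n\cdot\boldsymbol\tau=0\text{ on }\Gamma_N\}$. Standing assumption: for every $f\in L^2(\Omega)$ the problem of finding $u\in H^1_D(\Omega)$ with $(A\nabla u,\nabla v)+(\mathbf b\cdot\nabla u+au,v)=(f,v)$ for all $v\in H^1_D(\Omega)$, and the dual problem of finding $z\in H^1_D(\Omega)$ with $(\nabla\phi,(A\nabla+\mathbf b)z)+(\phi,az)=(f,\phi)$ for all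 $\phi\in H^1_D(\Omega)$, have unique solutions, which satisfy $\|u\|_{H^2(\Omega)}\le C\|f\|$ and $\|z\|_{H^2(\Omega)}\le C\|f\|$. Here $(A\nabla+\mathbf b)v:=A\nabla v+\mathbf b\,v$, and similarly for related expressions. Bilinear form: $$b(\boldsymbol\eta,w;\boldsymbol\tau,v)=\big(\boldsymbol\eta-(A\nabla+\mathbf b)w,\;A^{-1}\boldsymbol\tau-(\nabla+A^{-1}\mathbf b)v\big)+\big(a^{-1}\nabla\cdot\boldsymbol\eta-w,\;\nabla\cdot\boldsymbol\tau-a\,v\big).$$ Linear form: $f(\boldsymbol\tau,v)=(f,v)-\int_{\Gamma_N}g_N\,v\,ds-\int_{\Gamma_D}g_D\,(\boldsymbol\tau\cdot\mathbf n)\,ds$, the boundary integrals being understood as duality pairings. Norms: $|\!|\!|(\boldsymbol\tau,v)|\!|\!|^2=\|a^{1/2}v\|^2+\|A^{1/2}\nabla v\|^2+\|A^{-1/2}\boldsymbol\tau\|^2+\|a^{-1/2}\nabla\cdot\boldsymbol\tau\|^2$. $\|\cdot\|_{-1,\Omega}$ is the norm of the dual of $H^1_D(\Omega)$; $\|\cdot\|_{1/2,\Gamma_D}$ is the trace norm of $H^{1/2}(\Gamma_D)$ (restrictions to $\Gamma_D$ of traces of $H^1(\Omega)$ functions); $\|\cdot\|_{-1/2,\Gamma_N}$ is the norm of the dual of the space of traces on $\Gamma_N$ of functions in $H^1_D(\Omega)$.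
   Formalization: The condition a≠0 is read as a≠0 almost everywhere with 1/a essentially bounded; otherwise (e.g. a(x)=|x| near 0) the bilinear form and the norm are not defined on all of H_N(div;Ω)×H^1_D(Ω). *)

theory Defs
  imports "HOL-Analysis.Analysis"
begin

section \<open>Square-integrable and essentially bounded functions\<close>

text \<open>
  Elements of function spaces are represented by functions; two representatives of the same
  element agree almost everywhere. Everything on an open set \<open>\<Omega>\<close> refers to \<open>lebesgue_on \<Omega>\<close>.
\<close>

definition L2 :: "'a measure \<Rightarrow> ('a \<Rightarrow> 'b::euclidean_space) set" where
  "L2 M = {f. f \<in> borel_measurable M \<and> integrable M (\<lambda>x. (norm (f x))\<^sup>2)}"

definition L2_inner :: "'a measure \<Rightarrow> ('a \<Rightarrow> 'b::euclidean_space) \<Rightarrow> ('a \<Rightarrow> 'b) \<Rightarrow> real" where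
  "L2_inner M f g = (\<integral>x. f x \<bullet> g x \<partial>M)"

definition L2_norm :: "'a measure \<Rightarrow> ('a \<Rightarrow> 'b::euclidean_space) \<Rightarrow> real" where
  "L2_norm M f = sqrt (\<integral>x. (norm (f x))\<^sup>2 \<partial>M)"

definition Linf :: "'a measure \<Rightarrow> ('a \<Rightarrow> 'b::euclidean_space) set" where
  "Linf M = {f. f \<in> borel_measurable M \<and> (\<exists>K. AE x in M. norm (f x) \<le> K)}"


section \<open>Weak derivatives and Sobolev spaces\<close>

primrec Ck :: "nat \<Rightarrow> ('a::euclidean_space \<Rightarrow> real) \<Rightarrow> bool" where
  "Ck 0 \<phi> \<longleftrightarrow> continuous_on UNIV \<phi>"
| "Ck (Suc k) \<phi> \<longleftrightarrow> (\<forall>x. \<phi> differentiable (at x)) \<and>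
     (\<forall>i\<in>Basis. Ck k (\<lambda>x. frechet_derivative \<phi> (at x) i))"

definition smooth :: "('a::euclidean_space \<Rightarrow> real) \<Rightarrow> bool" where
  "smooth \<phi> \<longleftrightarrow> (\<forall>k. Ck k \<phi>)"

definition test_function :: "'a::euclidean_space set \<Rightarrow> ('a \<Rightarrow> real) \<Rightarrow> bool" where
  "test_function \<Omega> \<phi> \<longleftrightarrow>
     smooth \<phi> \<and> compact (closure {x. \<phi> x \<noteq> 0}) \<and> closure {x. \<phi> x \<noteq> 0} \<subseteq> \<Omega>"

definition grad :: "('a::euclidean_space \<Rightarrow> real) \<Rightarrow> 'a \<Rightarrow> 'a" where
  "grad \<phi> x = (\<Sum>i\<in>Basis. frechet_derivative \<phi> (at x) i *\<^sub>R i)"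

definition has_weak_grad :: "'a::euclidean_space set \<Rightarrow> ('a \<Rightarrow> real) \<Rightarrow> ('a \<Rightarrow> 'a) \<Rightarrow> bool" where
  "has_weak_grad \<Omega> v p \<longleftrightarrow> (\<forall>\<phi>. test_function \<Omega> \<phi> \<longrightarrow> (\<forall>i\<in>Basis.
     L2_inner (lebesgue_on \<Omega>) v (\<lambda>x. grad \<phi> x \<bullet> i)
       = - L2_inner (lebesgue_on \<Omega>) (\<lambda>x. p x \<bullet> i) \<phi>))"

definition has_weak_div :: "'a::euclidean_space set \<Rightarrow> ('a \<Rightarrow> 'a) \<Rightarrow> ('a \<Rightarrow> real) \<Rightarrow> bool" where
  "has_weak_div \<Omega> \<tau> q \<longleftrightarrow> (\<forall>\<phi>. test_function \<Omega> \<phi> \<longrightarrow>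
     L2_inner (lebesgue_on \<Omega>) \<tau> (grad \<phi>) = - L2_inner (lebesgue_on \<Omega>) q \<phi>)"

text \<open>The choices below are unique up to null subsets of \<open>\<Omega>\<close>.\<close>

definition weak_grad :: "'a::euclidean_space set \<Rightarrow> ('a \<Rightarrow> real) \<Rightarrow> 'a \<Rightarrow> 'a" where
  "weak_grad \<Omega> v = (SOME p. p \<in> L2 (lebesgue_on \<Omega>) \<and> has_weak_grad \<Omega> v p)"

definition weak_div :: "'a::euclidean_space set \<Rightarrow> ('a \<Rightarrow> 'a) \<Rightarrow> 'a \<Rightarrow> real" where
  "weak_div \<Omega> \<tau> = (SOME q. q \<in> L2 (lebesgue_on \<Omega>) \<and> has_weak_div \<Omega> \<tau> q)"

definition H1 :: "'a::euclidean_space set \<Rightarrow> ('a \<Rightarrow> real) set" where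
  "H1 \<Omega> = {v \<in> L2 (lebesgue_on \<Omega>). \<exists>p \<in> L2 (lebesgue_on \<Omega>). has_weak_grad \<Omega> v p}"

definition H1_norm :: "'a::euclidean_space set \<Rightarrow> ('a \<Rightarrow> real) \<Rightarrow> real" where
  "H1_norm \<Omega> v =
     sqrt ((L2_norm (lebesgue_on \<Omega>) v)\<^sup>2 + (L2_norm (lebesgue_on \<Omega>) (weak_grad \<Omega> v))\<^sup>2)"

definition H2 :: "'a::euclidean_space set \<Rightarrow> ('a \<Rightarrow> real) set" where
  "H2 \<Omega> = {v \<in> H1 \<Omega>. \<forall>i\<in>Basis. (\<lambda>x. weak_grad \<Omega> v x \<bullet> i) \<in> H1 \<Omega>}"

definition H2_norm :: "'a::euclidean_space set \<Rightarrow> ('a \<Rightarrow> real) \<Rightarrow> real" where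
  "H2_norm \<Omega> v = sqrt ((H1_norm \<Omega> v)\<^sup>2 +
     (\<Sum>i\<in>Basis. (L2_norm (lebesgue_on \<Omega>) (weak_grad \<Omega> (\<lambda>x. weak_grad \<Omega> v x \<bullet> i)))\<^sup>2))"

definition Hdiv :: "'a::euclidean_space set \<Rightarrow> ('a \<Rightarrow> 'a) set" where
  "Hdiv \<Omega> = {\<tau> \<in> L2 (lebesgue_on \<Omega>). \<exists>q \<in> L2 (lebesgue_on \<Omega>). has_weak_div \<Omega> \<tau> q}"


section \<open>Lipschitz boundaries, surface measure and traces\<close>

text \<open>
  Near each boundary point, \<open>\<Omega>\<close> lies above the graph of a Lipschitz function of the coordinates
  orthogonal to some direction \<open>\<nu>\<close>; the argument of \<open>\<gamma>\<close> is the orthogonal projection onto the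
  hyperplane \<open>z \<bullet> \<nu> = 0\<close>.
\<close>

definition lipschitz_boundary :: "'a::euclidean_space set \<Rightarrow> bool" where
  "lipschitz_boundary \<Omega> \<longleftrightarrow> (\<forall>x0 \<in> frontier \<Omega>. \<exists>r>0. \<exists>\<nu>. norm \<nu> = 1 \<and>
     (\<exists>\<gamma> L. L-lipschitz_on {z. z \<bullet> \<nu> = 0} \<gamma> \<and>
       \<Omega> \<inter> ball x0 r = {x \<in> ball x0 r. x \<bullet> \<nu> > \<gamma> (x - (x \<bullet> \<nu>) *\<^sub>R \<nu>)}))"

text \<open>
  Surface measure is the Hausdorff measure of dimension \<open>DIM('a) - 1\<close>, with the usual
  normalisation by the volume of the ball of diameter 1 (so that it is Euclidean area on
  hyperplanes). As a metric outer measure it is countably additive on Borel sets.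
  The formulas below are only meaningful for \<open>DIM('a) \<ge> 2\<close>.
\<close>

definition hausdorff_content :: "real \<Rightarrow> 'a::euclidean_space set \<Rightarrow> ennreal" where
  "hausdorff_content \<delta> S =
     (INF E \<in> {E :: nat \<Rightarrow> 'a set. S \<subseteq> (\<Union>i. E i) \<and> (\<forall>i. bounded (E i) \<and> diameter (E i) \<le> \<delta>)}.
        \<Sum>i. ennreal (unit_ball_vol (real (DIM('a) - 1)) * (diameter (E i) / 2) ^ (DIM('a) - 1)))"

definition surface_measure :: "'a::euclidean_space measure" where
  "surface_measure =
     measure_of UNIV (sets borel) (\<lambda>S. SUP \<delta>\<in>{0<..}. hausdorff_content \<delta> S)"

abbreviation surface_on :: "'a::euclidean_space set \<Rightarrow> 'a measure" where
  "surface_on \<Gamma> \<equiv> restrict_space surface_measure \<Gamma>"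

text \<open>
  The trace operator is the continuous extension to \<open>H1 \<Omega>\<close> of the restriction of smooth
  functions to the boundary, with values in \<open>L2\<close> of the boundary. \<open>has_trace\<close> is its graph.
\<close>

definition has_trace :: "'a::euclidean_space set \<Rightarrow> ('a \<Rightarrow> real) \<Rightarrow> ('a \<Rightarrow> real) \<Rightarrow> bool" where
  "has_trace \<Omega> v g \<longleftrightarrow> g \<in> L2 (surface_on (frontier \<Omega>)) \<and>
     (\<exists>\<phi> :: nat \<Rightarrow> 'a \<Rightarrow> real. (\<forall>n. smooth (\<phi> n)) \<and>
        (\<lambda>n. H1_norm \<Omega> (\<lambda>x. \<phi> n x - v x)) \<longlonglongrightarrow> 0 \<and>
        (\<forall>n. \<phi> n \<in> L2 (surface_on (frontier \<Omega>))) \<and>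
        (\<lambda>n. L2_norm (surface_on (frontier \<Omega>)) (\<lambda>x. \<phi> n x - g x)) \<longlonglongrightarrow> 0)"

text \<open>\<open>has_trace_on \<Omega> \<Gamma> v \<psi>\<close>: \<open>v = \<psi>\<close> on the boundary part \<open>\<Gamma>\<close> in the sense of traces.\<close>

definition has_trace_on ::
  "'a::euclidean_space set \<Rightarrow> 'a set \<Rightarrow> ('a \<Rightarrow> real) \<Rightarrow> ('a \<Rightarrow> real) \<Rightarrow> bool" where
  "has_trace_on \<Omega> \<Gamma> v \<psi> \<longleftrightarrow> (\<exists>g. has_trace \<Omega> v g \<and> (AE x in surface_on \<Gamma>. g x = \<psi> x))"

definition H1_D :: "'a::euclidean_space set \<Rightarrow> 'a set \<Rightarrow> ('a \<Rightarrow> real) set" where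
  "H1_D \<Omega> \<Gamma>D = {v \<in> H1 \<Omega>. has_trace_on \<Omega> \<Gamma>D v (\<lambda>_. 0)}"

text \<open>Traces on \<open>\<Gamma>\<close> of the functions in \<open>V\<close>, with the quotient norm.\<close>

definition trace_space ::
  "'a::euclidean_space set \<Rightarrow> 'a set \<Rightarrow> ('a \<Rightarrow> real) set \<Rightarrow> ('a \<Rightarrow> real) set" where
  "trace_space \<Omega> \<Gamma> V = {\<psi>. \<exists>v\<in>V. has_trace_on \<Omega> \<Gamma> v \<psi>}"

definition trace_norm ::
  "'a::euclidean_space set \<Rightarrow> 'a set \<Rightarrow> ('a \<Rightarrow> real) set \<Rightarrow> ('a \<Rightarrow> real) \<Rightarrow> real" where
  "trace_norm \<Omega> \<Gamma> V \<psi> = Inf {H1_norm \<Omega> v |v. v \<in> V \<and> has_trace_on \<Omega> \<Gamma> v \<psi>}"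

abbreviation H_half :: "'a::euclidean_space set \<Rightarrow> 'a set \<Rightarrow> ('a \<Rightarrow> real) set" where
  "H_half \<Omega> \<Gamma>D \<equiv> trace_space \<Omega> \<Gamma>D (H1 \<Omega>)"

abbreviation H_half_norm :: "'a::euclidean_space set \<Rightarrow> 'a set \<Rightarrow> ('a \<Rightarrow> real) \<Rightarrow> real" where
  "H_half_norm \<Omega> \<Gamma>D \<equiv> trace_norm \<Omega> \<Gamma>D (H1 \<Omega>)"


section \<open>Dual spaces and boundary pairings\<close>

text \<open>
  Bounded linear functionals on a space \<open>V\<close> of functions with a seminorm \<open>N\<close>. Boundedness makes
  them insensitive to changes of the argument by elements of seminorm 0.
\<close>

definition dual :: "('a \<Rightarrow> real) set \<Rightarrow> (('a \<Rightarrow> real) \<Rightarrow> real) \<Rightarrow> (('a \<Rightarrow> real) \<Rightarrow> real) set" where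
  "dual V N = {F. (\<forall>u\<in>V. \<forall>v\<in>V. F (\<lambda>x. u x + v x) = F u + F v) \<and>
                  (\<forall>c. \<forall>v\<in>V. F (\<lambda>x. c * v x) = c * F v) \<and>
                  (\<exists>K. \<forall>v\<in>V. \<bar>F v\<bar> \<le> K * N v)}"

definition dual_norm ::
  "('a \<Rightarrow> real) set \<Rightarrow> (('a \<Rightarrow> real) \<Rightarrow> real) \<Rightarrow> (('a \<Rightarrow> real) \<Rightarrow> real) \<Rightarrow> real" where
  "dual_norm V N F = Sup {\<bar>F v\<bar> |v. v \<in> V \<and> N v \<le> 1}"

definition H_minus1_norm :: "'a::euclidean_space set \<Rightarrow> 'a set \<Rightarrow> ('a \<Rightarrow> real) \<Rightarrow> real" where
  "H_minus1_norm \<Omega> \<Gamma>D f = dual_norm (H1_D \<Omega> \<Gamma>D) (H1_norm \<Omega>) (L2_inner (lebesgue_on \<Omega>) f)"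

abbreviation H_minus_half ::
  "'a::euclidean_space set \<Rightarrow> 'a set \<Rightarrow> 'a set \<Rightarrow> (('a \<Rightarrow> real) \<Rightarrow> real) set" where
  "H_minus_half \<Omega> \<Gamma>D \<Gamma>N \<equiv>
     dual (trace_space \<Omega> \<Gamma>N (H1_D \<Omega> \<Gamma>D)) (trace_norm \<Omega> \<Gamma>N (H1_D \<Omega> \<Gamma>D))"

abbreviation H_minus_half_norm ::
  "'a::euclidean_space set \<Rightarrow> 'a set \<Rightarrow> 'a set \<Rightarrow> (('a \<Rightarrow> real) \<Rightarrow> real) \<Rightarrow> real" where
  "H_minus_half_norm \<Omega> \<Gamma>D \<Gamma>N \<equiv>
     dual_norm (trace_space \<Omega> \<Gamma>N (H1_D \<Omega> \<Gamma>D)) (trace_norm \<Omega> \<Gamma>N (H1_D \<Omega> \<Gamma>D))"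

text \<open>
  For \<open>\<tau> \<in> Hdiv \<Omega>\<close> the normal component on the boundary is the functional given by Green's
  formula: the pairing of \<open>n \<cdot> \<tau>\<close> with the trace of \<open>v \<in> H1 \<Omega>\<close> is \<open>(\<tau>, \<nabla>v) + (\<nabla> \<cdot> \<tau>, v)\<close>.
\<close>

definition normal_pairing ::
  "'a::euclidean_space set \<Rightarrow> ('a \<Rightarrow> 'a) \<Rightarrow> ('a \<Rightarrow> real) \<Rightarrow> real" where
  "normal_pairing \<Omega> \<tau> v =
     L2_inner (lebesgue_on \<Omega>) \<tau> (weak_grad \<Omega> v) + L2_inner (lebesgue_on \<Omega>) (weak_div \<Omega> \<tau>) v"

text \<open>
  \<open>n \<cdot> \<tau> = 0\<close> on \<open>\<Gamma>N\<close>: functions in \<open>H1_D\<close> vanish on the rest of the boundary, so that the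
  pairing with them only sees the normal component on \<open>\<Gamma>N\<close>.
\<close>

definition H_N :: "'a::euclidean_space set \<Rightarrow> 'a set \<Rightarrow> ('a \<Rightarrow> 'a) set" where
  "H_N \<Omega> \<Gamma>D = {\<tau> \<in> Hdiv \<Omega>. \<forall>v \<in> H1_D \<Omega> \<Gamma>D. normal_pairing \<Omega> \<tau> v = 0}"

text \<open>
  The boundary integral of \<open>g\<^sub>D (\<tau> \<cdot> n)\<close> over \<open>\<Gamma>D\<close> for \<open>\<tau> \<in> H_N\<close>: any extension of \<open>g\<^sub>D\<close> to
  \<open>H1 \<Omega>\<close> gives the same value, because two of them differ by an element of \<open>H1_D\<close>.
\<close>

definition pairing_D ::
  "'a::euclidean_space set \<Rightarrow> 'a set \<Rightarrow> ('a \<Rightarrow> real) \<Rightarrow> ('a \<Rightarrow> 'a) \<Rightarrow> real" where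
  "pairing_D \<Omega> \<Gamma>D gD \<tau> = normal_pairing \<Omega> \<tau> (SOME G. G \<in> H1 \<Omega> \<and> has_trace_on \<Omega> \<Gamma>D G gD)"

text \<open>The boundary integral of \<open>g\<^sub>N v\<close> over \<open>\<Gamma>N\<close>: the functional \<open>g\<^sub>N\<close> applied to the trace.\<close>

definition pairing_N ::
  "'a::euclidean_space set \<Rightarrow> 'a set \<Rightarrow> (('a \<Rightarrow> real) \<Rightarrow> real) \<Rightarrow> ('a \<Rightarrow> real) \<Rightarrow> real" where
  "pairing_N \<Omega> \<Gamma>N gN v = gN (SOME \<psi>. has_trace_on \<Omega> \<Gamma>N v \<psi>)"


section \<open>The elliptic problems and the variational problem\<close>

definition mat_sqrt :: "real^'d^'d \<Rightarrow> real^'d^'d" where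
  "mat_sqrt M = (SOME S. transpose S = S \<and> (\<forall>\<xi>. 0 \<le> \<xi> \<bullet> (S *v \<xi>)) \<and> S ** S = M)"

definition primal_solution ::
  "(real^'d) set \<Rightarrow> (real^'d) set \<Rightarrow> (real^'d \<Rightarrow> real^'d^'d) \<Rightarrow> (real^'d \<Rightarrow> real^'d) \<Rightarrow>
   (real^'d \<Rightarrow> real) \<Rightarrow> (real^'d \<Rightarrow> real) \<Rightarrow> (real^'d \<Rightarrow> real) \<Rightarrow> bool" where
  "primal_solution \<Omega> \<Gamma>D A b a f u \<longleftrightarrow> u \<in> H1_D \<Omega> \<Gamma>D \<and> (\<forall>v \<in> H1_D \<Omega> \<Gamma>D.
     L2_inner (lebesgue_on \<Omega>) (\<lambda>x. A x *v weak_grad \<Omega> u x) (weak_grad \<Omega> v)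
     + L2_inner (lebesgue_on \<Omega>) (\<lambda>x. b x \<bullet> weak_grad \<Omega> u x + a x * u x) v
     = L2_inner (lebesgue_on \<Omega>) f v)"

definition dual_solution ::
  "(real^'d) set \<Rightarrow> (real^'d) set \<Rightarrow> (real^'d \<Rightarrow> real^'d^'d) \<Rightarrow> (real^'d \<Rightarrow> real^'d) \<Rightarrow>
   (real^'d \<Rightarrow> real) \<Rightarrow> (real^'d \<Rightarrow> real) \<Rightarrow> (real^'d \<Rightarrow> real) \<Rightarrow> bool" where
  "dual_solution \<Omega> \<Gamma>D A b a f z \<longleftrightarrow> z \<in> H1_D \<Omega> \<Gamma>D \<and> (\<forall>\<phi> \<in> H1_D \<Omega> \<Gamma>D.
     L2_inner (lebesgue_on \<Omega>) (weak_grad \<Omega> \<phi>) (\<lambda>x. A x *v weak_grad \<Omega> z x + z x *\<^sub>R b x)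
     + L2_inner (lebesgue_on \<Omega>) \<phi> (\<lambda>x. a x * z x)
     = L2_inner (lebesgue_on \<Omega>) f \<phi>)"

text \<open>
  Unique solvability with full regularity, where \<open>sol f u\<close> says that \<open>u\<close> solves the problem
  with right-hand side \<open>f\<close>.
\<close>

definition H2_well_posed ::
  "'a::euclidean_space set \<Rightarrow> (('a \<Rightarrow> real) \<Rightarrow> ('a \<Rightarrow> real) \<Rightarrow> bool) \<Rightarrow> bool" where
  "H2_well_posed \<Omega> sol \<longleftrightarrow> (\<exists>C. \<forall>f \<in> L2 (lebesgue_on \<Omega>). \<exists>u. sol f u \<and>
     (\<forall>u'. sol f u' \<longrightarrow> (AE x in lebesgue_on \<Omega>. u' x = u x)) \<and>
     u \<in> H2 \<Omega> \<and> H2_norm \<Omega> u \<le> C * L2_norm (lebesgue_on \<Omega>) f)"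

definition bform ::
  "(real^'d) set \<Rightarrow> (real^'d \<Rightarrow> real^'d^'d) \<Rightarrow> (real^'d \<Rightarrow> real^'d) \<Rightarrow> (real^'d \<Rightarrow> real) \<Rightarrow>
   (real^'d \<Rightarrow> real^'d) \<Rightarrow> (real^'d \<Rightarrow> real) \<Rightarrow> (real^'d \<Rightarrow> real^'d) \<Rightarrow> (real^'d \<Rightarrow> real) \<Rightarrow> real" where
  "bform \<Omega> A b a \<eta> w \<tau> v =
     L2_inner (lebesgue_on \<Omega>)
       (\<lambda>x. \<eta> x - (A x *v weak_grad \<Omega> w x + w x *\<^sub>R b x))
       (\<lambda>x. matrix_inv (A x) *v \<tau> x - (weak_grad \<Omega> v x + v x *\<^sub>R (matrix_inv (A x) *v b x)))
   + L2_inner (lebesgue_on \<Omega>)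
       (\<lambda>x. inverse (a x) * weak_div \<Omega> \<eta> x - w x)
       (\<lambda>x. weak_div \<Omega> \<tau> x - a x * v x)"

definition fform ::
  "(real^'d) set \<Rightarrow> (real^'d) set \<Rightarrow> (real^'d) set \<Rightarrow>
   (real^'d \<Rightarrow> real) \<Rightarrow> (real^'d \<Rightarrow> real) \<Rightarrow> ((real^'d \<Rightarrow> real) \<Rightarrow> real) \<Rightarrow>
   (real^'d \<Rightarrow> real^'d) \<Rightarrow> (real^'d \<Rightarrow> real) \<Rightarrow> real" where
  "fform \<Omega> \<Gamma>D \<Gamma>N f gD gN \<tau> v =
     L2_inner (lebesgue_on \<Omega>) f v - pairing_N \<Omega> \<Gamma>N gN v - pairing_D \<Omega> \<Gamma>D gD \<tau>"

definition variational_solution ::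
  "(real^'d) set \<Rightarrow> (real^'d) set \<Rightarrow> (real^'d) set \<Rightarrow>
   (real^'d \<Rightarrow> real^'d^'d) \<Rightarrow> (real^'d \<Rightarrow> real^'d) \<Rightarrow> (real^'d \<Rightarrow> real) \<Rightarrow>
   (real^'d \<Rightarrow> real) \<Rightarrow> (real^'d \<Rightarrow> real) \<Rightarrow> ((real^'d \<Rightarrow> real) \<Rightarrow> real) \<Rightarrow>
   (real^'d \<Rightarrow> real^'d) \<Rightarrow> (real^'d \<Rightarrow> real) \<Rightarrow> bool" where
  "variational_solution \<Omega> \<Gamma>D \<Gamma>N A b a f gD gN \<eta> w \<longleftrightarrow>
     \<eta> \<in> H_N \<Omega> \<Gamma>D \<and> w \<in> H1_D \<Omega> \<Gamma>D \<and>
     (\<forall>\<tau> \<in> H_N \<Omega> \<Gamma>D. \<forall>v \<in> H1_D \<Omega> \<Gamma>D.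
        bform \<Omega> A b a \<eta> w \<tau> v = fform \<Omega> \<Gamma>D \<Gamma>N f gD gN \<tau> v)"

text \<open>
  Where \<open>a\<close> is negative, its square roots are imaginary and only their moduli enter the norm;
  hence the absolute values.
\<close>

definition energy_norm ::
  "(real^'d) set \<Rightarrow> (real^'d \<Rightarrow> real^'d^'d) \<Rightarrow> (real^'d \<Rightarrow> real) \<Rightarrow>
   (real^'d \<Rightarrow> real^'d) \<Rightarrow> (real^'d \<Rightarrow> real) \<Rightarrow> real" where
  "energy_norm \<Omega> A a \<tau> v = sqrt (
     (L2_norm (lebesgue_on \<Omega>) (\<lambda>x. sqrt \<bar>a x\<bar> * v x))\<^sup>2
   + (L2_norm (lebesgue_on \<Omega>) (\<lambda>x. mat_sqrt (A x) *v weak_grad \<Omega> v x))\<^sup>2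
   + (L2_norm (lebesgue_on \<Omega>) (\<lambda>x. matrix_inv (mat_sqrt (A x)) *v \<tau> x))\<^sup>2
   + (L2_norm (lebesgue_on \<Omega>) (\<lambda>x. inverse (sqrt \<bar>a x\<bar>) * weak_div \<Omega> \<tau> x))\<^sup>2)"

end

theory Submission
  imports Defs
begin

text \<open>
  For a function \<open>u \<in> H1\<close> solving the original problem weakly, with \<open>u = g\<^sub>D\<close> on \<open>\<Gamma>D\<close> and flux
  data \<open>g\<^sub>N\<close>, the form \<open>b(\<eta>, w; \<tau>, v)\<close> equals \<open>(f, v) - g\<^sub>N(v) - \<langle>u, \<tau> \<cdot> n\<rangle>\<close> as soon as
  \<open>\<eta> - (A \<nabla> + b) w = - A \<nabla>u\<close> and \<open>div \<eta> - a w = - a u\<close>. The map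
  \<open>(\<tau>, v) \<mapsto> (\<tau> - (A \<nabla> + b) v, div \<tau> - a v)\<close> is onto \<open>L2 \<times> L2\<close>, because \<open>v\<close> only has to solve a dual
  problem; this gives existence, and uniqueness follows by testing with a preimage of the
  residuals. Both uses need the primal and dual problems for right-hand sides in the dual of
  \<open>H1_D\<close>: the primal one is a Riesz problem for a symmetric form plus an \<open>L2\<close> correction covered
  by the assumed solvability, the dual one follows by transposition.

  The Riesz theorem needs \<open>H1_D\<close> to be complete, which is the trace inequality
  \<open>\<parallel>\<phi>\<parallel> \<le> C \<parallel>\<phi>\<parallel>\<^sub>H\<^sub>1\<close> for the Hausdorff measure on the boundary. A Vitali covering bounds the Hausdorff
  content of a piece of a Lipschitz graph by \<open>1/\<epsilon>\<close> times the volume of a strip of height \<open>\<epsilon>\<close>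
  above it, and the integral over the strip is the difference of integrals over \<open>\<Omega>\<close> and a
  translate of \<open>\<Omega>\<close>, hence of order \<open>\<epsilon>\<close> times the integral of a directional derivative.
\<close>

section \<open>Smooth functions and bump functions\<close>

text \<open>With L(\<tau>, v) = (\<tau> - (A \<nabla> + b) v, div \<tau> - a v), the form pairs
  L(\<eta>, w) with L(\<tau>, v) under the weights A inverse and 1/a. Where a is negative the second
  weight is negative too, so the form is not coercive and Lax-Milgram does not apply; a bounded
  right inverse of L takes the place of coercivity.

  The two elliptic problems cannot be treated alike. Their common form differs from a coercive
  symmetric one by (b . \<nabla>u, v) and terms of order zero. For a given u this is an
  \<open>L2\<close> functional of v, but for a given v it acts on \<nabla>u, and b is merely
  bounded, so no integration by parts removes the gradient. Hence the detour through transposition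
  for the dual problem.

  The norm of the Dirichlet datum is an infimum over lifts G to \<open>H1\<close>. The solution is
  bounded for every single lift, and uniqueness identifies the solutions belonging to different
  lifts.

  Elements of function spaces are functions rather than classes, so weak gradients, traces and
  solution operators are linear only up to null functions, and inner products are
  semidefinite.\<close>

lemma Ck_SucD: "Ck (Suc k) \<phi> \<Longrightarrow> Ck k \<phi>"
proof (induction k arbitrary: \<phi>)
  case 0
  then show ?case
    by (auto intro!: continuous_at_imp_continuous_on differentiable_imp_continuous_within)
next
  case (Suc k)
  then show ?case
    by (metis Ck.simps(2))
qed

lemma frechet_derivative_eq: "(f has_derivative f') (at x) \<Longrightarrow> frechet_derivative f (at x) = f'"
  by (metis frechet_derivative_at)

lemma Ck_SucI:
  assumes "\<And>x. (\<phi> has_derivative D x) (at x)" and "\<And>i. i \<in> Basis \<Longrightarrow> Ck k (\<lambda>x. D x i)"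
  shows "Ck (Suc k) \<phi>"
  using assms by (auto simp: frechet_derivative_eq[OF assms(1)] differentiable_def)

lemma Ck_const: "Ck k (\<lambda>_. c)"
proof (induction k arbitrary: c)
  case (Suc k)
  show ?case by (rule Ck_SucI[where D="\<lambda>_ _. 0"]) (auto intro: Suc)
qed auto

lemma Ck_add: "Ck k f \<Longrightarrow> Ck k g \<Longrightarrow> Ck k (\<lambda>x. f x + g x)"
proof (induction k arbitrary: f g)
  case (Suc k)
  show ?case
    by (rule Ck_SucI[where D="\<lambda>x i. frechet_derivative f (at x) i + frechet_derivative g (at x) i"])
       (use Suc in \<open>auto intro!: has_derivative_add simp: frechet_derivative_works[symmetric]\<close>)
qed (auto intro: continuous_intros)

lemma Ck_mult: "Ck k f \<Longrightarrow> Ck k g \<Longrightarrow> Ck k (\<lambda>x. f x * g x)"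
proof (induction k arbitrary: f g)
  case (Suc k)
  have "Ck k f" "Ck k g"
    using Suc.prems by (auto intro: Ck_SucD simp del: Ck.simps)
  then show ?case
    by (intro Ck_SucI[where D="\<lambda>x i. f x * frechet_derivative g (at x) i + frechet_derivative f (at x) i * g x"])
       (use Suc in \<open>auto intro!: has_derivative_mult Ck_add Suc.IH simp: frechet_derivative_works[symmetric]\<close>)
qed (auto intro: continuous_intros)

lemma Ck_prod: "(\<And>i. i \<in> I \<Longrightarrow> Ck k (f i)) \<Longrightarrow> Ck k (\<lambda>x. \<Prod>i\<in>I. f i x)"
  by (induction I rule: infinite_finite_induct) (auto intro: Ck_const Ck_mult)

lemma smooth_const: "smooth (\<lambda>_. c)"
  by (simp add: smooth_def Ck_const)

lemma smooth_add: "smooth f \<Longrightarrow> smooth g \<Longrightarrow> smooth (\<lambda>x. f x + g x)"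
  by (simp add: smooth_def Ck_add)

lemma smooth_mult: "smooth f \<Longrightarrow> smooth g \<Longrightarrow> smooth (\<lambda>x. f x * g x)"
  by (simp add: smooth_def Ck_mult)

lemma smooth_scale: "smooth f \<Longrightarrow> smooth (\<lambda>x. c * f x)"
  by (simp add: smooth_mult smooth_const)

lemma smooth_deriv: "smooth f \<Longrightarrow> i \<in> Basis \<Longrightarrow> smooth (\<lambda>x. frechet_derivative f (at x) i)"
  unfolding smooth_def by (metis Ck.simps(2))

lemma smooth_continuous: "smooth f \<Longrightarrow> continuous_on S f"
  unfolding smooth_def by (metis Ck.simps(1) continuous_on_subset subset_UNIV)

lemma smooth_differentiable: "smooth f \<Longrightarrow> f differentiable (at x)"
  unfolding smooth_def by (metis Ck.simps(2))

lemma smooth_has_derivative: "smooth f \<Longrightarrow> (f has_derivative (\<lambda>h. grad f x \<bullet> h)) (at x)"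
proof -
  assume "smooth f"
  then have *: "(f has_derivative frechet_derivative f (at x)) (at x)"
    using smooth_differentiable frechet_derivative_works by blast
  then interpret bounded_linear "frechet_derivative f (at x)" by (rule has_derivative_bounded_linear)
  have "frechet_derivative f (at x) h = grad f x \<bullet> h" for h
  proof -
    have "frechet_derivative f (at x) h = frechet_derivative f (at x) (\<Sum>i\<in>Basis. (h \<bullet> i) *\<^sub>R i)"
      by (simp add: euclidean_representation)
    also have "\<dots> = grad f x \<bullet> h"
      unfolding grad_def inner_sum_left by (simp add: sum scale inner_commute mult.commute)
    finally show ?thesis .
  qed
  then show ?thesis using * by (metis (no_types, lifting) has_derivative_transform_eventually ext)
qed

lemma grad_eqI:
  assumes "(f has_derivative (\<lambda>h. p \<bullet> h)) (at x)" shows "grad f x = p"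
  unfolding grad_def frechet_derivative_eq[OF assms]
  by (simp add: euclidean_representation)

lemma continuous_grad: "smooth f \<Longrightarrow> continuous_on S (grad f)"
  unfolding grad_def by (intro continuous_intros smooth_continuous smooth_deriv)

lemma grad_add: "smooth f \<Longrightarrow> smooth g \<Longrightarrow> grad (\<lambda>x. f x + g x) x = grad f x + grad g x"
  by (intro grad_eqI) (auto intro!: derivative_eq_intros smooth_has_derivative simp: inner_add_left)

lemma grad_mult: "smooth f \<Longrightarrow> smooth g \<Longrightarrow> grad (\<lambda>x. f x * g x) x = f x *\<^sub>R grad g x + g x *\<^sub>R grad f x"
  by (intro grad_eqI) (auto intro!: derivative_eq_intros smooth_has_derivative simp: inner_add_left)

lemma grad_diff: "smooth f \<Longrightarrow> smooth g \<Longrightarrow> grad (\<lambda>x. f x - g x) x = grad f x - grad g x"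
  by (intro grad_eqI) (auto intro!: derivative_eq_intros smooth_has_derivative simp: inner_diff_left)

lemma grad_const: "grad (\<lambda>_. c) x = 0"
  by (intro grad_eqI) auto

text \<open>Differentiation maps this family into its own span, which gives smoothness by induction.\<close>

definition flat :: "nat \<Rightarrow> real \<Rightarrow> real" where
  "flat m t = (if t > 0 then exp (- 1 / t) / t ^ m else 0)"

text \<open>Under s = 1/t the limit from the right is that of s^m exp(-s) as s tends to
  infinity.\<close>

lemma flat_tendsto_0: "(flat m \<longlongrightarrow> 0) (at 0)"
proof -
  have *: "((\<lambda>t::real. inverse t ^ m / exp (inverse t)) \<longlongrightarrow> 0) (at_right 0)"
    by (rule filterlim_compose[OF tendsto_power_div_exp_0 filterlim_inverse_at_top_right])
  have "(flat m \<longlongrightarrow> 0) (at_right 0)"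
    by (rule Lim_transform_eventually[OF *])
       (auto simp: eventually_at_right_less flat_def exp_minus field_simps intro!: eventually_at_right_less[THEN eventually_mono])
  moreover have "(flat m \<longlongrightarrow> 0) (at_left 0)"
    by (rule tendsto_eventually) (auto simp: flat_def eventually_at_left_field intro!: exI[of _ "-1"])
  ultimately show ?thesis by (simp add: filterlim_split_at)
qed

lemma flat_deriv: "(flat m has_field_derivative flat (m+2) t - m * flat (m+1) t) (at t)"
proof -
  consider "t > 0" | "t < 0" | "t = 0" by linarith
  then show ?thesis
  proof cases
    case 1
    have "((\<lambda>t. exp (- 1 / t) / t ^ m) has_field_derivative flat (m+2) t - m * flat (m+1) t) (at t)"
      using 1 by (auto intro!: derivative_eq_intros simp: flat_def)
         (cases m; simp add: field_simps power2_eq_square)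
    then show ?thesis
      by (rule DERIV_cong_ev[THEN iffD1, rotated -1])
         (use 1 eventually_nhds_in_open[of "{0<..}" t] in \<open>auto elim!: eventually_mono simp: flat_def\<close>)
  next
    case 2
    have "((\<lambda>t. 0) has_field_derivative flat (m+2) t - m * flat (m+1) t) (at t)"
      using 2 by (auto simp: flat_def)
    then show ?thesis
      by (rule DERIV_cong_ev[THEN iffD1, rotated -1])
         (use 2 eventually_nhds_in_open[of "{..<0}" t] in \<open>auto elim!: eventually_mono simp: flat_def\<close>)
  next
    case 3
    \<comment> \<open>At the origin the difference quotient is \<open>flat (Suc m) h\<close>, whose
      limit is already known.\<close>
    have "((\<lambda>h. flat m h / h) \<longlongrightarrow> 0) (at 0)"
      by (rule Lim_transform_eventually[OF flat_tendsto_0[of "Suc m"]])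
         (auto simp: flat_def eventually_at_filter field_simps)
    then show ?thesis using 3 by (simp add: DERIV_def flat_def)
  qed
qed

lemma smooth_flat_affine: "smooth (\<lambda>x. flat m (c \<bullet> x + d))"
proof -
  have "Ck k (\<lambda>x. flat m (c \<bullet> x + d))" for k
  proof (induction k arbitrary: m)
    case 0
    have "continuous_on UNIV (flat m)"
      using flat_deriv by (intro continuous_at_imp_continuous_on) (auto intro: DERIV_isCont)
    then show ?case
      by (auto intro!: continuous_intros continuous_on_compose2[of UNIV "flat m"])
  next
    case (Suc k)
    show ?case
    proof (rule Ck_SucI)
      fix x :: 'a
      show "((\<lambda>x. flat m (c \<bullet> x + d)) has_derivative
         (\<lambda>h. (flat (m+2) (c \<bullet> x + d) + (- m) * flat (m+1) (c \<bullet> x + d)) * (c \<bullet> h))) (at x)"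
        by (rule has_derivative_eq_rhs[OF has_derivative_compose[OF _ flat_deriv[unfolded has_field_derivative_def]]])
           (auto intro!: derivative_eq_intros)
    qed (use Suc in \<open>intro Ck_mult Ck_add Ck_const\<close>, auto)
  qed
  then show ?thesis by (simp add: smooth_def)
qed

text \<open>Inside the box each factor is exp(-1/(n t)) with t the distance to a face. For n > 0 the
  scaling by n leaves the support unchanged and makes the values inside tend to 1, so the bumps
  approximate the indicator of an open box.\<close>

definition bump :: "nat \<Rightarrow> 'a::euclidean_space \<Rightarrow> 'a \<Rightarrow> 'a \<Rightarrow> real" where
  "bump n a b x = (\<Prod>i\<in>Basis. flat 0 (real n * (x \<bullet> i - a \<bullet> i)) * flat 0 (real n * (b \<bullet> i - x \<bullet> i)))"

lemma smooth_bump: "smooth (bump n a b)"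
proof -
  have 1: "smooth (\<lambda>x. flat 0 (real n * (x \<bullet> i - a \<bullet> i)))" for i
    using smooth_flat_affine[of 0 "real n *\<^sub>R i" "- real n * (a \<bullet> i)"]
    by (simp add: algebra_simps inner_commute)
  have 2: "smooth (\<lambda>x. flat 0 (real n * (b \<bullet> i - x \<bullet> i)))" for i
    using smooth_flat_affine[of 0 "- real n *\<^sub>R i" "real n * (b \<bullet> i)"]
    by (simp add: algebra_simps inner_commute)
  show ?thesis
    unfolding bump_def[abs_def] smooth_def
    by (intro allI Ck_prod Ck_mult) (use 1 2 in \<open>auto simp: smooth_def\<close>)
qed

lemma flat_0_bounds: "0 \<le> flat 0 t" "flat 0 t \<le> 1"
  by (auto simp: flat_def)

lemma bump_bounds: "0 \<le> bump n a b x" "bump n a b x \<le> 1"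
  unfolding bump_def by (auto intro!: prod_nonneg prod_le_1 mult_nonneg_nonneg mult_le_one flat_0_bounds)

lemma flat_0_pos_iff: "flat 0 t \<noteq> 0 \<longleftrightarrow> t > 0"
  by (auto simp: flat_def)

lemma bump_nonzero_iff: "n > 0 \<Longrightarrow> bump n a b x \<noteq> 0 \<longleftrightarrow> x \<in> box a b"
  unfolding bump_def
  by (auto simp: flat_0_pos_iff mem_box zero_less_mult_iff)

lemma bump_support_subset: "n > 0 \<Longrightarrow> closure {x. bump n a b x \<noteq> 0} \<subseteq> cbox a b"
  by (simp add: bump_nonzero_iff box_subset_cbox closure_minimal closed_cbox)

lemma test_function_bump: 
  assumes "n > 0" "cbox a b \<subseteq> \<Omega>" shows "test_function \<Omega> (bump n a b)"
proof -
  have "compact (closure {x. bump n a b x \<noteq> 0})"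
    using bump_support_subset[OF assms(1), of a b]
    by (meson bounded_cbox bounded_subset closed_closure compact_eq_bounded_closed)
  then show ?thesis
    using smooth_bump bump_support_subset[OF assms(1)] assms(2) unfolding test_function_def by blast
qed

lemma bump_tendsto_indicator: "(\<lambda>n. bump (Suc n) a b x) \<longlonglongrightarrow> indicator (box a b) x"
proof (cases "x \<in> box a b")
  case True
  have flat: "(\<lambda>n. flat 0 (real (Suc n) * t)) \<longlonglongrightarrow> 1" if "t > 0" for t
  proof -
    have "(\<lambda>n. exp (- ((1/t) * inverse (real (Suc n))))) \<longlonglongrightarrow> exp (- ((1/t) * 0))"
      by (intro tendsto_intros LIMSEQ_inverse_real_of_nat)
    then have "(\<lambda>n. exp (- ((1/t) * inverse (real (Suc n))))) \<longlonglongrightarrow> 1" by simp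
    then have lim: "(\<lambda>n. exp (- 1 / (real (Suc n) * t))) \<longlonglongrightarrow> 1" by (simp add: field_simps)
    have "0 < real (Suc n) * t" for n using that by simp
    then have "flat 0 (real (Suc n) * t) = exp (- 1 / (real (Suc n) * t))" for n
      unfolding flat_def by (simp del: of_nat_Suc)
    with lim show ?thesis by simp
  qed
  have "(\<lambda>n. bump (Suc n) a b x) \<longlonglongrightarrow> (\<Prod>i\<in>(Basis::'a set). 1 * 1)"
    unfolding bump_def using True by (intro tendsto_prod tendsto_mult flat) (auto simp: mem_box)
  then show ?thesis using True by simp
next
  case False
  then have "bump (Suc n) a b x = 0" for n using bump_nonzero_iff[of "Suc n" a b x] by auto
  then show ?thesis using False by simp
qed

section \<open>Square-integrable functions\<close>

lemma quadratic_nonneg_imp: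
  fixes B D E :: real
  assumes "\<And>t. 0 \<le> B * t\<^sup>2 + 2 * D * t + E" and "0 \<le> B"
  shows "D\<^sup>2 \<le> B * E"
proof (cases "B = 0")
  case True
  have "D = 0"
  proof (rule ccontr)
    assume "D \<noteq> 0"
    \<comment> \<open>This t makes the affine function 2 D t + E equal to -1.\<close>
    then show False using assms(1)[of "- (E + 1) / (2 * D)"] True by (simp add: field_simps)
  qed
  then show ?thesis using True by simp
next
  case False
  then have "0 \<le> E - D\<^sup>2 / B"
    using assms(1)[of "- D / B"] by (simp add: field_simps power2_eq_square)
  then show ?thesis using False assms(2) by (simp add: field_simps)
qed

text \<open>A carrier set with explicit operations, because the spaces in question are sets of
  functions modulo null functions and their forms are only semidefinite. The locale is instantiated
  by \<open>L2\<close>, \<open>H1\<close>, \<open>H1_D\<close> and by vectors with a positive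
  semidefinite matrix.\<close>

locale semi_inner_space =
  fixes V :: "'v set" and add :: "'v \<Rightarrow> 'v \<Rightarrow> 'v" and scale :: "real \<Rightarrow> 'v \<Rightarrow> 'v"
    and ip :: "'v \<Rightarrow> 'v \<Rightarrow> real"
  assumes nonempty: "V \<noteq> {}"
    and add_closed: "u \<in> V \<Longrightarrow> v \<in> V \<Longrightarrow> add u v \<in> V"
    and scale_closed: "u \<in> V \<Longrightarrow> scale c u \<in> V"
    and ip_sym: "u \<in> V \<Longrightarrow> v \<in> V \<Longrightarrow> ip u v = ip v u"
    and ip_add: "u \<in> V \<Longrightarrow> v \<in> V \<Longrightarrow> w \<in> V \<Longrightarrow> ip (add u v) w = ip u w + ip v w"
    and ip_scale: "u \<in> V \<Longrightarrow> w \<in> V \<Longrightarrow> ip (scale c u) w = c * ip u w"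
    and ip_nonneg: "u \<in> V \<Longrightarrow> 0 \<le> ip u u"
begin

definition nrm :: "'v \<Rightarrow> real" where "nrm u = sqrt (ip u u)"

definition sub :: "'v \<Rightarrow> 'v \<Rightarrow> 'v" where "sub u v = add u (scale (-1) v)"

lemma sub_closed: "u \<in> V \<Longrightarrow> v \<in> V \<Longrightarrow> sub u v \<in> V"
  by (simp add: sub_def add_closed scale_closed)

lemma ip_add_right: "u \<in> V \<Longrightarrow> v \<in> V \<Longrightarrow> w \<in> V \<Longrightarrow> ip w (add u v) = ip w u + ip w v"
  by (metis ip_add ip_sym add_closed)

lemma ip_scale_right: "u \<in> V \<Longrightarrow> w \<in> V \<Longrightarrow> ip w (scale c u) = c * ip w u"
  by (metis ip_scale ip_sym scale_closed)

lemma nrm_nonneg: "u \<in> V \<Longrightarrow> 0 \<le> nrm u"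
  by (simp add: nrm_def ip_nonneg)

lemma nrm_square: "u \<in> V \<Longrightarrow> (nrm u)\<^sup>2 = ip u u"
  by (simp add: nrm_def ip_nonneg)

lemma ip_expand:
  assumes "u \<in> V" "v \<in> V"
  shows "ip (add u (scale t v)) (add u (scale t v)) = ip v v * t\<^sup>2 + 2 * ip u v * t + ip u u"
  using assms
  by (simp add: ip_add ip_add_right ip_scale ip_scale_right add_closed scale_closed ip_sym[of v u]
      power2_eq_square algebra_simps)

lemma Cauchy_Schwarz:
  assumes "u \<in> V" "v \<in> V" shows "\<bar>ip u v\<bar> \<le> nrm u * nrm v"
proof -
  have "(ip u v)\<^sup>2 \<le> ip v v * ip u u"
  proof (rule quadratic_nonneg_imp)
    fix t
    show "0 \<le> ip v v * t\<^sup>2 + 2 * ip u v * t + ip u u"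
      using ip_expand[OF assms, of t] ip_nonneg[of "add u (scale t v)"] assms
      by (simp add: add_closed scale_closed)
  qed (use assms ip_nonneg in auto)
  then have "sqrt ((ip u v)\<^sup>2) \<le> sqrt (ip v v * ip u u)" by (rule real_sqrt_le_mono)
  then show ?thesis by (simp add: real_sqrt_mult nrm_def mult.commute)
qed

lemma nrm_add: 
  assumes "u \<in> V" "v \<in> V" shows "nrm (add u v) \<le> nrm u + nrm v"
proof (rule power2_le_imp_le)
  show "(nrm (add u v))\<^sup>2 \<le> (nrm u + nrm v)\<^sup>2"
    using assms Cauchy_Schwarz[OF assms]
    by (simp add: nrm_square add_closed ip_add ip_add_right power2_sum ip_sym[of v u])
qed (use assms nrm_nonneg in auto)

lemma nrm_scale: "u \<in> V \<Longrightarrow> nrm (scale c u) = \<bar>c\<bar> * nrm u"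
  by (simp add: nrm_def ip_scale ip_scale_right scale_closed real_sqrt_mult mult.assoc[symmetric])

lemma nrm_sub: "u \<in> V \<Longrightarrow> v \<in> V \<Longrightarrow> nrm (sub u v) \<le> nrm u + nrm v"
  using nrm_add[of u "scale (-1) v"] by (simp add: sub_def scale_closed nrm_scale)

definition complete_space :: bool where
  "complete_space \<longleftrightarrow> (\<forall>X :: nat \<Rightarrow> 'v. (\<forall>n. X n \<in> V) \<longrightarrow>
     (\<forall>e>0. \<exists>N. \<forall>m\<ge>N. \<forall>n\<ge>N. nrm (sub (X m) (X n)) < e) \<longrightarrow>
     (\<exists>l\<in>V. (\<lambda>n. nrm (sub (X n) l)) \<longlonglongrightarrow> 0))"

text \<open>The representative is the limit of a minimising sequence of \<open>ip u u - 2 F u\<close>.\<close>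

theorem Riesz_representation:
  assumes complete: complete_space
    and F_add: "\<And>u v. u \<in> V \<Longrightarrow> v \<in> V \<Longrightarrow> F (add u v) = F u + F v"
    and F_scale: "\<And>c u. u \<in> V \<Longrightarrow> F (scale c u) = c * F u"
    and F_bounded: "\<And>u. u \<in> V \<Longrightarrow> \<bar>F u\<bar> \<le> K * nrm u"
  shows "\<exists>u\<in>V. (\<forall>v\<in>V. ip u v = F v) \<and> nrm u \<le> \<bar>K\<bar>"
proof -
  define J where "J u = ip u u - 2 * F u" for u
  define m where "m = Inf (J ` V)"
  \<comment> \<open>With N = \<open>nrm u\<close> one has J u \<ge> N^2 - 2 K N = (N - K)^2 -
    K^2.\<close>
  have J_lower: "- K\<^sup>2 \<le> J u" if "u \<in> V" for u
  proof -
    have "0 \<le> (nrm u - K)\<^sup>2" by simp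
    moreover have "F u \<le> K * nrm u" using F_bounded[OF that] by linarith
    ultimately show ?thesis
      unfolding J_def nrm_square[OF that, symmetric] by (simp add: power2_diff algebra_simps)
  qed
  have bdd: "bdd_below (J ` V)" using J_lower by (auto intro!: bdd_belowI)
  have m_le: "m \<le> J u" if "u \<in> V" for u
    unfolding m_def using that bdd by (auto intro: cInf_lower)
  have "\<exists>u\<in>V. J u < m + 1 / real (Suc n)" for n
    using cInf_lessD[of "J ` V" "m + 1 / real (Suc n)"] nonempty by (auto simp: m_def)
  then obtain X where X: "\<And>n. X n \<in> V" "\<And>n. J (X n) < m + 1 / real (Suc n)" by metis
  have J_line: "J (add u (scale t v)) = ip v v * t\<^sup>2 + 2 * (ip u v - F v) * t + J u"
    if "u \<in> V" "v \<in> V" for u v t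
    using that unfolding J_def by (simp add: ip_expand F_add F_scale scale_closed algebra_simps)
  \<comment> \<open>Parallelogram law with the midpoint w: the squared distance equals 2 J u + 2 J v
    - 4 J w, and J w \<ge> m. It makes the minimising sequence Cauchy.\<close>
  have parallelogram: "(nrm (sub u v))\<^sup>2 \<le> 2 * (J u - m) + 2 * (J v - m)" if "u \<in> V" "v \<in> V" for u v
  proof -
    define w where "w = scale (1/2) (add u v)"
    have "(nrm (sub u v))\<^sup>2 = 2 * J u + 2 * J v - 4 * J w"
      using that unfolding J_def w_def
      by (simp add: nrm_square sub_closed F_add F_scale add_closed ip_scale ip_scale_right scale_closed 
          ip_add ip_add_right sub_def ip_sym[of v u] field_simps)
    moreover have "m \<le> J w" unfolding w_def using that by (intro m_le scale_closed add_closed)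
    ultimately show ?thesis by (simp add: right_diff_distrib)
  qed
  have "\<exists>N. \<forall>k\<ge>N. \<forall>n\<ge>N. nrm (sub (X k) (X n)) < e" if e: "e > 0" for e
  proof -
    have "0 < e\<^sup>2 / 4" using e by simp
    then obtain N where N: "1 / real (Suc N) < e\<^sup>2 / 4"
      using nat_approx_posE by metis
    have le: "J (X k) - m < e\<^sup>2 / 4" if "k \<ge> N" for k
    proof -
      have "1 / real (Suc k) \<le> 1 / real (Suc N)" using that by (simp add: frac_le)
      then show ?thesis using X(2)[of k] N by linarith
    qed
    have "nrm (sub (X k) (X n)) < e" if "k \<ge> N" "n \<ge> N" for k n
      using parallelogram[OF X(1) X(1), of k n] le[OF that(1)] le[OF that(2)] \<open>e > 0\<close>
      by (intro power2_less_imp_less[of _ e]) auto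
    then show ?thesis by blast
  qed
  then obtain l where l: "l \<in> V" "(\<lambda>n. nrm (sub (X n) l)) \<longlonglongrightarrow> 0"
    using complete X(1) unfolding complete_space_def by blast
  have "ip l v = F v" if v: "v \<in> V" for v
  proof -
    \<comment> \<open>A quantitative Euler equation: J (X n + t v) - m is a nonnegative quadratic in
      t, so its discriminant bounds the defect of the equation by the distance of J (X n) from the
      infimum.\<close>
    have bound: "(ip (X n) v - F v)\<^sup>2 \<le> ip v v * (1 / real (Suc n))" for n
    proof -
      have "(ip (X n) v - F v)\<^sup>2 \<le> ip v v * (J (X n) - m)"
      proof (rule quadratic_nonneg_imp)
        fix t
        have "m \<le> J (add (X n) (scale t v))" by (intro m_le add_closed scale_closed X v)
        then show "0 \<le> ip v v * t\<^sup>2 + 2 * (ip (X n) v - F v) * t + (J (X n) - m)"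
          using J_line[OF X(1) v] by simp
      qed (rule ip_nonneg[OF v])
      also have "\<dots> \<le> ip v v * (1 / real (Suc n))"
        using X(2)[of n] by (intro mult_left_mono ip_nonneg v) linarith
      finally show ?thesis .
    qed
    have "(\<lambda>n. (ip (X n) v - F v)\<^sup>2) \<longlonglongrightarrow> 0"
    proof (rule tendsto_sandwich[OF _ _ tendsto_const])
      show "(\<lambda>n. ip v v * (1 / real (Suc n))) \<longlonglongrightarrow> 0"
        using tendsto_mult[OF tendsto_const LIMSEQ_inverse_real_of_nat] by (simp add: field_simps)
    qed (use bound in auto)
    then have 1: "(\<lambda>n. ip (X n) v - F v) \<longlonglongrightarrow> 0"
      using tendsto_real_sqrt[of "\<lambda>n. (ip (X n) v - F v)\<^sup>2" 0 sequentially]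
      by (simp add: tendsto_rabs_zero_iff)
    have "(\<lambda>n. ip (sub (X n) l) v) \<longlonglongrightarrow> 0"
    proof (rule Lim_null_comparison)
      show "(\<lambda>n. nrm (sub (X n) l) * nrm v) \<longlonglongrightarrow> 0" using l(2) by (rule tendsto_mult_left_zero)
    qed (use Cauchy_Schwarz sub_closed X l v in auto)
    moreover have "ip (sub (X n) l) v = ip (X n) v - ip l v" for n
      using X l v by (simp add: sub_def ip_add ip_scale scale_closed)
    ultimately have 2: "(\<lambda>n. ip (X n) v - ip l v) \<longlonglongrightarrow> 0" by simp
    have "(\<lambda>n. (ip (X n) v - F v) - (ip (X n) v - ip l v)) \<longlonglongrightarrow> 0 - 0"
      by (rule tendsto_diff[OF 1 2])
    then show ?thesis by (simp add: LIMSEQ_const_iff)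
  qed
  moreover have "nrm l \<le> \<bar>K\<bar>"
  proof -
    have "(nrm l)\<^sup>2 = F l" using calculation l by (simp add: nrm_square)
    also have "\<dots> \<le> K * nrm l" using F_bounded[OF l(1)] by linarith
    also have "\<dots> \<le> \<bar>K\<bar> * nrm l" using nrm_nonneg[OF l(1)] by (simp add: mult_right_mono)
    finally show ?thesis using nrm_nonneg[OF l(1)]
      by (cases "nrm l = 0") (auto simp: power2_eq_square)
  qed
  ultimately show ?thesis using l(1) by blast
qed

end

section \<open>Elementary properties and completeness of \<open>L2\<close>\<close>

lemma L2_measurable: "f \<in> L2 M \<Longrightarrow> f \<in> borel_measurable M"
  by (simp add: L2_def)

lemma L2_integrable_square: "f \<in> L2 M \<Longrightarrow> integrable M (\<lambda>x. (norm (f x))\<^sup>2)"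
  by (simp add: L2_def)

text \<open>No measurability of g is asked for: if its square is not integrable, the integral, and
  with it \<open>L2_norm\<close>, is 0 by convention. This admits integrands built from
  \<open>mat_sqrt (A x)\<close>, which is a pointwise choice.\<close>

lemma L2_norm_le_AE:
  assumes "f \<in> L2 M" "AE x in M. norm (g x) \<le> K * norm (f x)"
  shows "L2_norm M g \<le> \<bar>K\<bar> * L2_norm M f"
proof (cases "integrable M (\<lambda>x. (norm (g x))\<^sup>2)")
  case True
  have le: "AE x in M. (norm (g x))\<^sup>2 \<le> K\<^sup>2 * (norm (f x))\<^sup>2"
    using assms(2)
  proof eventually_elim
    case (elim x)
    then show ?case using power_mono[OF elim norm_ge_zero, of 2] by (simp add: power_mult_distrib)
  qed
  have int: "integrable M (\<lambda>x. K\<^sup>2 * (norm (f x))\<^sup>2)"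
    using assms(1) by (simp add: L2_def)
  have "(\<integral>x. (norm (g x))\<^sup>2 \<partial>M) \<le> K\<^sup>2 * (\<integral>x. (norm (f x))\<^sup>2 \<partial>M)"
    using integral_mono_AE[OF True int le] by simp
  then have "sqrt (\<integral>x. (norm (g x))\<^sup>2 \<partial>M) \<le> sqrt (K\<^sup>2 * (\<integral>x. (norm (f x))\<^sup>2 \<partial>M))"
    by (rule real_sqrt_le_mono)
  then show ?thesis by (simp add: L2_norm_def real_sqrt_mult)
next
  case False
  then show ?thesis by (simp add: L2_norm_def not_integrable_integral_eq)
qed

lemma L2_bounded_by:
  assumes "g \<in> borel_measurable M" "f \<in> L2 M" "AE x in M. norm (g x) \<le> K * norm (f x)"
  shows "g \<in> L2 M" "L2_norm M g \<le> \<bar>K\<bar> * L2_norm M f"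
proof -
  have le: "AE x in M. (norm (g x))\<^sup>2 \<le> K\<^sup>2 * (norm (f x))\<^sup>2"
    using assms(3)
  proof eventually_elim
    case (elim x)
    then show ?case using power_mono[OF elim norm_ge_zero, of 2] by (simp add: power_mult_distrib)
  qed
  have int: "integrable M (\<lambda>x. K\<^sup>2 * (norm (f x))\<^sup>2)"
    using assms(2) by (simp add: L2_def)
  show g: "g \<in> L2 M"
    unfolding L2_def using assms(1) le by (auto intro!: Bochner_Integration.integrable_bound[OF int])
  show "L2_norm M g \<le> \<bar>K\<bar> * L2_norm M f" by (rule L2_norm_le_AE[OF assms(2,3)])
qed

lemma L2_add: "f \<in> L2 M \<Longrightarrow> g \<in> L2 M \<Longrightarrow> (\<lambda>x. f x + g x) \<in> L2 M"
proof -
  assume f: "f \<in> L2 M" and g: "g \<in> L2 M"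
  have int: "integrable M (\<lambda>x. 2 * (norm (f x))\<^sup>2 + 2 * (norm (g x))\<^sup>2)"
    using f g by (simp add: L2_def)
  have "(norm (f x + g x))\<^sup>2 \<le> 2 * (norm (f x))\<^sup>2 + 2 * (norm (g x))\<^sup>2" for x
  proof -
    have "(norm (f x + g x))\<^sup>2 \<le> (norm (f x) + norm (g x))\<^sup>2"
      by (intro power_mono norm_triangle_ineq) auto
    also have "\<dots> \<le> 2 * (norm (f x))\<^sup>2 + 2 * (norm (g x))\<^sup>2"
      using sum_squares_bound[of "norm (f x)" "norm (g x)"] by (simp add: power2_sum)
    finally show ?thesis .
  qed
  then show ?thesis
    using f g unfolding L2_def by (auto intro!: Bochner_Integration.integrable_bound[OF int])
qed

lemma L2_scaleR: "f \<in> L2 M \<Longrightarrow> (\<lambda>x. c *\<^sub>R f x) \<in> L2 M"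
  by (auto simp: L2_def power_mult_distrib)

lemma L2_scale: "f \<in> L2 M \<Longrightarrow> (\<lambda>x. c * f x) \<in> L2 M" for f :: "_ \<Rightarrow> real"
  using L2_scaleR[of f M c] by simp

lemma L2_uminus: "f \<in> L2 M \<Longrightarrow> (\<lambda>x. - f x) \<in> L2 M"
  using L2_scaleR[of f M "-1"] by simp

lemma L2_diff: "f \<in> L2 M \<Longrightarrow> g \<in> L2 M \<Longrightarrow> (\<lambda>x. f x - g x) \<in> L2 M"
  using L2_add[of f M "\<lambda>x. - g x"] L2_uminus[of g M] by simp

lemma L2_zero: "(\<lambda>x. 0) \<in> L2 M"
  by (simp add: L2_def)

lemma L2_inner_integrable: "f \<in> L2 M \<Longrightarrow> g \<in> L2 M \<Longrightarrow> integrable M (\<lambda>x. f x \<bullet> g x)"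
proof -
  assume f: "f \<in> L2 M" and g: "g \<in> L2 M"
  have int: "integrable M (\<lambda>x. (norm (f x))\<^sup>2 + (norm (g x))\<^sup>2)"
    using f g by (simp add: L2_def)
  have "\<bar>f x \<bullet> g x\<bar> \<le> (norm (f x))\<^sup>2 + (norm (g x))\<^sup>2" for x
    using Cauchy_Schwarz_ineq2[of "f x" "g x"] sum_squares_bound[of "norm (f x)" "norm (g x)"]
      mult_nonneg_nonneg[of "norm (f x)" "norm (g x)"] by simp
  then show ?thesis
    using f g unfolding L2_def by (auto intro!: Bochner_Integration.integrable_bound[OF int])
qed

lemma L2_inner_commute: "L2_inner M f g = L2_inner M g f"
  by (simp add: L2_inner_def inner_commute)

lemma L2_inner_add_left: "f \<in> L2 M \<Longrightarrow> g \<in> L2 M \<Longrightarrow> h \<in> L2 M \<Longrightarrow>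
    L2_inner M (\<lambda>x. f x + g x) h = L2_inner M f h + L2_inner M g h"
  by (simp add: L2_inner_def inner_add_left L2_inner_integrable)

lemma L2_inner_diff_left: "f \<in> L2 M \<Longrightarrow> g \<in> L2 M \<Longrightarrow> h \<in> L2 M \<Longrightarrow>
    L2_inner M (\<lambda>x. f x - g x) h = L2_inner M f h - L2_inner M g h"
  by (simp add: L2_inner_def inner_diff_left L2_inner_integrable)

lemma L2_inner_add_right: "f \<in> L2 M \<Longrightarrow> g \<in> L2 M \<Longrightarrow> h \<in> L2 M \<Longrightarrow>
    L2_inner M h (\<lambda>x. f x + g x) = L2_inner M h f + L2_inner M h g"
  by (simp add: L2_inner_def inner_add_right L2_inner_integrable)

lemma L2_inner_diff_right: "f \<in> L2 M \<Longrightarrow> g \<in> L2 M \<Longrightarrow> h \<in> L2 M \<Longrightarrow>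
    L2_inner M h (\<lambda>x. f x - g x) = L2_inner M h f - L2_inner M h g"
  by (simp add: L2_inner_def inner_diff_right L2_inner_integrable)

lemma L2_inner_scaleR_left: "L2_inner M (\<lambda>x. c *\<^sub>R f x) h = c * L2_inner M f h"
  by (simp add: L2_inner_def)

lemma L2_inner_scaleR_right: "L2_inner M h (\<lambda>x. c *\<^sub>R f x) = c * L2_inner M h f"
  by (simp add: L2_inner_def)

lemma L2_inner_cong_AE:
  assumes "f \<in> L2 M" "f' \<in> L2 M" "g \<in> L2 M" "g' \<in> L2 M"
    "AE x in M. f x = f' x" "AE x in M. g x = g' x"
  shows "L2_inner M f g = L2_inner M f' g'"
  unfolding L2_inner_def
proof (rule integral_cong_AE)
  show "AE x in M. f x \<bullet> g x = f' x \<bullet> g' x"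
    using assms(5,6) by eventually_elim simp
qed (use assms in \<open>simp_all add: borel_measurable_inner L2_measurable\<close>)

lemma L2_norm_eq: "L2_norm M f = sqrt (L2_inner M f f)"
  by (simp add: L2_norm_def L2_inner_def dot_square_norm)

lemma L2_norm_nonneg: "0 \<le> L2_norm M f"
  by (simp add: L2_norm_def)

lemma L2_norm_square: "(L2_norm M f)\<^sup>2 = L2_inner M f f"
  by (simp add: L2_norm_eq L2_inner_def)

lemma L2_norm_cong_AE:
  assumes "f \<in> L2 M" "f' \<in> L2 M" "AE x in M. f x = f' x"
  shows "L2_norm M f = L2_norm M f'"
  unfolding L2_norm_eq using L2_inner_cong_AE[OF assms(1,2,1,2,3,3)] by simp

interpretation L2: semi_inner_space "L2 M" "\<lambda>f g x. f x + g x" "\<lambda>c f x. c *\<^sub>R f x" "L2_inner M"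
  for M :: "'a measure"
proof
  show "L2 M \<noteq> ({} :: ('a \<Rightarrow> 'b) set)" using L2_zero by blast
  show "L2_inner M f g = L2_inner M g f" for f g :: "'a \<Rightarrow> 'b" by (rule L2_inner_commute)
  show "0 \<le> L2_inner M f f" for f :: "'a \<Rightarrow> 'b" by (simp add: L2_inner_def)
qed (simp_all add: L2_add L2_scaleR L2_inner_add_left L2_inner_scaleR_left)

lemma L2_nrm: "L2.nrm M f = L2_norm M f"
  by (simp add: L2.nrm_def L2_norm_eq)

lemma L2_Cauchy_Schwarz: "f \<in> L2 M \<Longrightarrow> g \<in> L2 M \<Longrightarrow> \<bar>L2_inner M f g\<bar> \<le> L2_norm M f * L2_norm M g"
  using L2.Cauchy_Schwarz[of f M g] by (simp add: L2_nrm)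

lemma L2_norm_add: "f \<in> L2 M \<Longrightarrow> g \<in> L2 M \<Longrightarrow> L2_norm M (\<lambda>x. f x + g x) \<le> L2_norm M f + L2_norm M g"
  using L2.nrm_add[of f M g] by (simp add: L2_nrm)

lemma L2_norm_scaleR: "L2_norm M (\<lambda>x. c *\<^sub>R f x) = \<bar>c\<bar> * L2_norm M f"
  by (simp add: L2_norm_def power_mult_distrib real_sqrt_mult)

lemma L2_norm_uminus: "L2_norm M (\<lambda>x. - f x) = L2_norm M f"
  by (simp add: L2_norm_def)

lemma L2_norm_diff: "f \<in> L2 M \<Longrightarrow> g \<in> L2 M \<Longrightarrow> L2_norm M (\<lambda>x. f x - g x) \<le> L2_norm M f + L2_norm M g"
  using L2_norm_add[of f M "\<lambda>x. - g x"] by (simp add: L2_uminus L2_norm_uminus)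

lemma L2_norm_0_imp_AE:
  assumes "f \<in> L2 M" "L2_norm M f = 0" shows "AE x in M. f x = 0"
proof -
  have "(\<integral>x. (norm (f x))\<^sup>2 \<partial>M) = 0" using assms(2) by (simp add: L2_norm_def)
  then have "AE x in M. (norm (f x))\<^sup>2 = 0"
    using integral_nonneg_eq_0_iff_AE[OF L2_integrable_square[OF assms(1)]] by simp
  then show ?thesis by simp
qed

lemma nn_integral_L2_norm:
  assumes "f \<in> L2 M" shows "(\<integral>\<^sup>+x. ennreal ((norm (f x))\<^sup>2) \<partial>M) = ennreal ((L2_norm M f)\<^sup>2)"
  unfolding L2_norm_def using L2_integrable_square[OF assms] by (simp add: nn_integral_eq_integral)

lemma L2_I_nn_integral:
  assumes "f \<in> borel_measurable M" "(\<integral>\<^sup>+x. ennreal ((norm (f x))\<^sup>2) \<partial>M) \<le> ennreal (K\<^sup>2)" "0 \<le> K"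
  shows "f \<in> L2 M" "L2_norm M f \<le> K"
proof -
  have "integrable M (\<lambda>x. (norm (f x))\<^sup>2)"
    using assms le_less_trans[OF assms(2) ennreal_less_top] by (intro integrableI_bounded) auto
  then show f: "f \<in> L2 M" using assms by (simp add: L2_def)
  show "L2_norm M f \<le> K"
    using assms(2,3) unfolding nn_integral_L2_norm[OF f] ennreal_le_iff[OF zero_le_power2]
    by (rule power2_le_imp_le)
qed

lemma L2_bounded:
  assumes "finite_measure M" "f \<in> borel_measurable M" "AE x in M. norm (f x) \<le> K"
  shows "f \<in> L2 M"
proof -
  interpret finite_measure M by fact
  have "AE x in M. (norm (f x))\<^sup>2 \<le> K\<^sup>2"
    using assms(3) by eventually_elim (auto intro: power_mono)
  then show ?thesis
    unfolding L2_def using assms by (auto intro!: integrable_const_bound[where B="K\<^sup>2"])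
qed

lemma L2_integrable:
  assumes "finite_measure M" "f \<in> L2 M" shows "integrable M f"
proof -
  interpret finite_measure M by fact
  have int: "integrable M (\<lambda>x. 1 + (norm (f x))\<^sup>2)" using assms by (simp add: L2_def)
  have "norm (f x) \<le> 1 + (norm (f x))\<^sup>2" for x
    using sum_squares_bound[of 1 "norm (f x)"] norm_ge_zero[of "f x"] unfolding power_one mult_1_right
    by linarith
  then show ?thesis
    using assms(2) by (intro Bochner_Integration.integrable_bound[OF int]) (auto simp: L2_measurable)
qed

text \<open>Riesz-Fischer: along a subsequence whose successive distances are at most (1/2)^k the
  increments have a finite sum almost everywhere, which gives a pointwise limit; Fatou's lemma then
  carries the Cauchy estimate over to that limit.\<close>

theorem L2_complete:
  fixes X :: "nat \<Rightarrow> 'a \<Rightarrow> 'b::euclidean_space"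
  assumes M: "finite_measure M" and X: "\<And>n. X n \<in> L2 M"
    and Cauchy: "\<And>e. e > 0 \<Longrightarrow> \<exists>N. \<forall>m\<ge>N. \<forall>n\<ge>N. L2_norm M (\<lambda>x. X m x - X n x) < e"
  shows "\<exists>l\<in>L2 M. (\<lambda>n. L2_norm M (\<lambda>x. X n x - l x)) \<longlonglongrightarrow> 0"
proof -
  interpret finite_measure M by fact
  have [measurable]: "X n \<in> borel_measurable M" for n using X L2_measurable by blast
  obtain N where N: "\<And>k m n. m \<ge> N k \<Longrightarrow> n \<ge> N k \<Longrightarrow> L2_norm M (\<lambda>x. X m x - X n x) < (1/2)^k"
    using Cauchy[of "(1/2)^_"] by (metis zero_less_divide_1_iff zero_less_numeral zero_less_power)
  \<comment> \<open>Summing, like taking a maximum, gives an index beyond all of the thresholds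
    \<open>N 0\<close>, ..., \<open>N k\<close>.\<close>
  define r where "r k = (\<Sum>j\<le>k. N j)" for k
  have r: "N k \<le> r j" if "k \<le> j" for k j
    unfolding r_def using that by (intro member_le_sum) auto
  define Y where "Y k = X (r k)" for k
  have Y: "Y k \<in> L2 M" and [measurable]: "Y k \<in> borel_measurable M" for k by (simp_all add: Y_def X)
  \<comment> \<open>Cauchy-Schwarz against the constant 1, which is in \<open>L2\<close> because the
    measure is finite, turns the \<open>L2\<close> bounds on the increments into bounds on their
    integrals.\<close>
  define c where "c = L2_norm M (\<lambda>x. 1::real)"
  have one: "(\<lambda>x. 1::real) \<in> L2 M" by (rule L2_bounded[OF M, where K=1]) auto
  have int_d: "(\<integral>\<^sup>+x. ennreal (norm (Y (Suc k) x - Y k x)) \<partial>M) \<le> ennreal (c * (1/2)^k)" for k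
  proof -
    have d: "(\<lambda>x. Y (Suc k) x - Y k x) \<in> L2 M" by (intro L2_diff Y)
    have d': "(\<lambda>x. norm (Y (Suc k) x - Y k x)) \<in> L2 M" 
      and dn: "L2_norm M (\<lambda>x. norm (Y (Suc k) x - Y k x)) = L2_norm M (\<lambda>x. Y (Suc k) x - Y k x)"
      using d by (auto simp: L2_def L2_norm_def)
    have "(\<integral>x. norm (Y (Suc k) x - Y k x) \<partial>M) \<le> L2_norm M (\<lambda>x. norm (Y (Suc k) x - Y k x)) * c"
      using L2_Cauchy_Schwarz[OF d' one] by (simp add: L2_inner_def c_def)
    also have "\<dots> \<le> (1/2)^k * c"
      unfolding dn using N[of k "r (Suc k)" "r k"] r[of k "Suc k"] r[of k k]
      by (intro mult_right_mono) (auto simp: Y_def c_def L2_norm_nonneg)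
    finally have "(\<integral>x. norm (Y (Suc k) x - Y k x) \<partial>M) \<le> c * (1/2)^k" by (simp add: mult.commute)
    moreover have "(\<integral>\<^sup>+x. ennreal (norm (Y (Suc k) x - Y k x)) \<partial>M) = ennreal (\<integral>x. norm (Y (Suc k) x - Y k x) \<partial>M)"
      by (intro nn_integral_eq_integral L2_integrable[OF M d']) auto
    ultimately show ?thesis by (simp add: ennreal_leI)
  qed
  have "(\<integral>\<^sup>+x. (\<Sum>k. ennreal (norm (Y (Suc k) x - Y k x))) \<partial>M) = (\<Sum>k. \<integral>\<^sup>+x. ennreal (norm (Y (Suc k) x - Y k x)) \<partial>M)"
    by (rule nn_integral_suminf) measurable
  also have "\<dots> \<le> (\<Sum>k. ennreal (c * (1/2)^k))"
    by (intro suminf_le int_d) auto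
  also have "\<dots> < \<infinity>"
  proof -
    have "summable (\<lambda>k. c * (1/2)^k)" by (intro summable_mult summable_geometric) simp
    moreover have "0 \<le> c * (1/2)^k" for k by (simp add: c_def L2_norm_nonneg)
    ultimately have "(\<Sum>k. ennreal (c * (1/2)^k)) \<noteq> top" by (rule ennreal_suminf_neq_top)
    then show ?thesis by (simp only: infinity_ennreal_def less_top)
  qed
  finally have "AE x in M. (\<Sum>k. ennreal (norm (Y (Suc k) x - Y k x))) \<noteq> \<infinity>"
    by (intro nn_integral_PInf_AE) auto
  then have conv: "AE x in M. convergent (\<lambda>k. Y k x)"
  proof eventually_elim
    case (elim x)
    then have "summable (\<lambda>k. norm (Y (Suc k) x - Y k x))"
      by (intro summable_suminf_not_top) auto
    then have "summable (\<lambda>k. Y (Suc k) x - Y k x)" by (rule summable_norm_cancel)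
    then have "convergent (\<lambda>n. \<Sum>k<n. Y (Suc k) x - Y k x)" by (simp add: summable_iff_convergent)
    then have "convergent (\<lambda>n. Y n x - Y 0 x)" by (simp only: sum_lessThan_telescope[of "\<lambda>k. Y k x"])
    then show ?case using convergent_add[OF _ convergent_const[of "Y 0 x"]] by fastforce
  qed
  define l where "l x = lim (\<lambda>k. Y k x)" for x
  have [measurable]: "l \<in> borel_measurable M" unfolding l_def[abs_def] by (rule borel_measurable_lim_metric) simp
  have lim: "AE x in M. (\<lambda>k. Y k x) \<longlonglongrightarrow> l x"
    using conv unfolding l_def by eventually_elim (simp add: convergent_LIMSEQ_iff)
  have key: "(\<lambda>x. X n x - l x) \<in> L2 M \<and> L2_norm M (\<lambda>x. X n x - l x) \<le> (1/2)^j" if "n \<ge> N j" for n j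
  proof -
    have "(\<integral>\<^sup>+x. ennreal ((norm (X n x - l x))\<^sup>2) \<partial>M) = (\<integral>\<^sup>+x. liminf (\<lambda>k. ennreal ((norm (X n x - Y k x))\<^sup>2)) \<partial>M)"
    proof (rule nn_integral_cong_AE)
      show "AE x in M. ennreal ((norm (X n x - l x))\<^sup>2) = liminf (\<lambda>k. ennreal ((norm (X n x - Y k x))\<^sup>2))"
        using lim
      proof eventually_elim
        case (elim x)
        have "(\<lambda>k. ennreal ((norm (X n x - Y k x))\<^sup>2)) \<longlonglongrightarrow> ennreal ((norm (X n x - l x))\<^sup>2)"
          by (intro tendsto_ennrealI tendsto_intros elim)
        then show ?case by (intro lim_imp_Liminf[symmetric]) simp
      qed
    qed
    also have "\<dots> \<le> liminf (\<lambda>k. \<integral>\<^sup>+x. ennreal ((norm (X n x - Y k x))\<^sup>2) \<partial>M)"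
      by (rule nn_integral_liminf) measurable
    also have "\<dots> \<le> ennreal (((1/2)^j)\<^sup>2)"
    proof (rule order_trans[OF Liminf_le_Limsup Limsup_bounded])
      show "\<forall>\<^sub>F k in sequentially. (\<integral>\<^sup>+x. ennreal ((norm (X n x - Y k x))\<^sup>2) \<partial>M) \<le> ennreal (((1/2)^j)\<^sup>2)"
        using eventually_ge_at_top[of j]
      proof eventually_elim
        case (elim k)
        have "L2_norm M (\<lambda>x. X n x - Y k x) \<le> (1/2)^j"
          unfolding Y_def using N[OF that r[OF elim]] by simp
        then show ?case
          by (subst nn_integral_L2_norm) (auto intro!: L2_diff X Y ennreal_leI power_mono L2_norm_nonneg simp del: power_divide)
      qed
    qed simp
    finally show ?thesis using L2_I_nn_integral[of "\<lambda>x. X n x - l x" M "(1/2)^j"] by auto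
  qed
  have "(\<lambda>x. X (N 0) x - (X (N 0) x - l x)) \<in> L2 M" using key[of 0 "N 0", OF order_refl] L2_diff[OF X] by blast
  then have "l \<in> L2 M" by simp
  moreover have "(\<lambda>n. L2_norm M (\<lambda>x. X n x - l x)) \<longlonglongrightarrow> 0"
  proof (rule LIMSEQ_I)
    fix e :: real assume "e > 0"
    then obtain j where "(1/2)^j < e" using real_arch_pow_inv[of e "1/2"] by auto
    then show "\<exists>no. \<forall>n\<ge>no. norm (L2_norm M (\<lambda>x. X n x - l x) - 0) < e"
      using key[of j] by (intro exI[of _ "N j"]) (auto simp: L2_norm_nonneg intro: le_less_trans)
  qed
  ultimately show ?thesis by blast
qed

section \<open>Test functions and integration by parts\<close>

text \<open>Open boxes are closed under intersection and generate the Borel sets, so a Dynkin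
  argument gives zero integral over every Borel set. The integral over the whole space is a separate
  hypothesis because complements need it and the space is not a box.\<close>

lemma AE_zero_if_box_integrals_zero:
  fixes f :: "'a::euclidean_space \<Rightarrow> real"
  assumes f: "integrable lborel f" and total: "(\<integral>x. f x \<partial>lborel) = 0"
    and box: "\<And>c d. (\<integral>x. indicator (box c d) x * f x \<partial>lborel) = 0"
  shows "AE x in lborel. f x = 0"
proof (rule sigma_finite_measure.density_zero[OF sigma_finite_lborel f])
  have int: "set_integrable lborel A f" if "A \<in> sets borel" for A
    using integrable_mult_indicator[OF _ f, of A] that by (simp add: set_integrable_def)
  fix A :: "'a set" assume "A \<in> sets lborel"
  then have "A \<in> sigma_sets UNIV (range (\<lambda>(a, b). box a b :: 'a set))"
    by (subst (asm) sets_lborel, subst (asm) borel_eq_box) (simp add: sets_measure_of)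
  moreover have "Int_stable (range (\<lambda>(a, b). box a b :: 'a set))"
    unfolding Int_stable_def by (force simp: box_Int_box)
  moreover have "range (\<lambda>(a, b). box a b :: 'a set) \<subseteq> Pow UNIV" by simp
  ultimately have "Int_stable (range (\<lambda>(a, b). box a b :: 'a set))"
    "range (\<lambda>(a, b). box a b :: 'a set) \<subseteq> Pow UNIV"
    "A \<in> sigma_sets UNIV (range (\<lambda>(a, b). box a b :: 'a set))" by blast+
  then show "set_lebesgue_integral lborel A f = 0"
  proof (induction rule: sigma_sets_induct_disjoint)
    case (basic A)
    then show ?case using box by (auto simp: set_lebesgue_integral_def)
  next
    case (compl A)
    then have "A \<in> sets borel" by (subst borel_eq_box) (simp add: sets_measure_of)
    then have "set_lebesgue_integral lborel (UNIV - A) f = (\<integral>x. f x - indicator A x * f x \<partial>lborel)"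
      unfolding set_lebesgue_integral_def
      by (intro Bochner_Integration.integral_cong) (auto simp: indicator_def)
    also have "\<dots> = 0"
      using int[OF \<open>A \<in> sets borel\<close>] f total compl(2)
      by (simp add: set_integrable_def set_lebesgue_integral_def)
    finally show ?case .
  next
    case (union A)
    then have "A i \<in> sets borel" for i by (subst borel_eq_box) (auto simp: sets_measure_of)
    then have "set_lebesgue_integral lborel (\<Union>i. A i) f = (\<Sum>i. set_lebesgue_integral lborel (A i) f)"
      using union(1) by (intro lebesgue_integral_countable_add int) (auto simp: disjoint_family_on_def)
    then show ?case using union by simp
  qed (auto simp: set_lebesgue_integral_def)
qed

text \<open>Fundamental lemma of the calculus of variations. Bumps converge boundedly to indicators
  of boxes, so p has zero integral over every box whose closed version lies in \<Omega>, and hence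
  vanishes there almost everywhere; countably many such boxes exhaust \<Omega>.\<close>

lemma AE_zero_if_test_integrals_zero:
  fixes \<Omega> :: "'a::euclidean_space set"
  assumes "open \<Omega>" and p: "integrable (lebesgue_on \<Omega>) p"
    and test: "\<And>\<phi>. test_function \<Omega> \<phi> \<Longrightarrow> (\<integral>x. p x * \<phi> x \<partial>lebesgue_on \<Omega>) = (0::real)"
  shows "AE x in lebesgue_on \<Omega>. p x = 0"
proof -
  have [measurable]: "\<Omega> \<in> sets borel" using \<open>open \<Omega>\<close> by simp
  have \<Omega>: "\<Omega> \<inter> space lebesgue \<in> sets lebesgue" using \<open>open \<Omega>\<close> by simp
  define g where "g x = indicator \<Omega> x * p x" for x
  have g: "integrable lebesgue g" using p unfolding integrable_restrict_space[OF \<Omega>] g_def by simp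
  \<comment> \<open>p is only Lebesgue measurable, whereas the box criterion lives on the Borel
    sets; a Borel representative of the extension of p by zero bridges the gap.\<close>
  obtain p' where p'[measurable]: "p' \<in> borel_measurable lborel" and eq: "AE x in lborel. g x = p' x"
    using completion_ex_borel_measurable_real[of g lborel] g by auto
  have eq': "AE x in lebesgue. g x = p' x" using eq by (rule AE_completion)
  have int: "integrable lborel p'"
  proof -
    have "integrable lebesgue p'"
      using integrable_cong_AE[of g lebesgue p'] g p' eq' by (simp add: measurable_completion)
    then show ?thesis by (simp add: integrable_completion)
  qed
  have bumps: "(\<integral>x. bump (Suc n) a b x * p' x \<partial>lborel) = 0" if "cbox a b \<subseteq> \<Omega>" for a b n
  proof -
    have [measurable]: "bump (Suc n) a b \<in> borel_measurable borel"
      by (intro borel_measurable_continuous_onI smooth_continuous smooth_bump)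
    have 1: "bump (Suc n) a b \<in> borel_measurable lebesgue" by (simp add: measurable_completion)
    have "(\<integral>x. bump (Suc n) a b x * p' x \<partial>lborel) = (\<integral>x. bump (Suc n) a b x * p' x \<partial>lebesgue)"
      by (simp add: integral_completion)
    also have "\<dots> = (\<integral>x. bump (Suc n) a b x * g x \<partial>lebesgue)"
    proof (rule integral_cong_AE)
      show "AE x in lebesgue. bump (Suc n) a b x * p' x = bump (Suc n) a b x * g x"
        using eq' by eventually_elim simp
    qed (use 1 g p' in \<open>auto intro!: borel_measurable_times measurable_completion\<close>)
    also have "\<dots> = (\<integral>x. p x * bump (Suc n) a b x \<partial>lebesgue_on \<Omega>)"
      unfolding integral_restrict_space[OF \<Omega>] g_def by (simp add: mult_ac)
    finally show ?thesis using test test_function_bump[OF _ that, of "Suc n"] by simp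
  qed
  have box: "(\<integral>x. indicator (box a b) x * p' x \<partial>lborel) = 0" if "cbox a b \<subseteq> \<Omega>" for a b
  proof (rule LIMSEQ_unique)
    have [measurable]: "bump (Suc n) a b \<in> borel_measurable borel" for n
      by (intro borel_measurable_continuous_onI smooth_continuous smooth_bump)
    have "norm (bump (Suc n) a b x * p' x) \<le> norm (p' x)" for n x
      using bump_bounds[of "Suc n" a b x] by (simp add: abs_mult mult_left_le_one_le)
    then show "(\<lambda>n. \<integral>x. bump (Suc n) a b x * p' x \<partial>lborel) \<longlonglongrightarrow> (\<integral>x. indicator (box a b) x * p' x \<partial>lborel)"
      by (intro integral_dominated_convergence[where w="\<lambda>x. norm (p' x)"])
         (use int in \<open>auto intro!: tendsto_mult bump_tendsto_indicator\<close>)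
    show "(\<lambda>n. \<integral>x. bump (Suc n) a b x * p' x \<partial>lborel) \<longlonglongrightarrow> 0"
      using bumps[OF that] by simp
  qed
  have AE_box: "AE x in lborel. x \<in> box a b \<longrightarrow> p' x = 0" if "cbox a b \<subseteq> \<Omega>" for a b
  proof -
    have "AE x in lborel. indicator (box a b) x * p' x = 0"
    proof (rule AE_zero_if_box_integrals_zero)
      show "integrable lborel (\<lambda>x. indicator (box a b) x * p' x)"
        using integrable_mult_indicator[OF _ int, of "box a b"] by simp
      show "(\<integral>x. indicator (box a b) x * p' x \<partial>lborel) = 0" by (rule box[OF that])
      fix c d
      \<comment> \<open>The intersection with an arbitrary box is again a box with closed version in
        \<Omega>, so the known integrals suffice for the criterion.\<close>
      define a' b' where "a' = (\<Sum>i\<in>Basis. max (a\<bullet>i) (c\<bullet>i) *\<^sub>R i)" and "b' = (\<Sum>i\<in>Basis. min (b\<bullet>i) (d\<bullet>i) *\<^sub>R i)"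
      have "cbox a' b' = cbox a b \<inter> cbox c d" "box a' b' = box a b \<inter> box c d"
        by (simp_all add: a'_def b'_def Int_interval box_Int_box)
      then have "indicator (box c d) x * (indicator (box a b) x * p' x) = indicator (box a' b') x * p' x"
        and "cbox a' b' \<subseteq> \<Omega>" for x
        using that by (auto simp: indicator_def)
      then have "(\<integral>x. indicator (box c d) x * (indicator (box a b) x * p' x) \<partial>lborel) = (\<integral>x. indicator (box a' b') x * p' x \<partial>lborel)"
        and "cbox a' b' \<subseteq> \<Omega>" by presburger+
      then show "(\<integral>x. indicator (box c d) x * (indicator (box a b) x * p' x) \<partial>lborel) = 0"
        using box[of a' b'] by simp
    qed
    then show ?thesis by eventually_elim (auto simp: indicator_def split: if_splits)
  qed
  obtain D where D: "countable D" "D \<subseteq> Pow \<Omega>" "\<And>X. X \<in> D \<Longrightarrow> \<exists>a b. X = cbox a b" "\<Union>D = \<Omega>"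
    using open_countable_Union_open_cbox[OF \<open>open \<Omega>\<close>] by blast
  have "AE x in lborel. x \<in> X \<longrightarrow> p' x = 0" if X: "X \<in> D" for X
  proof -
    obtain a b where ab: "X = cbox a b" "cbox a b \<subseteq> \<Omega>" using D X by blast
    \<comment> \<open>The cover consists of closed boxes while vanishing is known on the open ones;
      the faces are null.\<close>
    have "cbox a b - box a b \<in> null_sets lborel"
      using negligible_frontier_interval[of a b] by (auto simp: negligible_iff_null_sets null_sets_completion_iff)
    then have "AE x in lborel. x \<notin> cbox a b - box a b" by (rule AE_not_in)
    with AE_box[OF ab(2)] show ?thesis by eventually_elim (auto simp: ab)
  qed
  then have "AE x in lborel. \<forall>X\<in>D. x \<in> X \<longrightarrow> p' x = 0"
    using D(1) by (subst AE_ball_countable) auto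
  with eq have "AE x in lborel. x \<in> \<Omega> \<longrightarrow> p x = 0"
  proof eventually_elim
    case (elim x)
    moreover have "\<exists>X\<in>D. x \<in> X" if "x \<in> \<Omega>" using that D(4) by blast
    ultimately show ?case by (auto simp: g_def)
  qed
  then have "AE x in lebesgue. x \<in> \<Omega> \<longrightarrow> p x = 0" by (rule AE_completion)
  then show ?thesis unfolding AE_restrict_space_iff[OF \<Omega>] .
qed

lemma grad_outside_support:
  assumes "x \<notin> closure {x. F x \<noteq> 0}" shows "grad F x = 0"
proof (rule grad_eqI)
  have "\<forall>\<^sub>F y in nhds x. y \<in> - closure {x. F x \<noteq> 0}"
    using assms by (intro eventually_nhds_in_open) auto
  then have "\<forall>\<^sub>F y in nhds x. 0 = F y"
    by eventually_elim (use closure_subset[of "{x. F x \<noteq> 0}"] in auto)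
  moreover have "0 = F x" using assms closure_subset[of "{x. F x \<noteq> 0}"] by auto
  moreover have "((\<lambda>_. 0) has_derivative (\<lambda>h. 0 \<bullet> h)) (at x)" by simp
  ultimately show "(F has_derivative (\<lambda>h. 0 \<bullet> h)) (at x)"
    using has_derivative_transform_eventually[of "\<lambda>_. 0" "\<lambda>h. 0 \<bullet> h" x UNIV F] 
    by (metis UNIV_I eventually_nhds_conv_at)
qed

lemma smooth_compact_support_grad_bounded:
  assumes F: "smooth F" and "bounded {x. F x \<noteq> 0}"
  obtains B where "B > 0" "\<And>x. norm (grad F x) \<le> B"
proof -
  have "compact (closure {x. F x \<noteq> 0})" using assms(2) by (simp add: compact_closure)
  then have "bounded (grad F ` closure {x. F x \<noteq> 0})"
    by (intro compact_imp_bounded compact_continuous_image continuous_grad F)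
  then obtain B where B: "B > 0" "\<And>x. x \<in> closure {x. F x \<noteq> 0} \<Longrightarrow> norm (grad F x) \<le> B"
    unfolding bounded_pos by auto
  have "norm (grad F x) \<le> B" for x
    using B grad_outside_support[of x F] by (cases "x \<in> closure {x. F x \<noteq> 0}") auto
  with B(1) show ?thesis using that by blast
qed

lemma smooth_compact_support_Lipschitz:
  assumes F: "smooth F" and B: "\<And>x. norm (grad F x) \<le> B"
  shows "\<bar>F x - F y\<bar> \<le> B * norm (x - y)"
proof -
  have "norm (F x - F y) \<le> B * norm (x - y)"
  proof (rule differentiable_bound[where S=UNIV and f' = "\<lambda>x h. grad F x \<bullet> h"])
    show "onorm ((\<bullet>) (grad F x)) \<le> B" for x
    proof (rule onorm_le)
      fix h
      have "norm (grad F x \<bullet> h) \<le> norm (grad F x) * norm h" using Cauchy_Schwarz_ineq2 by simp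
      also have "\<dots> \<le> B * norm h" using B[of x] by (intro mult_right_mono) auto
      finally show "norm (grad F x \<bullet> h) \<le> B * norm h" .
    qed
  qed (use F in \<open>auto intro: smooth_has_derivative\<close>)
  then show ?thesis by simp
qed

text \<open>Stands in for the divergence theorem: S = \<open>UNIV\<close> leads to integration by
  parts against test functions, S = \<Omega> to the limit of integrals over thin strips along the
  boundary.\<close>

lemma difference_quotients_tendsto_integral:
  fixes F :: "'a::euclidean_space \<Rightarrow> real"
  assumes F: "smooth F" and supp: "bounded {x. F x \<noteq> 0}" and [measurable]: "S \<in> sets borel"
  shows "(\<lambda>n. real (Suc n) * (\<integral>x. indicator S x * (F (x + (1 / real (Suc n)) *\<^sub>R v) - F x) \<partial>lborel))
     \<longlonglongrightarrow> (\<integral>x. indicator S x * (grad F x \<bullet> v) \<partial>lborel)"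
proof -
  obtain B where B: "B > 0" "\<And>x. norm (grad F x) \<le> B"
    using smooth_compact_support_grad_bounded[OF F supp] by blast
  obtain R where R: "R > 0" "\<And>x. F x \<noteq> 0 \<Longrightarrow> norm x \<le> R" using supp unfolding bounded_pos by auto
  have [measurable]: "F \<in> borel_measurable borel"
    by (intro borel_measurable_continuous_onI smooth_continuous F)
  have [measurable]: "grad F \<in> borel_measurable borel"
    by (intro borel_measurable_continuous_onI continuous_grad F)
  define q where "q n x = indicator S x * (real (Suc n) * (F (x + (1 / real (Suc n)) *\<^sub>R v) - F x))" for n x
  \<comment> \<open>The shifts have length at most |v|, so all quotients vanish outside the ball of
    radius R + |v|; inside, the Lipschitz constant B of F bounds them by B |v|.\<close>
  define w where "w x = indicator (cball 0 (R + norm v)) x * (B * norm v)" for x :: 'a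
  have "(\<lambda>n. \<integral>x. q n x \<partial>lborel) \<longlonglongrightarrow> (\<integral>x. indicator S x * (grad F x \<bullet> v) \<partial>lborel)"
  proof (rule integral_dominated_convergence[where w=w])
    show "integrable lborel w"
      unfolding w_def by (intro integrable_mult_left integrable_real_indicator) (use emeasure_lborel_cball_finite in auto)
    show "AE x in lborel. (\<lambda>n. q n x) \<longlonglongrightarrow> indicator S x * (grad F x \<bullet> v)"
    proof (rule AE_I2)
      fix x
      have "((\<lambda>t. F (x + t *\<^sub>R v)) has_derivative (\<lambda>t. t * (grad F x \<bullet> v))) (at 0)"
        by (rule has_derivative_eq_rhs[OF has_derivative_compose[where g=F and f="\<lambda>t. x + t *\<^sub>R v"]])
           (auto intro!: derivative_eq_intros smooth_has_derivative F)
      then have "((\<lambda>t. F (x + t *\<^sub>R v)) has_field_derivative (grad F x \<bullet> v)) (at 0)"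
        by (simp add: has_field_derivative_def mult_commute_abs)
      then have "((\<lambda>t. (F (x + t *\<^sub>R v) - F x) / t) \<longlongrightarrow> grad F x \<bullet> v) (at 0)"
        by (simp add: DERIV_def)
      moreover have "filterlim (\<lambda>n. 1 / real (Suc n)) (at 0) sequentially"
        unfolding filterlim_at using LIMSEQ_inverse_real_of_nat by (auto simp: inverse_eq_divide)
      ultimately have "(\<lambda>n. (F (x + (1 / real (Suc n)) *\<^sub>R v) - F x) / (1 / real (Suc n))) \<longlonglongrightarrow> grad F x \<bullet> v"
        by (rule filterlim_compose)
      then have "(\<lambda>n. real (Suc n) * (F (x + (1 / real (Suc n)) *\<^sub>R v) - F x)) \<longlonglongrightarrow> grad F x \<bullet> v"
        by (simp add: mult.commute)
      then show "(\<lambda>n. q n x) \<longlonglongrightarrow> indicator S x * (grad F x \<bullet> v)"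
        unfolding q_def by (rule tendsto_mult_left)
    qed
    show "AE x in lborel. norm (q n x) \<le> w x" for n
    proof (rule AE_I2)
      fix x
      have small: "norm ((1 / real (Suc n)) *\<^sub>R v) \<le> norm v"
        by (simp add: divide_le_eq mult_le_cancel_left1 del: of_nat_Suc)
      show "norm (q n x) \<le> w x"
      proof (cases "x \<in> cball 0 (R + norm v)")
        case True
        have "\<bar>F (x + (1 / real (Suc n)) *\<^sub>R v) - F x\<bar> \<le> B * norm ((1 / real (Suc n)) *\<^sub>R v)"
          using smooth_compact_support_Lipschitz[OF F B(2), of "x + (1 / real (Suc n)) *\<^sub>R v" x] by simp
        then have "real (Suc n) * \<bar>F (x + (1 / real (Suc n)) *\<^sub>R v) - F x\<bar> \<le> B * norm v"
          by (simp add: field_simps del: of_nat_Suc)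
        then show ?thesis using True B(1) by (auto simp: q_def w_def abs_mult indicator_def simp del: of_nat_Suc)
      next
        case False
        then have "norm x > R + norm v" by simp
        moreover have "norm x \<le> norm (x + (1 / real (Suc n)) *\<^sub>R v) + norm ((1 / real (Suc n)) *\<^sub>R v)"
          using norm_triangle_ineq4[of "x + (1 / real (Suc n)) *\<^sub>R v" "(1 / real (Suc n)) *\<^sub>R v"] by simp
        ultimately have "F x = 0" "F (x + (1 / real (Suc n)) *\<^sub>R v) = 0"
          using R(2)[of x] R(2)[of "x + (1 / real (Suc n)) *\<^sub>R v"] small norm_ge_zero[of v] by linarith+
        then show ?thesis by (simp add: q_def w_def B(1) less_imp_le)
      qed
    qed
  qed (auto simp: q_def)
  moreover have "(\<integral>x. q n x \<partial>lborel) = real (Suc n) * (\<integral>x. indicator S x * (F (x + (1 / real (Suc n)) *\<^sub>R v) - F x) \<partial>lborel)" for n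
    unfolding q_def by (subst integral_mult_right_zero[symmetric]) (simp add: mult_ac)
  ultimately show ?thesis by simp
qed

lemma lborel_integral_translate:
  fixes f :: "'a::euclidean_space \<Rightarrow> real"
  assumes [measurable]: "f \<in> borel_measurable borel"
  shows "(\<integral>x. f (x + c) \<partial>lborel) = (\<integral>x. f x \<partial>lborel)"
proof -
  have "(\<integral>x. f x \<partial>lborel) = (\<integral>x. f x \<partial>distr lborel borel ((+) c))" by (simp add: lborel_distr_plus)
  also have "\<dots> = (\<integral>x. f (c + x) \<partial>lborel)" by (subst integral_distr) auto
  finally show ?thesis by (simp add: add.commute)
qed

lemma integrable_compact_support:
  fixes F :: "'a::euclidean_space \<Rightarrow> real"
  assumes F: "continuous_on UNIV F" and supp: "bounded {x. F x \<noteq> 0}"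
  shows "integrable lborel F"
proof -
  let ?K = "closure {x. F x \<noteq> 0}"
  have "integrable lborel (\<lambda>x. indicator ?K x *\<^sub>R F x)"
    using supp by (intro borel_integrable_compact continuous_on_subset[OF F]) (auto simp: compact_closure)
  also have "(\<lambda>x. indicator ?K x *\<^sub>R F x) = F"
    using closure_subset[of "{x. F x \<noteq> 0}"] by (auto simp: indicator_def fun_eq_iff)
  finally show ?thesis .
qed

text \<open>By translation invariance of Lebesgue measure every difference quotient has integral 0,
  and the integral of the derivative is the limit of these.\<close>

lemma integral_grad_zero:
  fixes F :: "'a::euclidean_space \<Rightarrow> real"
  assumes F: "smooth F" and supp: "bounded {x. F x \<noteq> 0}"
  shows "(\<integral>x. grad F x \<bullet> v \<partial>lborel) = 0"
proof (rule LIMSEQ_unique)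
  have [measurable]: "F \<in> borel_measurable borel"
    by (intro borel_measurable_continuous_onI smooth_continuous F)
  have int: "integrable lborel F" by (intro integrable_compact_support smooth_continuous F supp)
  show "(\<lambda>n. real (Suc n) * (\<integral>x. indicator UNIV x * (F (x + (1 / real (Suc n)) *\<^sub>R v) - F x) \<partial>lborel)) \<longlonglongrightarrow> (\<integral>x. grad F x \<bullet> v \<partial>lborel)"
    using difference_quotients_tendsto_integral[OF F supp, of UNIV v] by simp
  have "integrable lborel (\<lambda>x. F (x + c))" for c
  proof -
    have "integrable (distr lborel borel ((+) c)) F" using int by (simp add: lborel_distr_plus)
    then show ?thesis by (subst (asm) integrable_distr_eq) (auto simp: add.commute)
  qed
  then have "(\<integral>x. F (x + c) - F x \<partial>lborel) = 0" for c
    using int lborel_integral_translate[of F c] by simp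
  then show "(\<lambda>n. real (Suc n) * (\<integral>x. indicator UNIV x * (F (x + (1 / real (Suc n)) *\<^sub>R v) - F x) \<partial>lborel)) \<longlonglongrightarrow> 0"
    by simp
qed

section \<open>Weak derivatives and \<open>H1\<close>\<close>

lemma L2_component: "p \<in> L2 M \<Longrightarrow> (\<lambda>x. p x \<bullet> i) \<in> L2 M"
proof -
  assume p: "p \<in> L2 M"
  then have "p \<in> borel_measurable M" by (rule L2_measurable)
  then have "(\<lambda>x. p x \<bullet> i) \<in> borel_measurable M" by measurable
  moreover have "AE x in M. norm (p x \<bullet> i) \<le> norm i * norm (p x)"
    by (rule AE_I2, subst mult.commute) (simp add: Cauchy_Schwarz_ineq2)
  ultimately show ?thesis by (rule L2_bounded_by(1)[OF _ p])
qed

lemma L2_inner_tendsto: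
  assumes "\<And>n. X n \<in> L2 M" "l \<in> L2 M" "g \<in> L2 M" "(\<lambda>n. L2_norm M (\<lambda>x. X n x - l x)) \<longlonglongrightarrow> 0"
  shows "(\<lambda>n. L2_inner M (X n) g) \<longlonglongrightarrow> L2_inner M l g"
proof (rule LIM_zero_cancel, rule Lim_null_comparison)
  show "(\<lambda>n. L2_norm M (\<lambda>x. X n x - l x) * L2_norm M g) \<longlonglongrightarrow> 0"
    using assms(4) by (rule tendsto_mult_left_zero)
  show "\<forall>\<^sub>F n in sequentially. norm (L2_inner M (X n) g - L2_inner M l g) \<le> L2_norm M (\<lambda>x. X n x - l x) * L2_norm M g"
    using L2_Cauchy_Schwarz[OF L2_diff[OF assms(1,2)] assms(3)]
    by (simp add: L2_inner_diff_left assms)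
qed

lemma L2_norm_component_le:
  assumes "p \<in> L2 M" "norm i = 1" shows "L2_norm M (\<lambda>x. p x \<bullet> i) \<le> L2_norm M p"
proof -
  have "AE x in M. norm (p x \<bullet> i) \<le> 1 * norm (p x)"
    using Cauchy_Schwarz_ineq2[of _ i] assms(2) by auto
  then show ?thesis
    using L2_bounded_by(2)[OF L2_measurable[OF L2_component[OF assms(1)]] assms(1)] by fastforce
qed

lemma test_functionD: "test_function \<Omega> \<phi> \<Longrightarrow> smooth \<phi>" "test_function \<Omega> \<phi> \<Longrightarrow> bounded {x. \<phi> x \<noteq> 0}"
  "test_function \<Omega> \<phi> \<Longrightarrow> x \<notin> \<Omega> \<Longrightarrow> \<phi> x = 0" "test_function \<Omega> \<phi> \<Longrightarrow> x \<notin> \<Omega> \<Longrightarrow> grad \<phi> x = 0"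
  using closure_subset[of "{x. \<phi> x \<noteq> 0}"] grad_outside_support[of x \<phi>]
  by (auto simp: test_function_def dest: bounded_subset[OF compact_imp_bounded])

locale bounded_open =
  fixes \<Omega> :: "'a::euclidean_space set"
  assumes bounded_\<Omega>: "bounded \<Omega>" and open_\<Omega>: "open \<Omega>"
begin

abbreviation M where "M \<equiv> lebesgue_on \<Omega>"

lemma sets_\<Omega>: "\<Omega> \<in> sets borel" "\<Omega> \<inter> space lebesgue \<in> sets lebesgue" "\<Omega> \<inter> space lborel \<in> sets lborel"
  using open_\<Omega> by auto

lemma finite_M: "finite_measure M"
  using bounded_\<Omega> open_\<Omega> by (intro finite_measure_lebesgue_on bounded_set_imp_lmeasurable) auto

lemma continuous_measurable: "continuous_on UNIV f \<Longrightarrow> f \<in> borel_measurable M"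
  by (intro measurable_restrict_space1 measurable_completion) (auto intro: borel_measurable_continuous_onI)

lemma continuous_L2: 
  fixes f :: "'a \<Rightarrow> 'b::euclidean_space"
  assumes "continuous_on UNIV f" shows "f \<in> L2 M"
proof -
  have "compact (f ` closure \<Omega>)"
    using bounded_\<Omega> assms by (intro compact_continuous_image) (auto simp: compact_closure intro: continuous_on_subset)
  then have "bounded (f ` closure \<Omega>)" by (rule compact_imp_bounded)
  then obtain K where "\<And>x. x \<in> closure \<Omega> \<Longrightarrow> norm (f x) \<le> K" unfolding bounded_iff by auto
  moreover have "space M = \<Omega>" by (simp add: space_restrict_space)
  ultimately have "AE x in M. norm (f x) \<le> K" using closure_subset[of \<Omega>] by (intro AE_I2) auto
  then show ?thesis using L2_bounded[OF finite_M continuous_measurable[OF assms]] by blast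
qed

lemma smooth_L2: "smooth \<phi> \<Longrightarrow> \<phi> \<in> L2 M"
  by (intro continuous_L2 smooth_continuous)

lemma grad_L2: "smooth \<phi> \<Longrightarrow> grad \<phi> \<in> L2 M"
  by (intro continuous_L2 continuous_grad)

lemma grad_component_L2: "smooth \<phi> \<Longrightarrow> (\<lambda>x. grad \<phi> x \<bullet> i) \<in> L2 M"
  by (intro L2_component grad_L2)

lemma L2_zero_by_testing:
  assumes q: "q \<in> L2 M" and "\<And>\<phi>. test_function \<Omega> \<phi> \<Longrightarrow> L2_inner M q \<phi> = 0"
  shows "AE x in M. q x = 0"
  using assms(2) unfolding L2_inner_def
  by (intro AE_zero_if_test_integrals_zero[OF open_\<Omega> L2_integrable[OF finite_M q]]) simp

lemma has_weak_grad_unique: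
  assumes "p \<in> L2 M" "q \<in> L2 M" "has_weak_grad \<Omega> v p" "has_weak_grad \<Omega> v q"
  shows "AE x in M. p x = q x"
proof -
  have "AE x in M. p x \<bullet> i = q x \<bullet> i" if i: "i \<in> Basis" for i
  proof -
    have "AE x in M. p x \<bullet> i - q x \<bullet> i = 0"
    proof (rule L2_zero_by_testing)
      fix \<phi> assume \<phi>: "test_function \<Omega> \<phi>"
      then have "L2_inner M (\<lambda>x. p x \<bullet> i) \<phi> = L2_inner M (\<lambda>x. q x \<bullet> i) \<phi>"
        using assms(3,4) i unfolding has_weak_grad_def by (metis neg_equal_iff_equal)
      then show "L2_inner M (\<lambda>x. p x \<bullet> i - q x \<bullet> i) \<phi> = 0"
        using \<phi> assms(1,2) by (subst L2_inner_diff_left) (auto intro: L2_component smooth_L2 test_functionD)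
    qed (intro L2_diff L2_component assms)
    then show ?thesis by simp
  qed
  then have "AE x in M. \<forall>i\<in>Basis. p x \<bullet> i = q x \<bullet> i" by (simp add: AE_finite_allI)
  then show ?thesis by eventually_elim (auto intro: euclidean_eqI)
qed

lemma has_weak_div_unique:
  assumes "p \<in> L2 M" "q \<in> L2 M" "has_weak_div \<Omega> \<tau> p" "has_weak_div \<Omega> \<tau> q"
  shows "AE x in M. p x = q x"
proof -
  have "AE x in M. p x - q x = 0"
  proof (rule L2_zero_by_testing)
    fix \<phi> assume \<phi>: "test_function \<Omega> \<phi>"
    then have "L2_inner M p \<phi> = L2_inner M q \<phi>"
      using assms(3,4) unfolding has_weak_div_def by (metis neg_equal_iff_equal)
    then show "L2_inner M (\<lambda>x. p x - q x) \<phi> = 0"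
      using \<phi> assms(1,2) by (subst L2_inner_diff_left) (auto intro: smooth_L2 test_functionD)
  qed (intro L2_diff assms)
  then show ?thesis by simp
qed

lemma weak_grad_H1:
  assumes "v \<in> H1 \<Omega>" shows "weak_grad \<Omega> v \<in> L2 M" "has_weak_grad \<Omega> v (weak_grad \<Omega> v)"
  using assms someI_ex[of "\<lambda>p. p \<in> L2 M \<and> has_weak_grad \<Omega> v p"]
  unfolding H1_def weak_grad_def by auto

lemma weak_div_Hdiv:
  assumes "\<tau> \<in> Hdiv \<Omega>" shows "weak_div \<Omega> \<tau> \<in> L2 M" "has_weak_div \<Omega> \<tau> (weak_div \<Omega> \<tau>)"
  using assms someI_ex[of "\<lambda>p. p \<in> L2 M \<and> has_weak_div \<Omega> \<tau> p"]
  unfolding Hdiv_def weak_div_def by auto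

lemma H1_L2: "v \<in> H1 \<Omega> \<Longrightarrow> v \<in> L2 M"
  by (simp add: H1_def)

lemma Hdiv_L2: "v \<in> Hdiv \<Omega> \<Longrightarrow> v \<in> L2 M"
  by (simp add: Hdiv_def)

lemma H1_I:
  assumes "v \<in> L2 M" "p \<in> L2 M" "has_weak_grad \<Omega> v p"
  shows "v \<in> H1 \<Omega>" "AE x in M. weak_grad \<Omega> v x = p x"
proof -
  show "v \<in> H1 \<Omega>" using assms by (auto simp: H1_def)
  then show "AE x in M. weak_grad \<Omega> v x = p x"
    using has_weak_grad_unique weak_grad_H1 assms by blast
qed

lemma Hdiv_I:
  assumes "\<tau> \<in> L2 M" "q \<in> L2 M" "has_weak_div \<Omega> \<tau> q"
  shows "\<tau> \<in> Hdiv \<Omega>" "AE x in M. weak_div \<Omega> \<tau> x = q x"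
proof -
  show "\<tau> \<in> Hdiv \<Omega>" using assms by (auto simp: Hdiv_def)
  then show "AE x in M. weak_div \<Omega> \<tau> x = q x"
    using has_weak_div_unique weak_div_Hdiv assms by blast
qed

lemma has_weak_grad_add:
  assumes "u \<in> L2 M" "v \<in> L2 M" "p \<in> L2 M" "q \<in> L2 M" "has_weak_grad \<Omega> u p" "has_weak_grad \<Omega> v q"
  shows "has_weak_grad \<Omega> (\<lambda>x. u x + v x) (\<lambda>x. p x + q x)"
  unfolding has_weak_grad_def inner_add_left
proof (intro allI impI ballI)
  fix \<phi> and i :: 'a assume \<phi>: "test_function \<Omega> \<phi>" and i: "i \<in> Basis"
  have \<phi>L: "\<phi> \<in> L2 M" "(\<lambda>x. grad \<phi> x \<bullet> i) \<in> L2 M"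
    using \<phi> by (auto intro!: smooth_L2 grad_component_L2 test_functionD)
  show "L2_inner M (\<lambda>x. u x + v x) (\<lambda>x. grad \<phi> x \<bullet> i) = - L2_inner M (\<lambda>x. p x \<bullet> i + q x \<bullet> i) \<phi>"
    using assms(5,6) \<phi> i unfolding has_weak_grad_def
    by (simp add: L2_inner_add_left assms(1-4) \<phi>L L2_component)
qed

lemma has_weak_grad_scale:
  assumes "has_weak_grad \<Omega> u p"
  shows "has_weak_grad \<Omega> (\<lambda>x. c * u x) (\<lambda>x. c *\<^sub>R p x)"
  using assms L2_inner_scaleR_left[of M c u] L2_inner_scaleR_left[of M c "\<lambda>x. p x \<bullet> _"]
  unfolding has_weak_grad_def by simp

text \<open>The gradient identity can only hold almost everywhere, because \<open>weak_grad\<close>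
  chooses a representative for each function separately.\<close>

lemma H1_add:
  assumes "u \<in> H1 \<Omega>" "v \<in> H1 \<Omega>"
  shows "(\<lambda>x. u x + v x) \<in> H1 \<Omega>"
    "AE x in M. weak_grad \<Omega> (\<lambda>x. u x + v x) x = weak_grad \<Omega> u x + weak_grad \<Omega> v x"
proof -
  have "has_weak_grad \<Omega> (\<lambda>x. u x + v x) (\<lambda>x. weak_grad \<Omega> u x + weak_grad \<Omega> v x)"
    by (intro has_weak_grad_add weak_grad_H1 H1_L2 assms)
  note * = H1_I[OF L2_add L2_add this, OF H1_L2 H1_L2 weak_grad_H1(1) weak_grad_H1(1), OF assms assms]
  show "(\<lambda>x. u x + v x) \<in> H1 \<Omega>"
    "AE x in M. weak_grad \<Omega> (\<lambda>x. u x + v x) x = weak_grad \<Omega> u x + weak_grad \<Omega> v x" by (rule *)+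
qed

lemma H1_scale:
  assumes "u \<in> H1 \<Omega>"
  shows "(\<lambda>x. c * u x) \<in> H1 \<Omega>" "AE x in M. weak_grad \<Omega> (\<lambda>x. c * u x) x = c *\<^sub>R weak_grad \<Omega> u x"
  using H1_I[OF L2_scale L2_scaleR has_weak_grad_scale, OF H1_L2 weak_grad_H1(1) weak_grad_H1(2), OF assms assms assms]
  by blast+

lemma H1_diff:
  assumes "u \<in> H1 \<Omega>" "v \<in> H1 \<Omega>"
  shows "(\<lambda>x. u x - v x) \<in> H1 \<Omega>"
    "AE x in M. weak_grad \<Omega> (\<lambda>x. u x - v x) x = weak_grad \<Omega> u x - weak_grad \<Omega> v x"
proof -
  have eq: "(\<lambda>x. u x - v x) = (\<lambda>x. u x + (-1) * v x)" by simp
  show "(\<lambda>x. u x - v x) \<in> H1 \<Omega>" unfolding eq by (intro H1_add H1_scale assms)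
  show "AE x in M. weak_grad \<Omega> (\<lambda>x. u x - v x) x = weak_grad \<Omega> u x - weak_grad \<Omega> v x"
    unfolding eq using H1_add(2)[OF assms(1) H1_scale(1)[OF assms(2), of "-1"]] H1_scale(2)[OF assms(2), of "-1"]
    by eventually_elim simp
qed

lemma H1_zero: "(\<lambda>x. 0) \<in> H1 \<Omega>"
  by (rule H1_I(1)[where p="\<lambda>_. 0"]) (auto simp: L2_zero has_weak_grad_def L2_inner_def)

text \<open>Product rule for f \<phi>, which has bounded support, followed by
  \<open>integral_grad_zero\<close>. No boundary term arises, as \<phi> and its gradient vanish
  outside \<Omega>.\<close>

lemma has_weak_grad_smooth:
  assumes f: "smooth f" shows "has_weak_grad \<Omega> f (grad f)"
  unfolding has_weak_grad_def
proof (intro allI impI ballI)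
  fix \<phi> and i :: 'a assume \<phi>: "test_function \<Omega> \<phi>" and i: "i \<in> Basis"
  note s = test_functionD(1)[OF \<phi>]
  have "bounded {x. f x * \<phi> x \<noteq> 0}" using test_functionD(2)[OF \<phi>] by (rule bounded_subset) auto
  then have "(\<integral>x. grad (\<lambda>x. f x * \<phi> x) x \<bullet> i \<partial>lborel) = 0"
    by (intro integral_grad_zero smooth_mult f s)
  moreover have "(\<integral>x. grad (\<lambda>x. f x * \<phi> x) x \<bullet> i \<partial>lborel) = (\<integral>x. grad (\<lambda>x. f x * \<phi> x) x \<bullet> i \<partial>M)"
  proof -
    have "continuous_on UNIV (\<lambda>x. grad (\<lambda>x. f x * \<phi> x) x \<bullet> i)"
      by (intro continuous_intros continuous_grad smooth_mult f s)
    then have [measurable]: "(\<lambda>x. grad (\<lambda>x. f x * \<phi> x) x \<bullet> i) \<in> borel_measurable borel"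
      by (rule borel_measurable_continuous_onI)
    have "(\<integral>x. grad (\<lambda>x. f x * \<phi> x) x \<bullet> i \<partial>lborel) = (\<integral>x. grad (\<lambda>x. f x * \<phi> x) x \<bullet> i \<partial>lebesgue)"
      by (simp add: integral_completion)
    also have "\<dots> = (\<integral>x. indicator \<Omega> x *\<^sub>R (grad (\<lambda>x. f x * \<phi> x) x \<bullet> i) \<partial>lebesgue)"
      using test_functionD(3,4)[OF \<phi>] by (intro Bochner_Integration.integral_cong) (auto simp: indicator_def grad_mult f s)
    finally show ?thesis by (simp add: integral_restrict_space sets_\<Omega>)
  qed
  ultimately have "0 = (\<integral>x. \<phi> x * (grad f x \<bullet> i) + f x * (grad \<phi> x \<bullet> i) \<partial>M)"
    by (simp add: grad_mult f s inner_add_left add.commute)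
  also have "\<dots> = L2_inner M f (\<lambda>x. grad \<phi> x \<bullet> i) + L2_inner M (\<lambda>x. grad f x \<bullet> i) \<phi>"
    using L2_inner_integrable[OF smooth_L2[OF f] grad_component_L2[OF s, of i]] 
      L2_inner_integrable[OF grad_component_L2[OF f, of i] smooth_L2[OF s]]
    by (simp add: L2_inner_def mult.commute)
  finally show "L2_inner M f (\<lambda>x. grad \<phi> x \<bullet> i) = - L2_inner M (\<lambda>x. grad f x \<bullet> i) \<phi>" by simp
qed

lemma smooth_H1:
  assumes "smooth f" shows "f \<in> H1 \<Omega>" "AE x in M. weak_grad \<Omega> f x = grad f x"
  using H1_I[OF smooth_L2 grad_L2 has_weak_grad_smooth] assms by auto

section \<open>The inner product and completeness of \<open>H1\<close>\<close>

definition H1_inner :: "('a \<Rightarrow> real) \<Rightarrow> ('a \<Rightarrow> real) \<Rightarrow> real" where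
  "H1_inner u v = L2_inner M u v + L2_inner M (weak_grad \<Omega> u) (weak_grad \<Omega> v)"

lemma weak_grad_add_inner:
  assumes "u \<in> H1 \<Omega>" "v \<in> H1 \<Omega>" "p \<in> L2 M"
  shows "L2_inner M (weak_grad \<Omega> (\<lambda>x. u x + v x)) p = L2_inner M (weak_grad \<Omega> u) p + L2_inner M (weak_grad \<Omega> v) p"
proof -
  have "L2_inner M (weak_grad \<Omega> (\<lambda>x. u x + v x)) p = L2_inner M (\<lambda>x. weak_grad \<Omega> u x + weak_grad \<Omega> v x) p"
    by (intro L2_inner_cong_AE H1_add weak_grad_H1 L2_add assms) auto
  then show ?thesis by (simp add: L2_inner_add_left weak_grad_H1 assms)
qed

lemma weak_grad_scale_inner:
  assumes "u \<in> H1 \<Omega>" "p \<in> L2 M"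
  shows "L2_inner M (weak_grad \<Omega> (\<lambda>x. c * u x)) p = c * L2_inner M (weak_grad \<Omega> u) p"
proof -
  have "L2_inner M (weak_grad \<Omega> (\<lambda>x. c * u x)) p = L2_inner M (\<lambda>x. c *\<^sub>R weak_grad \<Omega> u x) p"
    by (intro L2_inner_cong_AE H1_scale weak_grad_H1 L2_scaleR assms) auto
  then show ?thesis by (simp add: L2_inner_scaleR_left)
qed

lemma H1_semi_inner:
  assumes "V \<subseteq> H1 \<Omega>" "V \<noteq> {}" "\<And>u v. u \<in> V \<Longrightarrow> v \<in> V \<Longrightarrow> (\<lambda>x. u x + v x) \<in> V"
    "\<And>c u. u \<in> V \<Longrightarrow> (\<lambda>x. c * u x) \<in> V"
  shows "semi_inner_space V (\<lambda>u v x. u x + v x) (\<lambda>c u x. c * u x) H1_inner"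
proof
  fix u v w :: "'a \<Rightarrow> real" and c
  show "H1_inner u v = H1_inner v u" unfolding H1_inner_def by (metis L2_inner_commute)
  show "0 \<le> H1_inner u u" by (simp add: H1_inner_def L2_inner_def)
  assume u: "u \<in> V" and w: "w \<in> V"
  then have [simp]: "u \<in> H1 \<Omega>" "w \<in> H1 \<Omega>" using assms(1) by auto
  show "H1_inner (\<lambda>x. c * u x) w = c * H1_inner u w"
    using L2_inner_scaleR_left[of M c u w]
    by (simp add: H1_inner_def weak_grad_scale_inner weak_grad_H1 algebra_simps)
  assume "v \<in> V" then have [simp]: "v \<in> H1 \<Omega>" using assms(1) by auto
  show "H1_inner (\<lambda>x. u x + v x) w = H1_inner u w + H1_inner v w"
    by (simp add: H1_inner_def weak_grad_add_inner weak_grad_H1 L2_inner_add_left H1_L2)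
qed (use assms in auto)

sublocale H1: semi_inner_space "H1 \<Omega>" "\<lambda>u v x. u x + v x" "\<lambda>c u x. c * u x" H1_inner
proof (rule H1_semi_inner)
  show "H1 \<Omega> \<noteq> {}" using H1_zero by blast
qed (auto intro: H1_add(1) H1_scale(1))

lemma H1_nrm: "H1.nrm v = H1_norm \<Omega> v"
  by (simp add: H1.nrm_def H1_norm_def H1_inner_def L2_norm_square)

lemma H1_norm_nonneg: "0 \<le> H1_norm \<Omega> v"
  by (simp add: H1_norm_def)

lemma H1_norm_add: "u \<in> H1 \<Omega> \<Longrightarrow> v \<in> H1 \<Omega> \<Longrightarrow> H1_norm \<Omega> (\<lambda>x. u x + v x) \<le> H1_norm \<Omega> u + H1_norm \<Omega> v"
  using H1.nrm_add by (simp add: H1_nrm)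

lemma H1_norm_diff: "u \<in> H1 \<Omega> \<Longrightarrow> v \<in> H1 \<Omega> \<Longrightarrow> H1_norm \<Omega> (\<lambda>x. u x - v x) \<le> H1_norm \<Omega> u + H1_norm \<Omega> v"
  using H1.nrm_sub by (simp add: H1_nrm H1.sub_def)

lemma H1_norm_scale: "u \<in> H1 \<Omega> \<Longrightarrow> H1_norm \<Omega> (\<lambda>x. c * u x) = \<bar>c\<bar> * H1_norm \<Omega> u"
  using H1.nrm_scale by (simp add: H1_nrm)

lemma H1_norm_zero: "H1_norm \<Omega> (\<lambda>x. 0) = 0"
  using H1_norm_scale[OF H1_zero, of 0] by simp

lemma L2_norm_le_H1_norm: "L2_norm M v \<le> H1_norm \<Omega> v" "L2_norm M (weak_grad \<Omega> v) \<le> H1_norm \<Omega> v"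
  by (auto simp: H1_norm_def intro!: real_le_rsqrt)

lemma H1_norm_le: "H1_norm \<Omega> v \<le> L2_norm M v + L2_norm M (weak_grad \<Omega> v)"
  unfolding H1_norm_def by (rule sqrt_sum_squares_le_sum) (auto simp: L2_norm_nonneg)

lemma H1_norm_cong_AE:
  assumes "u \<in> H1 \<Omega>" "v \<in> L2 M" "AE x in M. u x = v x"
  shows "v \<in> H1 \<Omega>" "AE x in M. weak_grad \<Omega> v x = weak_grad \<Omega> u x" "H1_norm \<Omega> v = H1_norm \<Omega> u"
proof -
  have "has_weak_grad \<Omega> v (weak_grad \<Omega> u)"
    unfolding has_weak_grad_def
  proof (intro allI impI ballI)
    fix \<phi> and i :: 'a assume "test_function \<Omega> \<phi>" "i \<in> Basis"
    moreover have "L2_inner M v (\<lambda>x. grad \<phi> x \<bullet> i) = L2_inner M u (\<lambda>x. grad \<phi> x \<bullet> i)"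
      using assms calculation by (intro L2_inner_cong_AE) (auto intro: grad_component_L2 test_functionD H1_L2)
    ultimately show "L2_inner M v (\<lambda>x. grad \<phi> x \<bullet> i) = - L2_inner M (\<lambda>x. weak_grad \<Omega> u x \<bullet> i) \<phi>"
      using weak_grad_H1(2)[OF assms(1)] by (simp add: has_weak_grad_def)
  qed
  note v = H1_I[OF assms(2) weak_grad_H1(1)[OF assms(1)] this]
  show "v \<in> H1 \<Omega>" "AE x in M. weak_grad \<Omega> v x = weak_grad \<Omega> u x" by (rule v)+
  have "L2_norm M (weak_grad \<Omega> v) = L2_norm M (weak_grad \<Omega> u)"
    by (intro L2_norm_cong_AE weak_grad_H1 v assms)
  moreover have "L2_norm M v = L2_norm M u"
    using assms by (intro L2_norm_cong_AE H1_L2 v) auto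
  ultimately show "H1_norm \<Omega> v = H1_norm \<Omega> u" by (simp add: H1_norm_def)
qed

text \<open>The weak gradient is a closed operator: for a fixed test function both sides of its
  defining identity are continuous in \<open>L2\<close>, so the limits of the functions and of their
  gradients still satisfy it.\<close>

lemma H1_complete:
  assumes X: "\<And>n. X n \<in> H1 \<Omega>"
    and Cauchy: "\<And>e. e > 0 \<Longrightarrow> \<exists>N. \<forall>m\<ge>N. \<forall>n\<ge>N. H1_norm \<Omega> (\<lambda>x. X m x - X n x) < e"
  shows "\<exists>l\<in>H1 \<Omega>. (\<lambda>n. H1_norm \<Omega> (\<lambda>x. X n x - l x)) \<longlonglongrightarrow> 0"
proof -
  have "\<exists>N. \<forall>m\<ge>N. \<forall>n\<ge>N. L2_norm M (\<lambda>x. X m x - X n x) < e" if "e > 0" for e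
    using Cauchy[OF that] L2_norm_le_H1_norm(1) by (meson le_less_trans)
  from L2_complete[OF finite_M H1_L2[OF X] this]
  obtain l where l: "l \<in> L2 M" "(\<lambda>n. L2_norm M (\<lambda>x. X n x - l x)) \<longlonglongrightarrow> 0" by blast
  have grad_diff: "L2_norm M (\<lambda>x. weak_grad \<Omega> (X m) x - weak_grad \<Omega> (X n) x)
      = L2_norm M (weak_grad \<Omega> (\<lambda>x. X m x - X n x))" for m n
    using H1_diff(2)[OF X X, of m n]
    by (intro L2_norm_cong_AE L2_diff weak_grad_H1 H1_diff X) (auto elim: eventually_mono)
  have "\<exists>N. \<forall>m\<ge>N. \<forall>n\<ge>N. L2_norm M (\<lambda>x. weak_grad \<Omega> (X m) x - weak_grad \<Omega> (X n) x) < e" if "e > 0" for e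
    using Cauchy[OF that] L2_norm_le_H1_norm(2) unfolding grad_diff by (meson le_less_trans)
  from L2_complete[OF finite_M weak_grad_H1(1)[OF X] this]
  obtain p where p: "p \<in> L2 M" "(\<lambda>n. L2_norm M (\<lambda>x. weak_grad \<Omega> (X n) x - p x)) \<longlonglongrightarrow> 0" by blast
  have "has_weak_grad \<Omega> l p"
    unfolding has_weak_grad_def
  proof (intro allI impI ballI)
    fix \<phi> and i :: 'a assume \<phi>: "test_function \<Omega> \<phi>" and i: "i \<in> Basis"
    note s = test_functionD(1)[OF \<phi>]
    have "(\<lambda>n. L2_norm M (\<lambda>x. weak_grad \<Omega> (X n) x \<bullet> i - p x \<bullet> i)) \<longlonglongrightarrow> 0"
    proof (rule tendsto_sandwich[OF _ _ tendsto_const p(2)])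
      show "\<forall>\<^sub>F n in sequentially. L2_norm M (\<lambda>x. weak_grad \<Omega> (X n) x \<bullet> i - p x \<bullet> i) \<le> L2_norm M (\<lambda>x. weak_grad \<Omega> (X n) x - p x)"
        using L2_norm_component_le[OF L2_diff[OF weak_grad_H1(1)[OF X] p(1)]] i
        by (simp add: inner_diff_left)
    qed (simp add: L2_norm_nonneg)
    then have "(\<lambda>n. L2_inner M (\<lambda>x. weak_grad \<Omega> (X n) x \<bullet> i) \<phi>) \<longlonglongrightarrow> L2_inner M (\<lambda>x. p x \<bullet> i) \<phi>"
      by (intro L2_inner_tendsto L2_component weak_grad_H1 X p smooth_L2 s)
    then have 1: "(\<lambda>n. - L2_inner M (\<lambda>x. weak_grad \<Omega> (X n) x \<bullet> i) \<phi>) \<longlonglongrightarrow> - L2_inner M (\<lambda>x. p x \<bullet> i) \<phi>"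
      by (rule tendsto_minus)
    have "(\<lambda>n. L2_inner M (X n) (\<lambda>x. grad \<phi> x \<bullet> i)) \<longlonglongrightarrow> L2_inner M l (\<lambda>x. grad \<phi> x \<bullet> i)"
      by (intro L2_inner_tendsto H1_L2 X l grad_component_L2 s)
    moreover have "L2_inner M (X n) (\<lambda>x. grad \<phi> x \<bullet> i) = - L2_inner M (\<lambda>x. weak_grad \<Omega> (X n) x \<bullet> i) \<phi>" for n
      using weak_grad_H1(2)[OF X] \<phi> i by (simp add: has_weak_grad_def)
    ultimately show "L2_inner M l (\<lambda>x. grad \<phi> x \<bullet> i) = - L2_inner M (\<lambda>x. p x \<bullet> i) \<phi>"
      using LIMSEQ_unique[OF _ 1] by simp
  qed
  note l' = H1_I[OF l(1) p(1) this]
  have "(\<lambda>n. H1_norm \<Omega> (\<lambda>x. X n x - l x)) \<longlonglongrightarrow> 0"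
  proof (rule tendsto_sandwich[OF _ _ tendsto_const])
    show "(\<lambda>n. L2_norm M (\<lambda>x. X n x - l x) + L2_norm M (\<lambda>x. weak_grad \<Omega> (X n) x - p x)) \<longlonglongrightarrow> 0"
      using tendsto_add[OF l(2) p(2)] by simp
    have "L2_norm M (weak_grad \<Omega> (\<lambda>x. X n x - l x)) = L2_norm M (\<lambda>x. weak_grad \<Omega> (X n) x - p x)" for n
    proof (rule L2_norm_cong_AE)
      show "AE x in M. weak_grad \<Omega> (\<lambda>x. X n x - l x) x = weak_grad \<Omega> (X n) x - p x"
        using H1_diff(2)[OF X l'(1)] l'(2) by eventually_elim simp
    qed (intro weak_grad_H1 H1_diff L2_diff X l' p)+
    then show "\<forall>\<^sub>F n in sequentially. H1_norm \<Omega> (\<lambda>x. X n x - l x) \<le>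
        L2_norm M (\<lambda>x. X n x - l x) + L2_norm M (\<lambda>x. weak_grad \<Omega> (X n) x - p x)"
      using H1_norm_le[of "\<lambda>x. X _ x - l x"] by (intro always_eventually) simp
  qed (simp add: H1_norm_nonneg)
  with l'(1) show ?thesis by blast
qed

end

section \<open>Surface measure of Lipschitz graphs\<close>

lemma sets_surface_measure: "sets surface_measure = sets borel" "space surface_measure = UNIV"
  using sets.sigma_sets_eq[of borel] by (simp_all add: surface_measure_def)

lemma hausdorff_content_antimono:
  assumes "\<delta> \<le> \<delta>'" shows "hausdorff_content \<delta>' S \<le> hausdorff_content \<delta> S"
  unfolding hausdorff_content_def by (rule INF_superset_mono) (auto intro: order_trans[OF _ assms])

lemma hausdorff_content_le:
  fixes E :: "nat \<Rightarrow> 'a::euclidean_space set"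
  assumes "S \<subseteq> (\<Union>i. E i)" "\<And>i. bounded (E i) \<and> diameter (E i) \<le> \<delta>"
  shows "hausdorff_content \<delta> S
    \<le> (\<Sum>i. ennreal (unit_ball_vol (real (DIM('a) - 1)) * (diameter (E i) / 2) ^ (DIM('a) - 1)))"
  unfolding hausdorff_content_def by (rule INF_lower) (use assms in auto)

text \<open>An upper bound holds without any appeal to countable additivity:
  \<open>measure_of\<close> yields the given set function if that is a measure and 0 otherwise. The
  scale is 10/(n+1) because a Vitali covering by balls of radius \<epsilon> = 1/(n+1), enlarged
  fivefold, consists of sets of diameter 10 \<epsilon>.\<close>

lemma emeasure_surface_measure_le:
  "emeasure surface_measure S \<le> (SUP n. hausdorff_content (10 / real (Suc n)) S)"
proof -
  have "emeasure surface_measure S \<le> (SUP \<delta>\<in>{0<..}. hausdorff_content \<delta> S)"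
    unfolding surface_measure_def by (simp add: emeasure_measure_of_conv)
  also have "\<dots> \<le> (SUP n. hausdorff_content (10 / real (Suc n)) S)"
  proof (rule SUP_least)
    fix \<delta> :: real assume "\<delta> \<in> {0<..}"
    then have "0 < \<delta> / 10" by simp
    then obtain n where "1 / real (Suc n) < \<delta> / 10" using nat_approx_posE by metis
    then have "10 / real (Suc n) \<le> \<delta>" by (simp add: field_simps)
    then show "hausdorff_content \<delta> S \<le> (SUP n. hausdorff_content (10 / real (Suc n)) S)"
      by (intro SUP_upper2[of n] hausdorff_content_antimono) auto
  qed
  finally show ?thesis .
qed

lemma hausdorff_content_tendsto:
  "(\<lambda>n. hausdorff_content (10 / real (Suc n)) S) \<longlonglongrightarrow> (SUP n. hausdorff_content (10 / real (Suc n)) S)"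
  by (intro LIMSEQ_SUP incseq_SucI hausdorff_content_antimono) (simp add: frac_le)

locale lipschitz_graph =
  fixes \<nu> :: "'a::euclidean_space" and \<gamma> :: "'a \<Rightarrow> real" and L :: real
  assumes norm_\<nu>: "norm \<nu> = 1" and Lipschitz: "L-lipschitz_on {z. z \<bullet> \<nu> = 0} \<gamma>"
begin

definition height :: "'a \<Rightarrow> real" where "height x = x \<bullet> \<nu> - \<gamma> (x - (x \<bullet> \<nu>) *\<^sub>R \<nu>)"

lemma \<nu>_\<nu>: "\<nu> \<bullet> \<nu> = 1"
  using norm_\<nu> by (simp add: norm_eq_1)

lemma height_translate: "height (x + t *\<^sub>R \<nu>) = height x + t"
  by (simp add: height_def inner_add_left \<nu>_\<nu> algebra_simps)

lemma L_nonneg: "0 \<le> L"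
  using Lipschitz by (rule lipschitz_on_nonneg)

lemma height_Lipschitz: "\<bar>height x - height y\<bar> \<le> (1 + L) * norm (x - y)"
proof -
  let ?P = "\<lambda>x. x - (x \<bullet> \<nu>) *\<^sub>R \<nu>"
  have "(norm (?P (x - y)))\<^sup>2 = (norm (x - y))\<^sup>2 - ((x - y) \<bullet> \<nu>)\<^sup>2"
    unfolding power2_norm_eq_inner
    by (simp add: inner_diff_left inner_diff_right \<nu>_\<nu> inner_commute power2_eq_square algebra_simps)
  then have "(norm (?P (x - y)))\<^sup>2 \<le> (norm (x - y))\<^sup>2" by simp
  then have "norm (?P (x - y)) \<le> norm (x - y)" by (rule power2_le_imp_le) simp
  moreover have "?P x - ?P y = ?P (x - y)" by (simp add: inner_diff_left scaleR_diff_left)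
  ultimately have P: "norm (?P x - ?P y) \<le> norm (x - y)" by (simp only:)
  have "dist (\<gamma> (?P x)) (\<gamma> (?P y)) \<le> L * dist (?P x) (?P y)"
    by (rule lipschitz_onD[OF Lipschitz]) (auto simp: inner_diff_left \<nu>_\<nu>)
  also have "\<dots> \<le> L * norm (x - y)"
    using P L_nonneg by (intro mult_left_mono) (auto simp: dist_norm)
  finally have "\<bar>\<gamma> (?P x) - \<gamma> (?P y)\<bar> \<le> L * norm (x - y)" by (simp add: dist_norm)
  moreover have "\<bar>(x - y) \<bullet> \<nu>\<bar> \<le> norm (x - y)"
    using Cauchy_Schwarz_ineq2[of "x - y" \<nu>] norm_\<nu> by simp
  ultimately show ?thesis unfolding height_def by (simp add: inner_diff_left algebra_simps)
qed

lemma continuous_height: "continuous_on S height"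
proof -
  have "(1 + L)-lipschitz_on S height"
    using height_Lipschitz L_nonneg by (intro lipschitz_onI) (auto simp: dist_norm)
  then show ?thesis by (rule lipschitz_on_continuous_on)
qed

lemma height_measurable [measurable]: "height \<in> borel_measurable borel"
  by (intro borel_measurable_continuous_onI continuous_height)

text \<open>Half open, so that inside a boundary patch it is exactly \<Omega> minus its translate by
  \<epsilon> \<nu>.\<close>

definition strip :: "real \<Rightarrow> 'a set" where "strip \<epsilon> = {x. 0 < height x \<and> height x \<le> \<epsilon>}"

lemma strip_measurable [measurable]: "strip \<epsilon> \<in> sets borel"
  unfolding strip_def by measurable

text \<open>Content per volume in dimension d: a covering ball of radius 5 \<epsilon> contributes
  \<open>unit_ball_vol (d - 1)\<close> times (5 \<epsilon>)^(d-1), and the ball of radius \<epsilon>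
  / (2 (1 + L)) charged for it has volume \<open>unit_ball_vol d\<close> times the d-th power of
  that radius. The quotient is \<open>cover_const / \<epsilon>\<close>.\<close>

definition cover_const :: real where
  "cover_const = unit_ball_vol (real (DIM('a) - 1)) * 5 ^ (DIM('a) - 1) * (2 * (1 + L)) ^ DIM('a)
     / unit_ball_vol (real DIM('a))"

lemma cover_const_pos: "0 < cover_const"
  using L_nonneg by (simp add: cover_const_def)

text \<open>
  Disjoint balls of radius \<open>\<epsilon>\<close> around points of the graph each contain a ball of comparable
  radius inside the strip, so the number of balls is controlled by the volume of the strip.
\<close>

lemma hausdorff_content_le_strip:
  assumes dim: "2 \<le> DIM('a)" and E: "\<And>x. x \<in> E \<Longrightarrow> height x = 0" and \<epsilon>: "0 < \<epsilon>"
    and N: "\<And>x. x \<in> E \<Longrightarrow> cball x \<epsilon> \<subseteq> N" and [measurable]: "N \<in> sets borel"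
  shows "hausdorff_content (10 * \<epsilon>) E \<le> ennreal (cover_const / \<epsilon>) * emeasure lborel (strip \<epsilon> \<inter> N)"
proof -
  \<comment> \<open>\<open>height\<close> has Lipschitz constant 1 + L, so on a ball of radius c
    \<epsilon> it differs from its value at the centre by less than \<epsilon> / 2; a ball centred
    at height \<epsilon> / 2 therefore stays in the strip.\<close>
  define c where "c = 1 / (2 * (1 + L))"
  have c: "0 < c" "c \<le> 1 / 2" "(1 + L) * c = 1 / 2" 
    using L_nonneg by (auto simp: c_def field_simps)
  obtain C where C: "countable C" "C \<subseteq> E"
    "pairwise (\<lambda>i j. disjnt (cball i \<epsilon>) (cball j \<epsilon>)) C" "E \<subseteq> (\<Union>i\<in>C. cball i (5 * \<epsilon>))"
    using Vitali_covering_lemma_cballs[where S=E and K=E and a="\<lambda>x. x" and r="\<lambda>_. \<epsilon>" and B=\<epsilon>] \<epsilon>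
    by (metis UN_I centre_in_cball less_imp_le order_refl subsetI)
  \<comment> \<open>\<open>hausdorff_content\<close> wants covers indexed by all naturals: the
    countable set of centres is enumerated along J, and the remaining indices get the empty
    set.\<close>
  define J where "J = to_nat_on C ` C"
  define g where "g = inv_into C (to_nat_on C)"
  have g: "g k \<in> C" if "k \<in> J" for k using that by (auto simp: g_def J_def inv_into_into)
  have g_inj: "g k \<noteq> g l" if "k \<in> J" "l \<in> J" "k \<noteq> l" for k l
    using that unfolding g_def J_def by (metis f_inv_into_f)
  define U where "U k = (if k \<in> J then cball (g k) (5 * \<epsilon>) else {})" for k
  define B where "B k = (if k \<in> J then ball (g k + (\<epsilon> / 2) *\<^sub>R \<nu>) (c * \<epsilon>) else {})" for k
  have B: "B k \<subseteq> strip \<epsilon> \<inter> N \<inter> cball (g k) \<epsilon>" if k: "k \<in> J" for k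
  proof
    fix z assume "z \<in> B k"
    then have z: "norm (g k + (\<epsilon> / 2) *\<^sub>R \<nu> - z) < c * \<epsilon>" using k by (simp add: B_def dist_norm)
    have "\<bar>height (g k + (\<epsilon> / 2) *\<^sub>R \<nu>) - height z\<bar> \<le> (1 + L) * norm (g k + (\<epsilon> / 2) *\<^sub>R \<nu> - z)"
      by (rule height_Lipschitz)
    also have "\<dots> < (1 + L) * (c * \<epsilon>)"
      using z L_nonneg by (intro mult_strict_left_mono) auto
    also have "\<dots> = \<epsilon> / 2" using c(3) by (simp add: mult.assoc[symmetric])
    finally have "\<bar>\<epsilon> / 2 - height z\<bar> < \<epsilon> / 2"
      using E g[OF k] C(2) by (auto simp: height_translate)
    then have 1: "z \<in> strip \<epsilon>" by (auto simp: strip_def abs_if split: if_splits)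
    have "c * \<epsilon> \<le> 1 / 2 * \<epsilon>" using c \<epsilon> by (intro mult_right_mono) auto
    moreover have "norm ((\<epsilon> / 2) *\<^sub>R \<nu>) = \<epsilon> / 2" using \<epsilon> norm_\<nu> by simp
    moreover have "norm (g k - z) \<le> norm (g k + (\<epsilon> / 2) *\<^sub>R \<nu> - z) + norm ((\<epsilon> / 2) *\<^sub>R \<nu>)"
      using norm_triangle_ineq4[of "g k + (\<epsilon> / 2) *\<^sub>R \<nu> - z" "(\<epsilon> / 2) *\<^sub>R \<nu>"] by (simp add: algebra_simps)
    ultimately have 2: "z \<in> cball (g k) \<epsilon>" using z unfolding mem_cball dist_norm by linarith
    then show "z \<in> strip \<epsilon> \<inter> N \<inter> cball (g k) \<epsilon>" using 1 N[of "g k"] g[OF k] C(2) by blast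
  qed
  have term_le: "ennreal (unit_ball_vol (real (DIM('a) - 1)) * (diameter (U k) / 2) ^ (DIM('a) - 1))
      \<le> ennreal (cover_const / \<epsilon>) * emeasure lborel (B k)" for k
  proof (cases "k \<in> J")
    case True
    obtain m where DIM: "DIM('a) = Suc m" using dim by (cases "DIM('a)") auto
    have "cover_const / \<epsilon> * (unit_ball_vol (real DIM('a)) * (c * \<epsilon>) ^ DIM('a))
        = unit_ball_vol (real (DIM('a) - 1)) * 5 ^ (DIM('a) - 1) * ((2 * (1 + L)) * c) ^ DIM('a) * (\<epsilon> ^ DIM('a) / \<epsilon>)"
      using unit_ball_vol_pos[of "real DIM('a)"]
      by (simp add: cover_const_def power_mult_distrib del: unit_ball_vol_pos)
    also have "2 * (1 + L) * c = 1" using c(3) by (simp add: algebra_simps)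
    also have "\<epsilon> ^ DIM('a) / \<epsilon> = \<epsilon> ^ (DIM('a) - 1)" using \<epsilon> by (simp add: DIM)
    finally have "cover_const / \<epsilon> * (unit_ball_vol (real DIM('a)) * (c * \<epsilon>) ^ DIM('a))
       = unit_ball_vol (real (DIM('a) - 1)) * (diameter (U k) / 2) ^ (DIM('a) - 1)"
      using True \<epsilon> by (simp add: U_def power_mult_distrib)
    moreover have "emeasure lborel (B k) = ennreal (unit_ball_vol (real DIM('a)) * (c * \<epsilon>) ^ DIM('a))"
      using True c \<epsilon> by (simp add: B_def emeasure_ball)
    ultimately show ?thesis using cover_const_pos \<epsilon> c
      by (simp add: ennreal_mult'[symmetric])
  next
    case False
    then show ?thesis using dim by (simp add: U_def power_0_left)
  qed
  have "hausdorff_content (10 * \<epsilon>) E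
      \<le> (\<Sum>k. ennreal (unit_ball_vol (real (DIM('a) - 1)) * (diameter (U k) / 2) ^ (DIM('a) - 1)))"
  proof (rule hausdorff_content_le)
    show "E \<subseteq> (\<Union>k. U k)"
    proof
      fix x assume "x \<in> E"
      then obtain i where i: "i \<in> C" "x \<in> cball i (5 * \<epsilon>)" using C(4) by blast
      have "g (to_nat_on C i) = i" unfolding g_def using i C(1) by (intro inv_into_f_f inj_on_to_nat_on)
      then show "x \<in> (\<Union>k. U k)" using i by (intro UN_I[of "to_nat_on C i"]) (auto simp: U_def J_def)
    qed
  qed (use \<epsilon> in \<open>auto simp: U_def\<close>)
  also have "\<dots> \<le> (\<Sum>k. ennreal (cover_const / \<epsilon>) * emeasure lborel (B k))"
    by (intro suminf_le term_le) auto
  also have "\<dots> = ennreal (cover_const / \<epsilon>) * (\<Sum>k. emeasure lborel (B k))" by simp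
  also have "(\<Sum>k. emeasure lborel (B k)) = emeasure lborel (\<Union>k. B k)"
  proof (rule suminf_emeasure)
    show "disjoint_family B"
      unfolding disjoint_family_on_def
    proof (intro ballI impI)
      fix k l :: nat assume kl: "k \<noteq> l"
      show "B k \<inter> B l = {}"
      proof (cases "k \<in> J \<and> l \<in> J")
        case True
        then have "disjnt (cball (g k) \<epsilon>) (cball (g l) \<epsilon>)"
          using C(3) g g_inj kl by (simp add: pairwise_def)
        then show ?thesis using B[of k] B[of l] True unfolding disjnt_def by blast
      qed (auto simp: B_def)
    qed
  qed (auto simp: B_def)
  also have "\<dots> \<le> emeasure lborel (strip \<epsilon> \<inter> N)"
  proof (rule emeasure_mono)
    have "B k \<subseteq> strip \<epsilon> \<inter> N" for k
    proof (cases "k \<in> J")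
      case True
      then show ?thesis using B by blast
    qed (simp add: B_def)
    then show "(\<Union>k. B k) \<subseteq> strip \<epsilon> \<inter> N" by blast
  qed simp
  finally show ?thesis by (simp add: mult_left_mono)
qed

end

section \<open>The trace inequality\<close>

text \<open>At most t / \<delta> + 2 naturals k satisfy k - 1 \<le> t / \<delta>. The levels are
  lowered by one because a point near the set where \<phi>^2 \<ge> k \<delta> is only known to
  satisfy \<phi>^2 \<ge> (k - 1) \<delta>.\<close>

lemma sum_levels_le:
  fixes t \<delta> :: real assumes "0 \<le> t" "0 < \<delta>"
  shows "(\<Sum>k\<le>m. if (real k - 1) * \<delta> \<le> t then \<delta> else 0) \<le> t + 2 * \<delta>"
proof (induction m)
  case (Suc m)
  show ?case
  proof (cases "(real (Suc m) - 1) * \<delta> \<le> t")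
    case True
    have "(\<Sum>k\<le>Suc m. if (real k - 1) * \<delta> \<le> t then \<delta> else 0) \<le> (\<Sum>k\<le>Suc m. \<delta>)"
      using assms(2) by (intro sum_mono) auto
    also have "\<dots> \<le> t + 2 * \<delta>" using True by (simp add: algebra_simps)
    finally show ?thesis .
  qed (use Suc in simp)
qed (use assms in auto)

text \<open>More than t / \<delta> levels lie at or below t, since level 0 counts as well; the bound
  on t ensures that the cut at m loses none of them.\<close>

lemma le_sum_levels:
  fixes t \<delta> :: real assumes "0 \<le> t" "0 < \<delta>"
  shows "t < real (Suc m) * \<delta> \<Longrightarrow> t \<le> (\<Sum>k\<le>m. if real k * \<delta> \<le> t then \<delta> else 0)"
proof (induction m)
  case (Suc m)
  show ?case
  proof (cases "t < real (Suc m) * \<delta>")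
    case True
    then show ?thesis using Suc.IH assms by simp
  next
    case False
    have "real k * \<delta> \<le> t" if "k \<le> Suc m" for k
    proof -
      have "real k * \<delta> \<le> real (Suc m) * \<delta>" using that assms by (intro mult_right_mono) auto
      then show ?thesis using False by linarith
    qed
    then have "(\<Sum>k\<le>Suc m. if real k * \<delta> \<le> t then \<delta> else 0) = (\<Sum>k\<le>Suc m. \<delta>)"
      by (intro sum.cong) auto
    also have "\<dots> = real (Suc (Suc m)) * \<delta>" by simp
    finally show ?thesis using Suc.prems by simp
  qed
qed (use assms in auto)

lemma (in bounded_open) integral_M_eq_lborel:
  fixes f :: "'a \<Rightarrow> real"
  assumes [measurable]: "f \<in> borel_measurable borel"
  shows "(\<integral>x. f x \<partial>M) = (\<integral>x. indicator \<Omega> x * f x \<partial>lborel)"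
proof -
  have [measurable]: "\<Omega> \<in> sets borel" by (rule sets_\<Omega>)
  have "(\<integral>x. f x \<partial>M) = (\<integral>x. indicator \<Omega> x * f x \<partial>lebesgue)"
    by (simp add: integral_restrict_space sets_\<Omega>)
  also have "\<dots> = (\<integral>x. indicator \<Omega> x * f x \<partial>lborel)"
    by (rule integral_completion) simp
  finally show ?thesis .
qed

locale graph_patch = lipschitz_graph \<nu> \<gamma> L + bounded_open \<Omega>
  for \<nu> :: "'a::euclidean_space" and \<gamma> :: "'a \<Rightarrow> real" and L :: real and \<Omega> :: "'a set" +
  fixes x0 :: 'a and r :: real
  assumes dim: "2 \<le> DIM('a)"
    and patch: "\<Omega> \<inter> ball x0 r = {x \<in> ball x0 r. x \<bullet> \<nu> > \<gamma> (x - (x \<bullet> \<nu>) *\<^sub>R \<nu>)}"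
begin

lemma patch_iff: "x \<in> ball x0 r \<Longrightarrow> x \<in> \<Omega> \<longleftrightarrow> 0 < height x"
  using patch unfolding height_def by (auto simp: set_eq_iff)

text \<open>A boundary point is not in the open set \<Omega>, and a point of the patch with negative
  height has a neighbourhood free of \<Omega>.\<close>

lemma frontier_height:
  assumes "x \<in> frontier \<Omega>" "x \<in> ball x0 r" shows "height x = 0"
proof -
  have "x \<notin> \<Omega>" using assms(1) open_\<Omega> by (auto simp: frontier_def interior_open)
  then have le: "height x \<le> 0" using patch_iff[OF assms(2)] by simp
  have "\<not> height x < 0"
  proof
    assume "height x < 0"
    moreover have "open (ball x0 r \<inter> {y. height y < 0})"
      by (intro open_Int open_ball open_Collect_less continuous_height continuous_on_const)
    ultimately have "\<Omega> \<inter> (ball x0 r \<inter> {y. height y < 0}) \<noteq> {}"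
      using assms open_Int_closure_eq_empty[of "ball x0 r \<inter> {y. height y < 0}" \<Omega>]
      by (auto simp: frontier_def)
    then show False using patch_iff by force
  qed
  with le show ?thesis by simp
qed

lemma strip_integral_tendsto:
  assumes F: "smooth F" and supp: "{x. F x \<noteq> 0} \<subseteq> cball x0 \<rho>" and "\<rho> < r"
  shows "(\<lambda>n. real (Suc n) * (\<integral>x. indicator (strip (1 / real (Suc n))) x * F x \<partial>lborel))
    \<longlonglongrightarrow> - (\<integral>x. indicator \<Omega> x * (grad F x \<bullet> \<nu>) \<partial>lborel)"
proof -
  have [measurable]: "\<Omega> \<in> sets borel" by (rule sets_\<Omega>)
  have bdd: "bounded {x. F x \<noteq> 0}" using supp bounded_cball bounded_subset by blast
  have [measurable]: "F \<in> borel_measurable borel"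
    by (intro borel_measurable_continuous_onI smooth_continuous F)
  have intF: "integrable lborel F" by (intro integrable_compact_support smooth_continuous F bdd)
  have eq: "- (\<integral>x. indicator \<Omega> x * (F (x + \<epsilon> *\<^sub>R \<nu>) - F x) \<partial>lborel) = (\<integral>x. indicator (strip \<epsilon>) x * F x \<partial>lborel)"
    if \<epsilon>: "0 < \<epsilon>" "\<epsilon> < r - \<rho>" for \<epsilon>
  proof -
    \<comment> \<open>The change of variables y = x + \<epsilon> \<nu> moves the shift from F to the
      indicator, where it becomes a translate of \<Omega>.\<close>
    define g where "g y = indicator \<Omega> (y - \<epsilon> *\<^sub>R \<nu>) * F y" for y
    have [measurable]: "g \<in> borel_measurable borel" unfolding g_def by measurable
    have g: "integrable lborel g"
      by (rule Bochner_Integration.integrable_bound[OF intF]) (auto simp: g_def indicator_def)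
    have g': "integrable lborel (\<lambda>x. g (x + \<epsilon> *\<^sub>R \<nu>))"
    proof -
      have "integrable (distr lborel borel ((+) (\<epsilon> *\<^sub>R \<nu>))) g" using g by (simp add: lborel_distr_plus)
      then show ?thesis by (subst (asm) integrable_distr_eq) (auto simp: add.commute)
    qed
    have i: "integrable lborel (\<lambda>x. indicator \<Omega> x * F x)"
      using integrable_mult_indicator[OF _ intF, of \<Omega>] by simp
    have "(\<integral>x. indicator \<Omega> x * (F (x + \<epsilon> *\<^sub>R \<nu>) - F x) \<partial>lborel) = (\<integral>x. g (x + \<epsilon> *\<^sub>R \<nu>) - indicator \<Omega> x * F x \<partial>lborel)"
      by (simp add: g_def algebra_simps)
    also have "\<dots> = (\<integral>x. g x \<partial>lborel) - (\<integral>x. indicator \<Omega> x * F x \<partial>lborel)"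
      using g' i lborel_integral_translate[of g] by simp
    also have "\<dots> = (\<integral>x. g x - indicator \<Omega> x * F x \<partial>lborel)" using g i by simp
    also have "\<dots> = (\<integral>x. - (indicator (strip \<epsilon>) x * F x) \<partial>lborel)"
    proof (rule Bochner_Integration.integral_cong)
      fix y
      show "g y - indicator \<Omega> y * F y = - (indicator (strip \<epsilon>) y * F y)"
      proof (cases "F y = 0")
        case False
        then have y: "dist x0 y \<le> \<rho>" using supp by auto
        \<comment> \<open>\<epsilon> < r - \<rho> keeps the shifted point in the patch, where
          membership in \<Omega> is read off from \<open>height\<close>.\<close>
        have "norm (x0 - y + \<epsilon> *\<^sub>R \<nu>) \<le> norm (x0 - y) + norm (\<epsilon> *\<^sub>R \<nu>)" by (rule norm_triangle_ineq)
        then have "dist x0 (y - \<epsilon> *\<^sub>R \<nu>) < r" using y \<epsilon> norm_\<nu> by (simp add: dist_norm algebra_simps)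
        then have "y - \<epsilon> *\<^sub>R \<nu> \<in> \<Omega> \<longleftrightarrow> \<epsilon> < height y"
          using patch_iff[of "y - \<epsilon> *\<^sub>R \<nu>"] height_translate[of y "- \<epsilon>"] by simp
        moreover have "y \<in> \<Omega> \<longleftrightarrow> 0 < height y" using patch_iff[of y] y \<open>\<rho> < r\<close> by simp
        ultimately show ?thesis using \<epsilon> by (auto simp: g_def strip_def indicator_def)
      qed (simp add: g_def)
    qed simp
    finally show ?thesis by simp
  qed
  have "(\<lambda>n. - (real (Suc n) * (\<integral>x. indicator \<Omega> x * (F (x + (1 / real (Suc n)) *\<^sub>R \<nu>) - F x) \<partial>lborel)))
      \<longlonglongrightarrow> - (\<integral>x. indicator \<Omega> x * (grad F x \<bullet> \<nu>) \<partial>lborel)"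
    by (intro tendsto_minus difference_quotients_tendsto_integral F bdd) simp
  moreover have "\<forall>\<^sub>F n in sequentially. - (real (Suc n) * (\<integral>x. indicator \<Omega> x * (F (x + (1 / real (Suc n)) *\<^sub>R \<nu>) - F x) \<partial>lborel))
      = real (Suc n) * (\<integral>x. indicator (strip (1 / real (Suc n))) x * F x \<partial>lborel)"
  proof -
    have "\<forall>\<^sub>F n in sequentially. inverse (real (Suc n)) < r - \<rho>"
      using LIMSEQ_inverse_real_of_nat \<open>\<rho> < r\<close> by (intro order_tendstoD(2)[where y=0]) auto
    then show ?thesis
    proof eventually_elim
      case (elim n)
      then have e: "1 / real (Suc n) < r - \<rho>" by (simp add: inverse_eq_divide)
      have "0 < 1 / real (Suc n)" by simp
      from eq[OF this e, symmetric] show ?case by (simp only: mult_minus_right)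
    qed
  qed
  ultimately show ?thesis by (rule Lim_transform_eventually)
qed

text \<open>
  Layer-cake decomposition along the level sets of \<open>\<phi>\<^sup>2\<close> at multiples of \<open>\<delta>\<close>; the term \<open>2 * \<delta>\<close> absorbs
  the discretisation, so that one height \<open>\<epsilon>\<close> serves finitely many levels.
\<close>

lemma patch_level_estimate:
  assumes \<zeta>: "smooth \<zeta>" "\<And>x. 0 \<le> \<zeta> x" and supp: "{x. \<zeta> x \<noteq> 0} \<subseteq> cball x0 \<rho>" and "\<rho> < r"
    and c: "0 < c" and \<phi>: "smooth \<phi>" and \<delta>: "0 < \<delta>"
  shows "(\<integral>\<^sup>+x. indicator (frontier \<Omega> \<inter> {x. c \<le> \<zeta> x}) x * ennreal ((\<phi> x)\<^sup>2) \<partial>surface_measure)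
    \<le> ennreal (2 * cover_const / c * - (\<integral>x. indicator \<Omega> x * (grad (\<lambda>x. \<zeta> x * (\<phi> x * \<phi> x + 2 * \<delta>)) x \<bullet> \<nu>) \<partial>lborel))"
proof -
  define F where "F = (\<lambda>x. \<zeta> x * (\<phi> x * \<phi> x + 2 * \<delta>))"
  have F: "smooth F" unfolding F_def by (intro smooth_mult smooth_add smooth_const \<zeta> \<phi>)
  have suppF: "{x. F x \<noteq> 0} \<subseteq> cball x0 \<rho>" using supp by (auto simp: F_def)
  have F_nonneg: "0 \<le> F x" for x using \<zeta>(2)[of x] \<delta> by (simp add: F_def)
  have cont: "continuous_on S \<zeta>" "continuous_on S \<phi>" "continuous_on S F" for S
    by (auto intro: smooth_continuous \<zeta> \<phi> F)
  have [measurable]: "\<zeta> \<in> borel_measurable borel" "\<phi> \<in> borel_measurable borel" "F \<in> borel_measurable borel"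
    by (auto intro: borel_measurable_continuous_onI cont)
  have intF: "integrable lborel F"
    by (intro integrable_compact_support cont bounded_subset[OF bounded_cball suppF])
  define S where "S = {x. c \<le> \<zeta> x}"
  have S_sub: "S \<subseteq> cball x0 \<rho>" using supp c by (auto simp: S_def)
  have [measurable]: "S \<in> sets borel" "frontier \<Omega> \<in> sets borel" unfolding S_def by auto
  have "bounded ((\<lambda>x. \<phi> x * \<phi> x) ` cball x0 (\<rho> + 1))"
    by (intro compact_imp_bounded compact_continuous_image continuous_intros cont compact_cball)
  then obtain b where b: "\<And>x. x \<in> cball x0 (\<rho> + 1) \<Longrightarrow> \<bar>\<phi> x * \<phi> x\<bar> \<le> b"
    unfolding bounded_iff by (metis imageI real_norm_def)
  \<comment> \<open>Levels up to m exhaust the values of \<phi>^2 on the patch, so only finitely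
    many contents have to be controlled by one \<epsilon>.\<close>
  obtain m where m: "b < real m * \<delta>" using reals_Archimedean3[OF \<delta>] by blast
  have bound: "\<phi> x * \<phi> x < real (Suc m) * \<delta>" if "x \<in> S" for x
  proof -
    have "\<phi> x * \<phi> x \<le> b" using b[of x] that S_sub by force
    then show ?thesis using m \<delta> by (simp add: algebra_simps)
  qed
  have unif: "uniformly_continuous_on (cball x0 (\<rho> + 1)) \<zeta>" "uniformly_continuous_on (cball x0 (\<rho> + 1)) (\<lambda>x. \<phi> x * \<phi> x)"
    by (auto intro!: compact_uniformly_continuous continuous_intros cont)
  obtain \<eta>1 where \<eta>1: "\<eta>1 > 0" "\<And>x y. x \<in> cball x0 (\<rho> + 1) \<Longrightarrow> y \<in> cball x0 (\<rho> + 1) \<Longrightarrow> dist y x < \<eta>1 \<Longrightarrow> dist (\<zeta> y) (\<zeta> x) < c / 2"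
    using unif(1) c unfolding uniformly_continuous_on_def by (metis half_gt_zero)
  obtain \<eta>2 where \<eta>2: "\<eta>2 > 0" "\<And>x y. x \<in> cball x0 (\<rho> + 1) \<Longrightarrow> y \<in> cball x0 (\<rho> + 1) \<Longrightarrow> dist y x < \<eta>2 \<Longrightarrow> dist (\<phi> y * \<phi> y) (\<phi> x * \<phi> x) < \<delta>"
    using unif(2) \<delta> unfolding uniformly_continuous_on_def by metis
  define E where "E k = frontier \<Omega> \<inter> S \<inter> {x. real k * \<delta> \<le> \<phi> x * \<phi> x}" for k
  \<comment> \<open>What survives of the conditions of \<open>E k\<close> within distance
    \<epsilon>: by uniform continuity \<zeta> may drop from c to c / 2, and \<phi>^2 by one level.
    The moduli are taken on a ball enlarged by 1, which contains these neighbourhoods as \<epsilon>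
    < 1.\<close>
  define N where "N k = {x. c / 2 \<le> \<zeta> x} \<inter> {x. (real k - 1) * \<delta> \<le> \<phi> x * \<phi> x}" for k
  have [measurable]: "E k \<in> sets borel" "N k \<in> sets borel" for k unfolding E_def N_def by measurable
  have E_sets: "E k \<in> sets surface_measure" for k by (simp add: sets_surface_measure)
  have step: "(\<Sum>k\<le>m. ennreal \<delta> * hausdorff_content (10 / real (Suc n)) (E k))
      \<le> ennreal (2 * cover_const / c * (real (Suc n) * (\<integral>x. indicator (strip (1 / real (Suc n))) x * F x \<partial>lborel)))"
    if n: "inverse (real (Suc n)) < min (min \<eta>1 \<eta>2) 1" for n
  proof -
    define \<epsilon> where "\<epsilon> = 1 / real (Suc n)"
    have \<epsilon>: "0 < \<epsilon>" "\<epsilon> < \<eta>1" "\<epsilon> < \<eta>2" "\<epsilon> < 1" using n by (auto simp: \<epsilon>_def inverse_eq_divide)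
    have "cball x \<epsilon> \<subseteq> N k" if x: "x \<in> E k" for x k
    proof
      fix y assume y: "y \<in> cball x \<epsilon>"
      have x': "x \<in> cball x0 \<rho>" "c \<le> \<zeta> x" "real k * \<delta> \<le> \<phi> x * \<phi> x" using x S_sub by (auto simp: E_def S_def)
      have "y \<in> cball x0 (\<rho> + 1)" "x \<in> cball x0 (\<rho> + 1)"
        using x' y \<epsilon> dist_triangle[of x0 y x] by (auto simp: dist_commute)
      moreover have "dist y x < \<eta>1" "dist y x < \<eta>2" using y \<epsilon> by (auto simp: dist_commute)
      ultimately have "dist (\<zeta> y) (\<zeta> x) < c / 2" "dist (\<phi> y * \<phi> y) (\<phi> x * \<phi> x) < \<delta>"
        using \<eta>1 \<eta>2 by auto
      then show "y \<in> N k" using x' by (auto simp: N_def dist_real_def abs_if algebra_simps split: if_splits)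
    qed
    then have cover: "hausdorff_content (10 * \<epsilon>) (E k) \<le> ennreal (cover_const / \<epsilon>) * emeasure lborel (strip \<epsilon> \<inter> N k)" for k
      using frontier_height S_sub \<open>\<rho> < r\<close> \<epsilon> dim
      by (intro hausdorff_content_le_strip) (auto simp: E_def)
    have "(\<Sum>k\<le>m. ennreal \<delta> * hausdorff_content (10 * \<epsilon>) (E k))
        \<le> (\<Sum>k\<le>m. ennreal \<delta> * (ennreal (cover_const / \<epsilon>) * emeasure lborel (strip \<epsilon> \<inter> N k)))"
      by (intro sum_mono mult_left_mono cover) auto
    also have "\<dots> = ennreal (cover_const / \<epsilon>) * (\<Sum>k\<le>m. ennreal \<delta> * emeasure lborel (strip \<epsilon> \<inter> N k))"
      by (simp add: sum_distrib_left mult_ac)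
    also have "(\<Sum>k\<le>m. ennreal \<delta> * emeasure lborel (strip \<epsilon> \<inter> N k))
        = (\<integral>\<^sup>+x. (\<Sum>k\<le>m. ennreal \<delta> * indicator (strip \<epsilon> \<inter> N k) x) \<partial>lborel)"
      by (subst nn_integral_sum) (auto simp: nn_integral_cmult_indicator)
    also have "\<dots> \<le> (\<integral>\<^sup>+x. ennreal (2 / c * (indicator (strip \<epsilon>) x * F x)) \<partial>lborel)"
    proof (rule nn_integral_mono)
      fix x
      show "(\<Sum>k\<le>m. ennreal \<delta> * indicator (strip \<epsilon> \<inter> N k) x) \<le> ennreal (2 / c * (indicator (strip \<epsilon>) x * F x))"
      proof (cases "x \<in> strip \<epsilon> \<and> c / 2 \<le> \<zeta> x")
        case True
        have "(\<Sum>k\<le>m. ennreal \<delta> * indicator (strip \<epsilon> \<inter> N k) x)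
            = (\<Sum>k\<le>m. ennreal (if (real k - 1) * \<delta> \<le> \<phi> x * \<phi> x then \<delta> else 0))"
          using True by (intro sum.cong) (auto simp: N_def)
        also have "\<dots> = ennreal (\<Sum>k\<le>m. if (real k - 1) * \<delta> \<le> \<phi> x * \<phi> x then \<delta> else 0)"
          using \<delta> by (intro sum_ennreal) auto
        also have "\<dots> \<le> ennreal (\<phi> x * \<phi> x + 2 * \<delta>)"
          by (intro ennreal_leI sum_levels_le \<delta>) simp
        also have "\<dots> \<le> ennreal (2 / c * F x)"
        proof (rule ennreal_leI)
          \<comment> \<open>Here \<zeta> \<ge> c / 2, which is the origin of the factor 2 /
            c.\<close>
          have "1 * (\<phi> x * \<phi> x + 2 * \<delta>) \<le> (2 / c * \<zeta> x) * (\<phi> x * \<phi> x + 2 * \<delta>)"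
            using True c \<delta> by (intro mult_right_mono) (auto simp: field_simps)
          then show "\<phi> x * \<phi> x + 2 * \<delta> \<le> 2 / c * F x" by (simp add: F_def mult.assoc)
        qed
        finally show ?thesis using True by simp
      qed (auto simp: N_def)
    qed
    also have "\<dots> = ennreal (\<integral>x. 2 / c * (indicator (strip \<epsilon>) x * F x) \<partial>lborel)"
    proof (rule nn_integral_eq_integral)
      show "integrable lborel (\<lambda>x. 2 / c * (indicator (strip \<epsilon>) x * F x))"
        using integrable_mult_indicator[OF _ intF, of "strip \<epsilon>"] by simp
    qed (use F_nonneg c in auto)
    also have "ennreal (cover_const / \<epsilon>) * \<dots> = ennreal (cover_const / \<epsilon> * (\<integral>x. 2 / c * (indicator (strip \<epsilon>) x * F x) \<partial>lborel))"
      using cover_const_pos \<epsilon> by (intro ennreal_mult'[symmetric]) simp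
    also have "cover_const / \<epsilon> * (\<integral>x. 2 / c * (indicator (strip \<epsilon>) x * F x) \<partial>lborel)
        = 2 * cover_const / c * (real (Suc n) * (\<integral>x. indicator (strip \<epsilon>) x * F x \<partial>lborel))"
      by (simp add: \<epsilon>_def)
    finally show ?thesis by (simp add: \<epsilon>_def mult_left_mono)
  qed
  have "(\<integral>\<^sup>+x. indicator (frontier \<Omega> \<inter> {x. c \<le> \<zeta> x}) x * ennreal ((\<phi> x)\<^sup>2) \<partial>surface_measure)
      \<le> (\<integral>\<^sup>+x. (\<Sum>k\<le>m. ennreal \<delta> * indicator (E k) x) \<partial>surface_measure)"
  proof (rule nn_integral_mono)
    fix x
    show "indicator (frontier \<Omega> \<inter> {x. c \<le> \<zeta> x}) x * ennreal ((\<phi> x)\<^sup>2) \<le> (\<Sum>k\<le>m. ennreal \<delta> * indicator (E k) x)"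
    proof (cases "x \<in> frontier \<Omega> \<inter> S")
      case True
      have "ennreal ((\<phi> x)\<^sup>2) \<le> ennreal (\<Sum>k\<le>m. if real k * \<delta> \<le> \<phi> x * \<phi> x then \<delta> else 0)"
        using le_sum_levels[OF _ \<delta> bound, of x] True by (intro ennreal_leI) (simp add: power2_eq_square)
      also have "\<dots> = (\<Sum>k\<le>m. ennreal (if real k * \<delta> \<le> \<phi> x * \<phi> x then \<delta> else 0))"
        using \<delta> by (intro sum_ennreal[symmetric]) auto
      also have "\<dots> = (\<Sum>k\<le>m. ennreal \<delta> * indicator (E k) x)"
        using True by (intro sum.cong) (auto simp: E_def)
      finally show ?thesis using True by (simp add: S_def)
    qed (auto simp: S_def)
  qed
  also have "\<dots> = (\<Sum>k\<le>m. ennreal \<delta> * emeasure surface_measure (E k))"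
    using E_sets by (subst nn_integral_sum) (auto simp: nn_integral_cmult_indicator)
  also have "\<dots> \<le> (\<Sum>k\<le>m. ennreal \<delta> * (SUP n. hausdorff_content (10 / real (Suc n)) (E k)))"
    by (intro sum_mono mult_left_mono emeasure_surface_measure_le) auto
  also have "\<dots> \<le> ennreal (2 * cover_const / c * - (\<integral>x. indicator \<Omega> x * (grad F x \<bullet> \<nu>) \<partial>lborel))"
  proof (rule tendsto_le[OF sequentially_bot])
    show "(\<lambda>n. \<Sum>k\<le>m. ennreal \<delta> * hausdorff_content (10 / real (Suc n)) (E k))
        \<longlonglongrightarrow> (\<Sum>k\<le>m. ennreal \<delta> * (SUP n. hausdorff_content (10 / real (Suc n)) (E k)))"
      by (intro tendsto_sum ennreal_tendsto_cmult hausdorff_content_tendsto) simp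
    show "(\<lambda>n. ennreal (2 * cover_const / c * (real (Suc n) * (\<integral>x. indicator (strip (1 / real (Suc n))) x * F x \<partial>lborel))))
        \<longlonglongrightarrow> ennreal (2 * cover_const / c * - (\<integral>x. indicator \<Omega> x * (grad F x \<bullet> \<nu>) \<partial>lborel))"
      by (intro tendsto_ennrealI tendsto_mult_left strip_integral_tendsto[OF F suppF \<open>\<rho> < r\<close>])
    have "\<forall>\<^sub>F n in sequentially. inverse (real (Suc n)) < min (min \<eta>1 \<eta>2) 1"
      using LIMSEQ_inverse_real_of_nat \<eta>1(1) \<eta>2(1) by (intro order_tendstoD(2)[where y=0]) auto
    then show "\<forall>\<^sub>F n in sequentially. (\<Sum>k\<le>m. ennreal \<delta> * hausdorff_content (10 / real (Suc n)) (E k))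
        \<le> ennreal (2 * cover_const / c * (real (Suc n) * (\<integral>x. indicator (strip (1 / real (Suc n))) x * F x \<partial>lborel)))"
      by eventually_elim (rule step)
  qed
  finally show ?thesis by (simp add: F_def)
qed

text \<open>Minus the \<nu>-derivative of \<zeta> (\<phi>^2 + 2 \<delta>) is pointwise at most (B +
  1) (\<phi>^2 + |\<nabla>\<phi>|^2) + 2 \<delta> B, where B bounds |\<nabla>\<zeta>|. Since
  \<delta> is arbitrary, its contribution can be made smaller than any e.\<close>

lemma patch_estimate:
  assumes \<zeta>: "smooth \<zeta>" "\<And>x. 0 \<le> \<zeta> x" "\<And>x. \<zeta> x \<le> 1" and supp: "{x. \<zeta> x \<noteq> 0} \<subseteq> cball x0 \<rho>" and "\<rho> < r"
    and c: "0 < c"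
  shows "\<exists>C\<ge>0. \<forall>\<phi>. smooth \<phi> \<longrightarrow>
    (\<integral>\<^sup>+x. indicator (frontier \<Omega> \<inter> {x. c \<le> \<zeta> x}) x * ennreal ((\<phi> x)\<^sup>2) \<partial>surface_measure)
      \<le> ennreal (C * (\<integral>x. (\<phi> x)\<^sup>2 + (norm (grad \<phi> x))\<^sup>2 \<partial>M))"
proof -
  have "bounded {x. \<zeta> x \<noteq> 0}" using supp bounded_cball bounded_subset by blast
  from smooth_compact_support_grad_bounded[OF \<zeta>(1) this]
  obtain B where B: "B > 0" "\<And>x. norm (grad \<zeta> x) \<le> B" by blast
  define K where "K = 2 * cover_const / c"
  have K: "0 < K" using cover_const_pos c by (simp add: K_def)
  define V where "V = (\<integral>x. (1::real) \<partial>M)"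
  have V: "0 \<le> V" by (simp add: V_def)
  have "(\<integral>\<^sup>+x. indicator (frontier \<Omega> \<inter> {x. c \<le> \<zeta> x}) x * ennreal ((\<phi> x)\<^sup>2) \<partial>surface_measure)
      \<le> ennreal (K * (B + 1) * (\<integral>x. (\<phi> x)\<^sup>2 + (norm (grad \<phi> x))\<^sup>2 \<partial>M))" (is "?lhs \<le> ennreal ?R") if \<phi>: "smooth \<phi>" for \<phi>
  proof (rule ennreal_le_epsilon)
    fix e :: real assume e: "0 < e"
    \<comment> \<open>Solves 2 K \<delta> B (V + 1) = e, with V the volume of \<Omega>; V + 1
      instead of V avoids division by 0.\<close>
    define \<delta> where "\<delta> = e / (2 * K * B * (V + 1))"
    have \<delta>: "0 < \<delta>" using e K B V by (simp add: \<delta>_def)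
    define F where "F = (\<lambda>x. \<zeta> x * (\<phi> x * \<phi> x + 2 * \<delta>))"
    have F: "smooth F" unfolding F_def by (intro smooth_mult smooth_add smooth_const \<zeta> \<phi>)
    define I where "I x = (\<phi> x)\<^sup>2 + (norm (grad \<phi> x))\<^sup>2" for x
    have cont: "continuous_on UNIV I" "continuous_on UNIV (\<lambda>x. grad F x \<bullet> \<nu>)"
      unfolding I_def by (intro continuous_intros smooth_continuous continuous_grad \<phi> F)+
    note int = L2_integrable[OF finite_M continuous_L2[OF cont(1)]] L2_integrable[OF finite_M continuous_L2[OF cont(2)]]
      L2_integrable[OF finite_M continuous_L2[OF continuous_on_const]]
    have pointwise: "- (grad F x \<bullet> \<nu>) \<le> (B + 1) * I x + 2 * \<delta> * B" for x
    proof -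
      have gF: "grad F x = (2 * (\<zeta> x * \<phi> x)) *\<^sub>R grad \<phi> x + (\<phi> x * \<phi> x + 2 * \<delta>) *\<^sub>R grad \<zeta> x"
        unfolding F_def using \<zeta> \<phi>
        by (simp add: grad_mult grad_add smooth_add smooth_mult smooth_const grad_const scaleR_right_distrib scaleR_left_distrib[symmetric])
      have "- (grad F x \<bullet> \<nu>) \<le> norm (grad F x)"
        using Cauchy_Schwarz_ineq2[of "grad F x" \<nu>] norm_\<nu> by simp
      also have "\<dots> \<le> 2 * (\<zeta> x * \<bar>\<phi> x\<bar>) * norm (grad \<phi> x) + (\<phi> x * \<phi> x + 2 * \<delta>) * norm (grad \<zeta> x)"
        unfolding gF using \<zeta>(2)[of x] \<delta>
        by (intro order_trans[OF norm_triangle_ineq]) (simp add: abs_mult)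
      also have "\<dots> \<le> 2 * (1 * \<bar>\<phi> x\<bar>) * norm (grad \<phi> x) + (\<phi> x * \<phi> x + 2 * \<delta>) * B"
        using \<zeta>(2,3)[of x] \<delta> B by (intro add_mono mult_mono mult_left_mono) auto
      also have "2 * (1 * \<bar>\<phi> x\<bar>) * norm (grad \<phi> x) \<le> I x"
        using sum_squares_bound[of "\<bar>\<phi> x\<bar>" "norm (grad \<phi> x)"] by (simp add: I_def)
      also have "(\<phi> x * \<phi> x + 2 * \<delta>) * B \<le> B * I x + 2 * \<delta> * B"
        using B(1) by (simp add: I_def power2_eq_square algebra_simps)
      finally show ?thesis by (simp add: algebra_simps)
    qed
    have "- (\<integral>x. indicator \<Omega> x * (grad F x \<bullet> \<nu>) \<partial>lborel) = (\<integral>x. - (grad F x \<bullet> \<nu>) \<partial>M)"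
      using integral_M_eq_lborel[OF borel_measurable_continuous_onI[OF cont(2)]] by simp
    also have "\<dots> \<le> (\<integral>x. (B + 1) * I x + 2 * \<delta> * B \<partial>M)"
      by (intro integral_mono pointwise Bochner_Integration.integrable_add integrable_mult_right
          Bochner_Integration.integrable_minus int)
    also have "\<dots> = (B + 1) * (\<integral>x. I x \<partial>M) + 2 * \<delta> * B * V"
      by (subst Bochner_Integration.integral_add) (auto intro!: integrable_mult_right int simp: V_def)
    finally have "K * - (\<integral>x. indicator \<Omega> x * (grad F x \<bullet> \<nu>) \<partial>lborel) \<le> K * ((B + 1) * (\<integral>x. I x \<partial>M) + 2 * \<delta> * B * V)"
      using K by (intro mult_left_mono) auto
    also have "\<dots> \<le> K * ((B + 1) * (\<integral>x. I x \<partial>M) + 2 * \<delta> * B * (V + 1))"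
      using K \<delta> B by (intro mult_left_mono add_left_mono) auto
    also have "\<dots> = K * (B + 1) * (\<integral>x. I x \<partial>M) + e"
    proof -
      have "V + 1 \<noteq> 0" using V by simp
      then have "\<delta> * (2 * K * B * (V + 1)) = e" using K B by (simp add: \<delta>_def)
      then show ?thesis by (simp add: algebra_simps)
    qed
    finally have "K * - (\<integral>x. indicator \<Omega> x * (grad F x \<bullet> \<nu>) \<partial>lborel) \<le> ?R + e" by (simp add: I_def)
    then have "ennreal (K * - (\<integral>x. indicator \<Omega> x * (grad F x \<bullet> \<nu>) \<partial>lborel)) \<le> ennreal (?R + e)"
      by (rule ennreal_leI)
    also have "\<dots> = ennreal ?R + ennreal e"
      using e K B by (intro ennreal_plus) auto
    finally have "ennreal (K * - (\<integral>x. indicator \<Omega> x * (grad F x \<bullet> \<nu>) \<partial>lborel)) \<le> ennreal ?R + ennreal e" .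
    with patch_level_estimate[OF \<zeta>(1,2) supp \<open>\<rho> < r\<close> c \<phi> \<delta>]
    show "?lhs \<le> ennreal ?R + ennreal e" unfolding F_def K_def by (rule order_trans)
  qed
  then show ?thesis using K B by (intro exI[of _ "K * (B + 1)"]) auto
qed

end

section \<open>Traces\<close>

locale lipschitz_domain = bounded_open \<Omega> for \<Omega> :: "'a::euclidean_space set" +
  assumes dim: "2 \<le> DIM('a)" and lipschitz: "lipschitz_boundary \<Omega>"
begin

abbreviation S where "S \<equiv> surface_on (frontier \<Omega>)"

lemma smooth_integrable_energy:
  assumes "smooth \<phi>" shows "(\<integral>x. (\<phi> x)\<^sup>2 + (norm (grad \<phi> x))\<^sup>2 \<partial>M) = (H1_norm \<Omega> \<phi>)\<^sup>2"
proof -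
  have "(\<integral>x. (\<phi> x)\<^sup>2 + (norm (grad \<phi> x))\<^sup>2 \<partial>M) = (\<integral>x. \<phi> x \<bullet> \<phi> x + grad \<phi> x \<bullet> grad \<phi> x \<partial>M)"
    by (simp only: power2_norm_eq_inner) (simp add: power2_eq_square)
  also have "\<dots> = (L2_norm M \<phi>)\<^sup>2 + (L2_norm M (grad \<phi>))\<^sup>2"
    using L2_inner_integrable[OF smooth_L2[OF assms] smooth_L2[OF assms]]
      L2_inner_integrable[OF grad_L2[OF assms] grad_L2[OF assms]]
    unfolding L2_norm_square L2_inner_def by (intro Bochner_Integration.integral_add)
  also have "L2_norm M (grad \<phi>) = L2_norm M (weak_grad \<Omega> \<phi>)"
    using smooth_H1[OF assms] by (intro L2_norm_cong_AE grad_L2 weak_grad_H1 assms) (auto elim: eventually_mono)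
  finally show ?thesis by (simp add: H1_norm_def)
qed

lemma local_trace_estimate:
  assumes x0: "x0 \<in> frontier \<Omega>"
  shows "\<exists>U C. open U \<and> x0 \<in> U \<and> 0 \<le> C \<and> (\<forall>\<phi>. smooth \<phi> \<longrightarrow>
    (\<integral>\<^sup>+x. indicator (frontier \<Omega> \<inter> U) x * ennreal ((\<phi> x)\<^sup>2) \<partial>surface_measure) \<le> ennreal (C * (H1_norm \<Omega> \<phi>)\<^sup>2))"
proof -
  obtain r \<nu> \<gamma> L where r: "r > 0" and \<nu>: "norm \<nu> = 1" "L-lipschitz_on {z. z \<bullet> \<nu> = 0} \<gamma>"
    "\<Omega> \<inter> ball x0 r = {x \<in> ball x0 r. x \<bullet> \<nu> > \<gamma> (x - (x \<bullet> \<nu>) *\<^sub>R \<nu>)}"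
  proof -
    have "\<exists>r>0. \<exists>\<nu>. norm \<nu> = 1 \<and> (\<exists>\<gamma> L. L-lipschitz_on {z. z \<bullet> \<nu> = 0} \<gamma> \<and>
       \<Omega> \<inter> ball x0 r = {x \<in> ball x0 r. x \<bullet> \<nu> > \<gamma> (x - (x \<bullet> \<nu>) *\<^sub>R \<nu>)})"
      using lipschitz x0 unfolding lipschitz_boundary_def by (rule bspec)
    then show ?thesis using that by (elim exE conjE) blast
  qed
  interpret graph_patch \<nu> \<gamma> L \<Omega> x0 r
    by unfold_locales (use \<nu> dim in auto)
  obtain a b where ab: "cbox a b \<subseteq> ball x0 (r / 2)" "x0 \<in> box a b"
    using open_contains_cbox[OF open_ball, of x0 x0 "r / 2"] r by (metis centre_in_ball half_gt_zero)
  have supp: "{x. bump 1 a b x \<noteq> 0} \<subseteq> cball x0 (r / 2)"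
    using order_trans[OF box_subset_cbox order_trans[OF ab(1) ball_subset_cball]] by (simp add: bump_nonzero_iff)
  \<comment> \<open>A level strictly between 0 and the value at \<open>x0\<close>, so that
    \<open>x0\<close> lies in the open set where the bump exceeds c.\<close>
  define c where "c = bump 1 a b x0 / 2"
  have "bump 1 a b x0 \<noteq> 0" using ab(2) bump_nonzero_iff[of 1 a b x0] by simp
  then have c: "0 < c" "c < bump 1 a b x0" using bump_bounds(1)[of 1 a b x0] by (auto simp: c_def)
  obtain C where C: "0 \<le> C" "\<And>\<phi>. smooth \<phi> \<Longrightarrow>
    (\<integral>\<^sup>+x. indicator (frontier \<Omega> \<inter> {x. c \<le> bump 1 a b x}) x * ennreal ((\<phi> x)\<^sup>2) \<partial>surface_measure)
      \<le> ennreal (C * (\<integral>x. (\<phi> x)\<^sup>2 + (norm (grad \<phi> x))\<^sup>2 \<partial>M))"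
    using patch_estimate[OF smooth_bump bump_bounds supp _ c(1)] r by auto
  define U where "U = {x. c < bump 1 a b x}"
  have "open U" unfolding U_def
    by (intro open_Collect_less continuous_on_const smooth_continuous smooth_bump)
  moreover have "(\<integral>\<^sup>+x. indicator (frontier \<Omega> \<inter> U) x * ennreal ((\<phi> x)\<^sup>2) \<partial>surface_measure)
    \<le> ennreal (C * (H1_norm \<Omega> \<phi>)\<^sup>2)" if "smooth \<phi>" for \<phi>
    unfolding smooth_integrable_energy[OF that, symmetric]
    by (rule order_trans[OF nn_integral_mono C(2)[OF that]]) (auto simp: U_def indicator_def)
  ultimately show ?thesis using C(1) c(2) by (intro exI[of _ U] exI[of _ C]) (auto simp: U_def)
qed

text \<open>Finitely many patches cover the compact boundary and squared norms add up, so the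
  constant is the root of the sum of the local ones.\<close>

theorem smooth_trace_estimate:
  "\<exists>C\<ge>0. \<forall>\<phi>. smooth \<phi> \<longrightarrow> \<phi> \<in> L2 S \<and> L2_norm S \<phi> \<le> C * H1_norm \<Omega> \<phi>"
proof -
  define Q where "Q x0 U C \<longleftrightarrow> open U \<and> x0 \<in> U \<and> 0 \<le> C \<and> (\<forall>\<phi>. smooth \<phi> \<longrightarrow>
    (\<integral>\<^sup>+x. indicator (frontier \<Omega> \<inter> U) x * ennreal ((\<phi> x)\<^sup>2) \<partial>surface_measure) \<le> ennreal (C * (H1_norm \<Omega> \<phi>)\<^sup>2))"
    for x0 U C
  have "\<forall>x0\<in>frontier \<Omega>. \<exists>U. \<exists>C. Q x0 U C"
    using local_trace_estimate by (simp add: Q_def)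
  from bchoice[OF this] obtain U where "\<forall>x0\<in>frontier \<Omega>. \<exists>C. Q x0 (U x0) C" by blast
  from bchoice[OF this] obtain C where UC: "\<And>x0. x0 \<in> frontier \<Omega> \<Longrightarrow> Q x0 (U x0) (C x0)" by blast
  have U: "open (U x)" "x \<in> U x" if "x \<in> frontier \<Omega>" for x using UC[OF that] by (simp_all add: Q_def)
  have "compact (frontier \<Omega>)" using bounded_\<Omega> by (rule compact_frontier_bounded)
  moreover have "frontier \<Omega> \<subseteq> (\<Union>x\<in>frontier \<Omega>. U x)" using U(2) by blast
  ultimately obtain D where D: "D \<subseteq> frontier \<Omega>" "finite D" "frontier \<Omega> \<subseteq> (\<Union>x\<in>D. U x)"
    using compactE_image[of "frontier \<Omega>" "frontier \<Omega>" U] U(1) by metis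
  have fr: "frontier \<Omega> \<in> sets surface_measure" "frontier \<Omega> \<inter> space surface_measure \<in> sets surface_measure"
    by (auto simp: sets_surface_measure)
  define K where "K = sqrt (\<Sum>x\<in>D. C x)"
  have C: "0 \<le> C x" if "x \<in> D" for x using that D UC[of x] by (auto simp: Q_def)
  have K: "K\<^sup>2 = (\<Sum>x\<in>D. C x)" "0 \<le> K" using C by (simp_all add: K_def sum_nonneg)
  have "\<phi> \<in> L2 S \<and> L2_norm S \<phi> \<le> K * H1_norm \<Omega> \<phi>" if \<phi>: "smooth \<phi>" for \<phi>
  proof -
    have meas: "\<phi> \<in> borel_measurable surface_measure"
      using borel_measurable_continuous_onI[OF smooth_continuous[OF \<phi>]]
      by (simp add: measurable_cong_sets[OF sets_surface_measure(1) refl])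
    then have [measurable]: "(\<lambda>x. ennreal ((\<phi> x)\<^sup>2)) \<in> borel_measurable surface_measure" by measurable
    have U_sets: "frontier \<Omega> \<inter> U x \<in> sets surface_measure" if "x \<in> D" for x
      using that D U(1)[of x] by (auto simp: sets_surface_measure intro!: sets.Int)
    have "(\<integral>\<^sup>+x. ennreal ((norm (\<phi> x))\<^sup>2) \<partial>S) = (\<integral>\<^sup>+x. ennreal ((\<phi> x)\<^sup>2) * indicator (frontier \<Omega>) x \<partial>surface_measure)"
      using fr by (simp add: nn_integral_restrict_space)
    also have "\<dots> \<le> (\<integral>\<^sup>+x. (\<Sum>y\<in>D. indicator (frontier \<Omega> \<inter> U y) x * ennreal ((\<phi> x)\<^sup>2)) \<partial>surface_measure)"
    proof (rule nn_integral_mono)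
      fix x
      show "ennreal ((\<phi> x)\<^sup>2) * indicator (frontier \<Omega>) x \<le> (\<Sum>y\<in>D. indicator (frontier \<Omega> \<inter> U y) x * ennreal ((\<phi> x)\<^sup>2))"
      proof (cases "x \<in> frontier \<Omega>")
        case True
        then obtain y where y: "y \<in> D" "x \<in> U y" using D by blast
        have "indicator (frontier \<Omega> \<inter> U y) x * ennreal ((\<phi> x)\<^sup>2) \<le> (\<Sum>y\<in>D. indicator (frontier \<Omega> \<inter> U y) x * ennreal ((\<phi> x)\<^sup>2))"
          using y D by (intro member_le_sum) auto
        then show ?thesis using True y by simp
      qed simp
    qed
    also have "\<dots> = (\<Sum>y\<in>D. \<integral>\<^sup>+x. indicator (frontier \<Omega> \<inter> U y) x * ennreal ((\<phi> x)\<^sup>2) \<partial>surface_measure)"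
      using U_sets by (intro nn_integral_sum) simp
    also have "\<dots> \<le> (\<Sum>y\<in>D. ennreal (C y * (H1_norm \<Omega> \<phi>)\<^sup>2))"
    proof (rule sum_mono)
      fix y assume "y \<in> D"
      then show "(\<integral>\<^sup>+x. indicator (frontier \<Omega> \<inter> U y) x * ennreal ((\<phi> x)\<^sup>2) \<partial>surface_measure) \<le> ennreal (C y * (H1_norm \<Omega> \<phi>)\<^sup>2)"
        using UC[of y] D(1) \<phi> by (auto simp: Q_def)
    qed
    also have "\<dots> = ennreal (\<Sum>y\<in>D. C y * (H1_norm \<Omega> \<phi>)\<^sup>2)"
      using C by (intro sum_ennreal) auto
    also have "(\<Sum>y\<in>D. C y * (H1_norm \<Omega> \<phi>)\<^sup>2) = (K * H1_norm \<Omega> \<phi>)\<^sup>2"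
      by (simp add: K power_mult_distrib sum_distrib_right)
    finally show ?thesis
      using L2_I_nn_integral[of \<phi> S "K * H1_norm \<Omega> \<phi>"] K(2) meas
      by (simp add: H1_norm_nonneg measurable_restrict_space1)
  qed
  then show ?thesis using K(2) by blast
qed

text \<open>The trace estimate for the constant function 1 bounds the area of the boundary.
  Finiteness is what \<open>L2_complete\<close> asks for there.\<close>

lemma finite_S: "finite_measure S"
proof -
  have "(\<lambda>_. 1::real) \<in> L2 S" using smooth_trace_estimate smooth_const by blast
  then have "integrable S (\<lambda>_. 1::real)" by (simp add: L2_def)
  then show ?thesis
    by (intro finite_measureI) (auto simp: integrable_iff_bounded)
qed

definition trace_const :: real where
  "trace_const = (SOME C. 0 \<le> C \<and> (\<forall>\<phi>. smooth \<phi> \<longrightarrow> \<phi> \<in> L2 S \<and> L2_norm S \<phi> \<le> C * H1_norm \<Omega> \<phi>))"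

lemma trace_const: "0 \<le> trace_const" "smooth \<phi> \<Longrightarrow> \<phi> \<in> L2 S"
  "smooth \<phi> \<Longrightarrow> L2_norm S \<phi> \<le> trace_const * H1_norm \<Omega> \<phi>"
proof -
  have "0 \<le> trace_const \<and> (\<forall>\<phi>. smooth \<phi> \<longrightarrow> \<phi> \<in> L2 S \<and> L2_norm S \<phi> \<le> trace_const * H1_norm \<Omega> \<phi>)"
    unfolding trace_const_def by (rule someI_ex) (use smooth_trace_estimate in blast)
  then show "0 \<le> trace_const" "smooth \<phi> \<Longrightarrow> \<phi> \<in> L2 S"
    "smooth \<phi> \<Longrightarrow> L2_norm S \<phi> \<le> trace_const * H1_norm \<Omega> \<phi>" by blast+
qed

section \<open>The trace relation on \<open>H1\<close>\<close>

lemma has_trace_L2: "has_trace \<Omega> v g \<Longrightarrow> g \<in> L2 S"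
  by (simp add: has_trace_def)

lemma has_traceE:
  assumes "has_trace \<Omega> v g" "e > 0"
  obtains \<phi> where "smooth \<phi>" "H1_norm \<Omega> (\<lambda>x. \<phi> x - v x) < e" "L2_norm S (\<lambda>x. \<phi> x - g x) < e"
proof -
  obtain \<phi> :: "nat \<Rightarrow> 'a \<Rightarrow> real" where \<phi>: "\<And>n. smooth (\<phi> n)"
    "(\<lambda>n. H1_norm \<Omega> (\<lambda>x. \<phi> n x - v x)) \<longlonglongrightarrow> 0" "(\<lambda>n. L2_norm S (\<lambda>x. \<phi> n x - g x)) \<longlonglongrightarrow> 0"
    using assms(1) unfolding has_trace_def by blast
  have "\<forall>\<^sub>F n in sequentially. H1_norm \<Omega> (\<lambda>x. \<phi> n x - v x) < e \<and> L2_norm S (\<lambda>x. \<phi> n x - g x) < e"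
    by (intro eventually_conj order_tendstoD(2)[OF \<phi>(2)] order_tendstoD(2)[OF \<phi>(3)] assms(2))
  then obtain n where "H1_norm \<Omega> (\<lambda>x. \<phi> n x - v x) < e \<and> L2_norm S (\<lambda>x. \<phi> n x - g x) < e"
    by (auto simp: eventually_sequentially)
  then show ?thesis using that \<phi>(1) by blast
qed

lemma has_traceI:
  assumes "g \<in> L2 S"
    and "\<And>e. e > 0 \<Longrightarrow> \<exists>\<phi>. smooth \<phi> \<and> H1_norm \<Omega> (\<lambda>x. \<phi> x - v x) < e \<and> L2_norm S (\<lambda>x. \<phi> x - g x) < e"
  shows "has_trace \<Omega> v g"
proof -
  have "\<exists>\<phi>. smooth \<phi> \<and> H1_norm \<Omega> (\<lambda>x. \<phi> x - v x) < inverse (real (Suc n)) \<and> L2_norm S (\<lambda>x. \<phi> x - g x) < inverse (real (Suc n))" for n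
    by (intro assms(2)) simp
  then obtain \<phi> where \<phi>: "\<And>n. smooth (\<phi> n)" "\<And>n. H1_norm \<Omega> (\<lambda>x. \<phi> n x - v x) < inverse (real (Suc n))"
    "\<And>n. L2_norm S (\<lambda>x. \<phi> n x - g x) < inverse (real (Suc n))" by metis
  have "(\<lambda>n. H1_norm \<Omega> (\<lambda>x. \<phi> n x - v x)) \<longlonglongrightarrow> 0"
    by (rule tendsto_sandwich[OF _ _ tendsto_const LIMSEQ_inverse_real_of_nat])
       (intro always_eventually allI H1_norm_nonneg less_imp_le[OF \<phi>(2)])+
  moreover have "(\<lambda>n. L2_norm S (\<lambda>x. \<phi> n x - g x)) \<longlonglongrightarrow> 0"
    by (rule tendsto_sandwich[OF _ _ tendsto_const LIMSEQ_inverse_real_of_nat])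
       (intro always_eventually allI L2_norm_nonneg less_imp_le[OF \<phi>(3)])+
  ultimately show ?thesis using assms(1) \<phi>(1) trace_const(2) unfolding has_trace_def by blast
qed

lemma has_trace_bound:
  assumes "v \<in> H1 \<Omega>" "has_trace \<Omega> v g" shows "L2_norm S g \<le> trace_const * H1_norm \<Omega> v"
proof (rule field_le_epsilon)
  fix e :: real assume e: "e > 0"
  \<comment> \<open>An error d in \<open>H1\<close> costs d times \<open>trace_const\<close> on the
    boundary, and the approximation of g another d.\<close>
  define d where "d = e / (1 + trace_const)"
  have d: "d > 0" "(1 + trace_const) * d = e" using e trace_const(1) by (auto simp: d_def)
  obtain \<phi> where \<phi>: "smooth \<phi>" "H1_norm \<Omega> (\<lambda>x. \<phi> x - v x) < d" "L2_norm S (\<lambda>x. \<phi> x - g x) < d"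
    using has_traceE[OF assms(2) d(1)] .
  note \<phi>S = trace_const(2)[OF \<phi>(1)] and gS = has_trace_L2[OF assms(2)]
  have "L2_norm S (\<lambda>x. \<phi> x - (\<phi> x - g x)) \<le> L2_norm S \<phi> + L2_norm S (\<lambda>x. \<phi> x - g x)"
    by (intro L2_norm_diff L2_diff \<phi>S gS)
  also have "\<dots> \<le> trace_const * H1_norm \<Omega> \<phi> + d"
    using trace_const(3)[OF \<phi>(1)] \<phi>(3) by simp
  also have "H1_norm \<Omega> \<phi> \<le> H1_norm \<Omega> v + d"
    using H1_norm_add[OF assms(1) H1_diff(1)[OF smooth_H1(1)[OF \<phi>(1)] assms(1)]] \<phi>(2) by simp
  finally have "L2_norm S g \<le> trace_const * (H1_norm \<Omega> v + d) + d"
    using trace_const(1) by (simp add: mult_left_mono)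
  also have "\<dots> = trace_const * H1_norm \<Omega> v + e" using d(2) by (simp add: algebra_simps)
  finally show "L2_norm S g \<le> trace_const * H1_norm \<Omega> v + e" .
qed

lemma has_trace_add:
  assumes "u \<in> H1 \<Omega>" "v \<in> H1 \<Omega>" "has_trace \<Omega> u g" "has_trace \<Omega> v h"
  shows "has_trace \<Omega> (\<lambda>x. u x + v x) (\<lambda>x. g x + h x)"
proof (rule has_traceI)
  fix e :: real assume "e > 0"
  then have e: "e / 2 > 0" by simp
  obtain \<phi> where \<phi>: "smooth \<phi>" "H1_norm \<Omega> (\<lambda>x. \<phi> x - u x) < e / 2" "L2_norm S (\<lambda>x. \<phi> x - g x) < e / 2"
    using has_traceE[OF assms(3) e] .
  obtain \<psi> where \<psi>: "smooth \<psi>" "H1_norm \<Omega> (\<lambda>x. \<psi> x - v x) < e / 2" "L2_norm S (\<lambda>x. \<psi> x - h x) < e / 2"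
    using has_traceE[OF assms(4) e] .
  have "H1_norm \<Omega> (\<lambda>x. (\<phi> x - u x) + (\<psi> x - v x)) < e"
    using H1_norm_add[OF H1_diff(1)[OF smooth_H1(1)[OF \<phi>(1)] assms(1)] H1_diff(1)[OF smooth_H1(1)[OF \<psi>(1)] assms(2)]] \<phi>(2) \<psi>(2)
    by linarith
  moreover have "L2_norm S (\<lambda>x. (\<phi> x - g x) + (\<psi> x - h x)) < e"
    using L2_norm_add[OF L2_diff[OF trace_const(2)[OF \<phi>(1)] has_trace_L2[OF assms(3)]] L2_diff[OF trace_const(2)[OF \<psi>(1)] has_trace_L2[OF assms(4)]]] \<phi>(3) \<psi>(3)
    by linarith
  ultimately show "\<exists>\<phi>. smooth \<phi> \<and> H1_norm \<Omega> (\<lambda>x. \<phi> x - (u x + v x)) < e \<and> L2_norm S (\<lambda>x. \<phi> x - (g x + h x)) < e"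
    using smooth_add[OF \<phi>(1) \<psi>(1)] by (intro exI[of _ "\<lambda>x. \<phi> x + \<psi> x"]) (simp add: add_diff_add)
qed (intro L2_add has_trace_L2[OF assms(3)] has_trace_L2[OF assms(4)])

lemma has_trace_scale:
  assumes "u \<in> H1 \<Omega>" "has_trace \<Omega> u g"
  shows "has_trace \<Omega> (\<lambda>x. c * u x) (\<lambda>x. c * g x)"
proof (rule has_traceI)
  fix e :: real assume "e > 0"
  then have e: "e / (\<bar>c\<bar> + 1) > 0" by (simp add: add_nonneg_pos)
  obtain \<phi> where \<phi>: "smooth \<phi>" "H1_norm \<Omega> (\<lambda>x. \<phi> x - u x) < e / (\<bar>c\<bar> + 1)" "L2_norm S (\<lambda>x. \<phi> x - g x) < e / (\<bar>c\<bar> + 1)"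
    using has_traceE[OF assms(2) e] .
  have less: "\<bar>c\<bar> * t < e" if "t < e / (\<bar>c\<bar> + 1)" "0 \<le> t" for t
  proof -
    have "\<bar>c\<bar> * t \<le> (\<bar>c\<bar> + 1) * t" using that by (intro mult_right_mono) auto
    also have "\<dots> < e" using that by (simp add: field_simps add_nonneg_pos)
    finally show ?thesis .
  qed
  have "H1_norm \<Omega> (\<lambda>x. c * (\<phi> x - u x)) < e"
    using H1_norm_scale[OF H1_diff(1)[OF smooth_H1(1)[OF \<phi>(1)] assms(1)], of c] less[OF \<phi>(2) H1_norm_nonneg] by simp
  moreover have "L2_norm S (\<lambda>x. c * (\<phi> x - g x)) < e"
    using L2_norm_scaleR[of S c "\<lambda>x. \<phi> x - g x"] less[OF \<phi>(3) L2_norm_nonneg] by simp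
  ultimately show "\<exists>\<phi>. smooth \<phi> \<and> H1_norm \<Omega> (\<lambda>x. \<phi> x - c * u x) < e \<and> L2_norm S (\<lambda>x. \<phi> x - c * g x) < e"
    using smooth_scale[OF \<phi>(1), of c] by (intro exI[of _ "\<lambda>x. c * \<phi> x"]) (simp add: right_diff_distrib)
qed (intro L2_scale has_trace_L2[OF assms(2)])

lemma has_trace_smooth: "smooth \<phi> \<Longrightarrow> has_trace \<Omega> \<phi> \<phi>"
  by (rule has_traceI) (auto simp: trace_const(2) H1_norm_zero L2_norm_def)

text \<open>Closedness of the graph of the trace. \<open>has_trace_bound\<close>, applied to
  differences, makes the traces Cauchy in \<open>L2\<close> of the boundary; a smooth function close
  to the pair (v n, g n) is then close to the limit pair.\<close>

lemma has_trace_limit: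
  assumes v: "\<And>n. v n \<in> H1 \<Omega>" "l \<in> H1 \<Omega>" and g: "\<And>n. has_trace \<Omega> (v n) (g n)"
    and lim: "(\<lambda>n. H1_norm \<Omega> (\<lambda>x. v n x - l x)) \<longlonglongrightarrow> 0"
  shows "\<exists>h. has_trace \<Omega> l h \<and> (\<lambda>n. L2_norm S (\<lambda>x. g n x - h x)) \<longlonglongrightarrow> 0"
proof -
  note gS = has_trace_L2[OF g]
  have diff: "L2_norm S (\<lambda>x. g m x - g n x) \<le> trace_const * (H1_norm \<Omega> (\<lambda>x. v m x - l x) + H1_norm \<Omega> (\<lambda>x. v n x - l x))" for m n
  proof -
    have "has_trace \<Omega> (\<lambda>x. v m x + (-1) * v n x) (\<lambda>x. g m x + (-1) * g n x)"
      by (intro has_trace_add has_trace_scale H1_scale v g)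
    then have "L2_norm S (\<lambda>x. g m x - g n x) \<le> trace_const * H1_norm \<Omega> (\<lambda>x. v m x - v n x)"
      using has_trace_bound[OF H1_diff(1)[OF v(1) v(1)]] by simp
    also have "H1_norm \<Omega> (\<lambda>x. v m x - v n x) \<le> H1_norm \<Omega> (\<lambda>x. v m x - l x) + H1_norm \<Omega> (\<lambda>x. v n x - l x)"
      using H1_norm_diff[OF H1_diff(1)[OF v(1) v(2)] H1_diff(1)[OF v(1) v(2)], of m n] by simp
    finally show ?thesis using trace_const(1) by (simp add: mult_left_mono)
  qed
  have "\<exists>N. \<forall>m\<ge>N. \<forall>n\<ge>N. L2_norm S (\<lambda>x. g m x - g n x) < e" if "e > 0" for e
  proof -
    define d where "d = e / (2 * (trace_const + 1))"
    have "trace_const + 1 > 0" using trace_const(1) by simp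
    then have d: "d > 0" "2 * (trace_const + 1) * d = e" using that by (auto simp: d_def)
    have "\<forall>\<^sub>F n in sequentially. H1_norm \<Omega> (\<lambda>x. v n x - l x) < d"
      by (rule order_tendstoD(2)[OF lim d(1)])
    then obtain N where N: "\<And>n. n \<ge> N \<Longrightarrow> H1_norm \<Omega> (\<lambda>x. v n x - l x) < d"
      by (auto simp: eventually_sequentially)
    have "L2_norm S (\<lambda>x. g m x - g n x) < e" if "m \<ge> N" "n \<ge> N" for m n
    proof -
      have "trace_const * (H1_norm \<Omega> (\<lambda>x. v m x - l x) + H1_norm \<Omega> (\<lambda>x. v n x - l x)) \<le> trace_const * (d + d)"
        using N[OF that(1)] N[OF that(2)] trace_const(1) by (intro mult_left_mono) auto
      also have "\<dots> < e" using d by (simp add: algebra_simps)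
      finally show ?thesis using diff[of m n] by simp
    qed
    then show ?thesis by blast
  qed
  from L2_complete[OF finite_S gS this]
  obtain h where h: "h \<in> L2 S" "(\<lambda>n. L2_norm S (\<lambda>x. g n x - h x)) \<longlonglongrightarrow> 0" by blast
  have "has_trace \<Omega> l h"
  proof (rule has_traceI[OF h(1)])
    fix e :: real assume "e > 0"
    then have e: "e / 2 > 0" by simp
    have "\<forall>\<^sub>F n in sequentially. H1_norm \<Omega> (\<lambda>x. v n x - l x) < e / 2 \<and> L2_norm S (\<lambda>x. g n x - h x) < e / 2"
      by (intro eventually_conj order_tendstoD(2)[OF lim] order_tendstoD(2)[OF h(2)] e)
    then obtain n where n: "H1_norm \<Omega> (\<lambda>x. v n x - l x) < e / 2" "L2_norm S (\<lambda>x. g n x - h x) < e / 2"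
      by (auto simp: eventually_sequentially)
    obtain \<phi> where \<phi>: "smooth \<phi>" "H1_norm \<Omega> (\<lambda>x. \<phi> x - v n x) < e / 2" "L2_norm S (\<lambda>x. \<phi> x - g n x) < e / 2"
      using has_traceE[OF g e] .
    have "H1_norm \<Omega> (\<lambda>x. (\<phi> x - v n x) + (v n x - l x)) < e"
      using H1_norm_add[OF H1_diff(1)[OF smooth_H1(1)[OF \<phi>(1)] v(1)] H1_diff(1)[OF v], of n n] \<phi>(2) n(1) by linarith
    moreover have "L2_norm S (\<lambda>x. (\<phi> x - g n x) + (g n x - h x)) < e"
      using L2_norm_add[OF L2_diff[OF trace_const(2)[OF \<phi>(1)] gS] L2_diff[OF gS h(1)], of n n] \<phi>(3) n(2) by linarith
    ultimately show "\<exists>\<phi>. smooth \<phi> \<and> H1_norm \<Omega> (\<lambda>x. \<phi> x - l x) < e \<and> L2_norm S (\<lambda>x. \<phi> x - h x) < e"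
      using \<phi>(1) by auto
  qed
  with h(2) show ?thesis by blast
qed

lemma has_trace_on_add:
  assumes "u \<in> H1 \<Omega>" "v \<in> H1 \<Omega>" "has_trace_on \<Omega> \<Gamma> u g" "has_trace_on \<Omega> \<Gamma> v h"
  shows "has_trace_on \<Omega> \<Gamma> (\<lambda>x. u x + v x) (\<lambda>x. g x + h x)"
proof -
  obtain g' h' where *: "has_trace \<Omega> u g'" "AE x in surface_on \<Gamma>. g' x = g x"
    "has_trace \<Omega> v h'" "AE x in surface_on \<Gamma>. h' x = h x"
    using assms(3,4) unfolding has_trace_on_def by blast
  have "AE x in surface_on \<Gamma>. g' x + h' x = g x + h x"
    using *(2,4) by eventually_elim simp
  then show ?thesis using has_trace_add[OF assms(1,2) *(1,3)] unfolding has_trace_on_def by blast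
qed

lemma has_trace_on_scale:
  assumes "u \<in> H1 \<Omega>" "has_trace_on \<Omega> \<Gamma> u g"
  shows "has_trace_on \<Omega> \<Gamma> (\<lambda>x. c * u x) (\<lambda>x. c * g x)"
proof -
  obtain g' where *: "has_trace \<Omega> u g'" "AE x in surface_on \<Gamma>. g' x = g x"
    using assms(2) unfolding has_trace_on_def by blast
  have "AE x in surface_on \<Gamma>. c * g' x = c * g x"
    using *(2) by eventually_elim simp
  then show ?thesis using has_trace_scale[OF assms(1) *(1)] unfolding has_trace_on_def by blast
qed

lemma has_trace_on_diff:
  assumes "u \<in> H1 \<Omega>" "v \<in> H1 \<Omega>" "has_trace_on \<Omega> \<Gamma> u g" "has_trace_on \<Omega> \<Gamma> v h"
  shows "has_trace_on \<Omega> \<Gamma> (\<lambda>x. u x - v x) (\<lambda>x. g x - h x)"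
  using has_trace_on_add[OF assms(1) H1_scale(1)[OF assms(2), of "-1"] assms(3) has_trace_on_scale[OF assms(2,4), of "-1"]]
  by simp

section \<open>The space \<open>H1_D\<close> and its completeness\<close>

lemma H1_D_H1: "v \<in> H1_D \<Omega> \<Gamma>D \<Longrightarrow> v \<in> H1 \<Omega>"
  by (simp add: H1_D_def)

lemma H1_D_add: "u \<in> H1_D \<Omega> \<Gamma>D \<Longrightarrow> v \<in> H1_D \<Omega> \<Gamma>D \<Longrightarrow> (\<lambda>x. u x + v x) \<in> H1_D \<Omega> \<Gamma>D"
  using has_trace_on_add[of u v \<Gamma>D "\<lambda>_. 0" "\<lambda>_. 0"] H1_add(1) by (simp add: H1_D_def)

lemma H1_D_scale: "u \<in> H1_D \<Omega> \<Gamma>D \<Longrightarrow> (\<lambda>x. c * u x) \<in> H1_D \<Omega> \<Gamma>D"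
  using has_trace_on_scale[of u \<Gamma>D "\<lambda>_. 0" c] H1_scale(1) by (simp add: H1_D_def)

lemma H1_D_diff: "u \<in> H1_D \<Omega> \<Gamma>D \<Longrightarrow> v \<in> H1_D \<Omega> \<Gamma>D \<Longrightarrow> (\<lambda>x. u x - v x) \<in> H1_D \<Omega> \<Gamma>D"
  using H1_D_add[OF _ H1_D_scale[of v \<Gamma>D "-1"], of u] by simp

lemma H1_D_zero: "(\<lambda>x. 0) \<in> H1_D \<Omega> \<Gamma>D"
  using has_trace_smooth[OF smooth_const, of 0] H1_zero unfolding H1_D_def has_trace_on_def by auto

lemma test_function_H1_D:
  assumes "test_function \<Omega> \<phi>" "\<Gamma>D \<subseteq> frontier \<Omega>" shows "\<phi> \<in> H1_D \<Omega> \<Gamma>D"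
proof -
  have "\<phi> x = 0" if "x \<in> \<Gamma>D" for x
    using that assms(2) open_\<Omega> test_functionD(3)[OF assms(1)] by (auto simp: frontier_def interior_open)
  then have "AE x in surface_on \<Gamma>D. \<phi> x = 0"
    by (intro AE_I2) (simp add: space_restrict_space)
  then show ?thesis
    using has_trace_smooth test_functionD(1)[OF assms(1)] smooth_H1(1) unfolding H1_D_def has_trace_on_def by blast
qed

text \<open>A vanishing trace on \<Gamma>D survives \<open>H1\<close> limits, because the traces
  converge in \<open>L2\<close> of the boundary along with the functions.\<close>

theorem H1_D_complete:
  assumes \<Gamma>: "\<Gamma>D \<subseteq> frontier \<Omega>" "\<Gamma>D \<in> sets borel" and X: "\<And>n. X n \<in> H1_D \<Omega> \<Gamma>D"
    and Cauchy: "\<And>e. e > 0 \<Longrightarrow> \<exists>N. \<forall>m\<ge>N. \<forall>n\<ge>N. H1_norm \<Omega> (\<lambda>x. X m x - X n x) < e"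
  shows "\<exists>l\<in>H1_D \<Omega> \<Gamma>D. (\<lambda>n. H1_norm \<Omega> (\<lambda>x. X n x - l x)) \<longlonglongrightarrow> 0"
proof -
  have "\<exists>l\<in>H1 \<Omega>. (\<lambda>n. H1_norm \<Omega> (\<lambda>x. X n x - l x)) \<longlonglongrightarrow> 0"
    by (rule H1_complete[OF H1_D_H1[OF X] Cauchy])
  then obtain l where l: "l \<in> H1 \<Omega>" "(\<lambda>n. H1_norm \<Omega> (\<lambda>x. X n x - l x)) \<longlonglongrightarrow> 0" by blast
  have "\<exists>g. has_trace \<Omega> (X n) g \<and> (AE x in surface_on \<Gamma>D. g x = 0)" for n
    using X[of n] by (simp add: H1_D_def has_trace_on_def)
  then obtain g where g: "\<And>n. has_trace \<Omega> (X n) (g n)" "\<And>n. AE x in surface_on \<Gamma>D. g n x = 0" by metis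
  obtain h where h: "has_trace \<Omega> l h" "(\<lambda>n. L2_norm S (\<lambda>x. g n x - h x)) \<longlonglongrightarrow> 0"
    using has_trace_limit[OF H1_D_H1[OF X] l(1) g(1) l(2)] by blast
  have sets: "\<Gamma>D \<inter> space surface_measure \<in> sets surface_measure" "frontier \<Omega> \<inter> space surface_measure \<in> sets surface_measure"
    using \<Gamma>(2) by (auto simp: sets_surface_measure)
  have AE_D: "AE x in S. x \<in> \<Gamma>D \<longrightarrow> g n x = 0" for n
    using g(2)[of n] unfolding AE_restrict_space_iff[OF sets(1)] AE_restrict_space_iff[OF sets(2)]
    by eventually_elim simp
  \<comment> \<open>The limit trace cut off to \<Gamma>D. As \<open>g n\<close> vanishes there, |k|
    \<le> |g n - h| almost everywhere for every n, so k has norm 0.\<close>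
  define k where "k x = indicator \<Gamma>D x * h x" for x
  have ind: "indicator \<Gamma>D \<in> borel_measurable S"
    using \<Gamma>(2) by (intro measurable_restrict_space1 borel_measurable_indicator) (simp add: sets_surface_measure)
  have kS: "k \<in> L2 S"
  proof (rule L2_bounded_by(1)[OF _ has_trace_L2[OF h(1)]])
    show "k \<in> borel_measurable S"
      unfolding k_def[abs_def] using ind L2_measurable[OF has_trace_L2[OF h(1)]] by (rule borel_measurable_times)
    show "AE x in S. norm (k x) \<le> 1 * norm (h x)" by (auto simp: k_def indicator_def)
  qed
  have "L2_norm S k \<le> L2_norm S (\<lambda>x. g n x - h x)" for n
  proof -
    have "AE x in S. norm (k x) \<le> 1 * norm (g n x - h x)"
      using AE_D[of n] by eventually_elim (auto simp: k_def indicator_def)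
    then show ?thesis
      using L2_bounded_by(2)[OF L2_measurable[OF kS] L2_diff[OF has_trace_L2[OF g(1)] has_trace_L2[OF h(1)]]] by fastforce
  qed
  then have "L2_norm S k \<le> 0"
    using h(2) by (intro LIMSEQ_le_const) auto
  then have "L2_norm S k = 0" using L2_norm_nonneg[of S k] by simp
  then have "AE x in S. k x = 0" by (rule L2_norm_0_imp_AE[OF kS])
  then have "AE x in surface_on \<Gamma>D. h x = 0"
    unfolding AE_restrict_space_iff[OF sets(1)] AE_restrict_space_iff[OF sets(2)]
    by eventually_elim (use \<Gamma>(1) in \<open>auto simp: k_def\<close>)
  then have "l \<in> H1_D \<Omega> \<Gamma>D" using l(1) h(1) unfolding H1_D_def has_trace_on_def by blast
  with l(2) show ?thesis by blast
qed

section \<open>Dual norms and pairings on trace spaces\<close>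

lemma trace_norm_nonneg:
  assumes "\<psi> \<in> trace_space \<Omega> \<Gamma> V" shows "0 \<le> trace_norm \<Omega> \<Gamma> V \<psi>"
  unfolding trace_norm_def using assms
  by (intro cInf_greatest) (auto simp: trace_space_def H1_norm_nonneg)

lemma trace_norm_le:
  assumes "v \<in> V" "has_trace_on \<Omega> \<Gamma> v \<psi>" shows "trace_norm \<Omega> \<Gamma> V \<psi> \<le> H1_norm \<Omega> v"
  unfolding trace_norm_def using assms
  by (intro cInf_lower bdd_belowI[of _ 0]) (auto simp: H1_norm_nonneg)

text \<open>The constant K guarantees that the values are bounded above; the real supremum of an
  unbounded set would carry no information.\<close>

lemma dual_norm_upper:
  assumes K: "\<And>v. v \<in> V \<Longrightarrow> \<bar>F v\<bar> \<le> K * N v" "\<And>v. v \<in> V \<Longrightarrow> 0 \<le> N v" and v: "v \<in> V" "N v \<le> 1"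
  shows "\<bar>F v\<bar> \<le> dual_norm V N F"
  unfolding dual_norm_def
proof (rule cSup_upper)
  show "bdd_above {\<bar>F v\<bar> |v. v \<in> V \<and> N v \<le> 1}"
  proof (rule bdd_aboveI[of _ "\<bar>K\<bar>"], clarify)
    fix u assume u: "u \<in> V" "N u \<le> 1"
    have "K * N u \<le> \<bar>K\<bar> * 1" using u K(2)[OF u(1)] by (intro mult_mono) auto
    then show "\<bar>F u\<bar> \<le> \<bar>K\<bar>" using K(1)[OF u(1)] by simp
  qed
qed (use v in blast)

text \<open>By scaling v to \<open>H1\<close> norm 1. If v has norm 0 this is impossible, and F
  vanishes on its trace by continuity.\<close>

lemma dual_trace_bound:
  assumes V: "V \<subseteq> H1 \<Omega>" "\<And>c v. v \<in> V \<Longrightarrow> (\<lambda>x. c * v x) \<in> V"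
    and F: "F \<in> dual (trace_space \<Omega> \<Gamma> V) (trace_norm \<Omega> \<Gamma> V)"
    and v: "v \<in> V" "has_trace_on \<Omega> \<Gamma> v \<psi>"
  shows "\<bar>F \<psi>\<bar> \<le> dual_norm (trace_space \<Omega> \<Gamma> V) (trace_norm \<Omega> \<Gamma> V) F * H1_norm \<Omega> v"
proof -
  let ?T = "trace_space \<Omega> \<Gamma> V" and ?N = "trace_norm \<Omega> \<Gamma> V"
  obtain K where K: "\<And>\<psi>. \<psi> \<in> ?T \<Longrightarrow> \<bar>F \<psi>\<bar> \<le> K * ?N \<psi>" using F unfolding dual_def by blast
  have \<psi>: "\<psi> \<in> ?T" using v by (auto simp: trace_space_def)
  show ?thesis
  proof (cases "H1_norm \<Omega> v = 0")
    case True
    then have "?N \<psi> = 0" using trace_norm_le[OF v] trace_norm_nonneg[OF \<psi>] by simp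
    then show ?thesis using K[OF \<psi>] True by simp
  next
    case False
    define c where "c = inverse (H1_norm \<Omega> v)"
    have c: "c > 0" "c * H1_norm \<Omega> v = 1" using False H1_norm_nonneg[of v] by (auto simp: c_def)
    have vH: "v \<in> H1 \<Omega>" using v V by blast
    have t: "has_trace_on \<Omega> \<Gamma> (\<lambda>x. c * v x) (\<lambda>x. c * \<psi> x)" by (rule has_trace_on_scale[OF vH v(2)])
    have "?N (\<lambda>x. c * \<psi> x) \<le> H1_norm \<Omega> (\<lambda>x. c * v x)" by (rule trace_norm_le[OF V(2)[OF v(1)] t])
    also have "\<dots> = 1" using c by (simp add: H1_norm_scale[OF vH])
    finally have N1: "?N (\<lambda>x. c * \<psi> x) \<le> 1" .
    have T: "(\<lambda>x. c * \<psi> x) \<in> ?T" using t V(2)[OF v(1)] by (auto simp: trace_space_def)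
    have "\<bar>F (\<lambda>x. c * \<psi> x)\<bar> \<le> dual_norm ?T ?N F"
      by (rule dual_norm_upper[where F=F and V="?T" and N="?N" and K=K, OF K trace_norm_nonneg T N1])
    moreover have "F (\<lambda>x. c * \<psi> x) = c * F \<psi>" using F \<psi> unfolding dual_def by blast
    ultimately have "c * \<bar>F \<psi>\<bar> \<le> dual_norm ?T ?N F" using c by (simp add: abs_mult)
    then have "H1_norm \<Omega> v * (c * \<bar>F \<psi>\<bar>) \<le> H1_norm \<Omega> v * dual_norm ?T ?N F"
      by (intro mult_left_mono H1_norm_nonneg)
    moreover have "H1_norm \<Omega> v * (c * \<bar>F \<psi>\<bar>) = \<bar>F \<psi>\<bar>" using c(2) by (simp add: mult.assoc[symmetric] mult.commute)
    ultimately show ?thesis by (simp add: mult.commute)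
  qed
qed

text \<open>The difference of two traces of v is a trace of the zero function, on which F vanishes
  by \<open>dual_trace_bound\<close>; so the choice made in \<open>pairing_N\<close> does not
  matter.\<close>

lemma pairing_N_eq:
  assumes V: "V \<subseteq> H1 \<Omega>" "\<And>c v. v \<in> V \<Longrightarrow> (\<lambda>x. c * v x) \<in> V" "\<And>u v. u \<in> V \<Longrightarrow> v \<in> V \<Longrightarrow> (\<lambda>x. u x + v x) \<in> V"
    and F: "F \<in> dual (trace_space \<Omega> \<Gamma> V) (trace_norm \<Omega> \<Gamma> V)"
    and v: "v \<in> V" "has_trace_on \<Omega> \<Gamma> v \<psi>"
  shows "pairing_N \<Omega> \<Gamma> F v = F \<psi>"
proof -
  let ?T = "trace_space \<Omega> \<Gamma> V"
  define \<psi>' where "\<psi>' = (SOME \<psi>. has_trace_on \<Omega> \<Gamma> v \<psi>)"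
  have \<psi>': "has_trace_on \<Omega> \<Gamma> v \<psi>'" unfolding \<psi>'_def using someI[of "has_trace_on \<Omega> \<Gamma> v" \<psi>] v(2) by simp
  have vH: "v \<in> H1 \<Omega>" using v V by blast
  have t: "has_trace_on \<Omega> \<Gamma> (\<lambda>x. v x + (-1) * v x) (\<lambda>x. \<psi>' x + (-1) * \<psi> x)"
    by (intro has_trace_on_add has_trace_on_scale H1_scale vH v \<psi>')
  have "\<bar>F (\<lambda>x. \<psi>' x + (-1) * \<psi> x)\<bar> \<le> dual_norm ?T (trace_norm \<Omega> \<Gamma> V) F * H1_norm \<Omega> (\<lambda>x. v x + (-1) * v x)"
    by (rule dual_trace_bound[OF V(1) _ F V(3)[OF v(1) V(2)[OF v(1), of "-1"]] t]) (rule V(2))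
  also have "\<dots> = 0" by (simp add: H1_norm_zero)
  finally have "F (\<lambda>x. \<psi>' x + (-1) * \<psi> x) = 0" by simp
  moreover have T: "\<psi> \<in> ?T" "\<psi>' \<in> ?T" using v \<psi>' by (auto simp: trace_space_def)
  have mT: "(\<lambda>x. (-1) * \<psi> x) \<in> ?T"
    unfolding trace_space_def using has_trace_on_scale[OF vH v(2), of "-1"] V(2)[OF v(1), of "-1"] by blast
  have lin: "\<forall>u\<in>?T. \<forall>v\<in>?T. F (\<lambda>x. u x + v x) = F u + F v" "\<forall>c. \<forall>v\<in>?T. F (\<lambda>x. c * v x) = c * F v"
    using F unfolding dual_def by blast+
  have "F (\<lambda>x. \<psi>' x + (-1) * \<psi> x) = F \<psi>' + (-1) * F \<psi>"
    unfolding lin(1)[rule_format, OF T(2) mT] lin(2)[rule_format, OF T(1)] ..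
  ultimately show ?thesis by (simp add: pairing_N_def \<psi>'_def)
qed

end

section \<open>Elliptic matrices\<close>

lemma symmetric_matrix_inner:
  fixes N :: "real^'n^'n"
  assumes "transpose N = N" shows "(N *v x) \<bullet> y = x \<bullet> (N *v y)"
proof -
  have "N *v x = x v* N" using vector_transpose_matrix[of x N] unfolding assms by (rule sym)
  then show ?thesis by (simp only: dot_lmul_matrix)
qed

text \<open>Cauchy-Schwarz for the semidefinite form x . N y, applied to N x and x, gives |N x|^2
  \<le> (\<open>sqrt c\<close> |N x|) (\<open>sqrt c\<close> |x|).\<close>

lemma norm_psd_matrix_le:
  fixes N :: "real^'n^'n"
  assumes sym: "transpose N = N" and pos: "\<And>x. 0 \<le> x \<bullet> (N *v x)" and le: "\<And>x. x \<bullet> (N *v x) \<le> c * (x \<bullet> x)"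
  shows "norm (N *v x) \<le> c * norm x"
proof -
  interpret N: semi_inner_space UNIV "(+)" "(*\<^sub>R)" "\<lambda>x y. x \<bullet> (N *v y)"
  proof
    show "x \<bullet> (N *v y) = y \<bullet> (N *v x)" for x y
      using symmetric_matrix_inner[OF sym, of y x] by (simp only: inner_commute)
  qed (use pos in \<open>simp_all add: inner_add_left\<close>)
  have "0 \<le> c * (x \<bullet> x)" using order_trans[OF pos le] .
  then have c: "0 \<le> c \<or> x = 0" by (auto simp: zero_le_mult_iff dot_square_norm)
  have nrm: "N.nrm y \<le> sqrt c * norm y" for y
    unfolding N.nrm_def norm_eq_sqrt_inner real_sqrt_mult[symmetric] using le by (intro real_sqrt_le_mono)
  show ?thesis
  proof (cases "N *v x = 0 \<or> x = 0")
    case False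
    have "(norm (N *v x))\<^sup>2 = (N *v x) \<bullet> (N *v x)" by (simp add: power2_norm_eq_inner)
    also have "\<dots> \<le> N.nrm (N *v x) * N.nrm x" using N.Cauchy_Schwarz[of "N *v x" x] by simp
    also have "\<dots> \<le> (sqrt c * norm (N *v x)) * (sqrt c * norm x)"
      using False c by (intro mult_mono nrm N.nrm_nonneg) auto
    also have "\<dots> = norm (N *v x) * (c * norm x)" using False c by simp
    finally show ?thesis using False by (simp add: power2_eq_square)
  qed (use c in auto)
qed

text \<open>Banach's fixed point theorem for the map Y |-> (X + Y^2) / 2 on the symmetric operators
  of norm at most \<rho>. They are mapped into themselves as \<rho>^2 \<le> \<rho>, and Y^2 - Z^2 =
  Y (Y - Z) + (Y - Z) Z makes \<rho> a contraction factor.\<close>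

lemma blinfun_symmetric_square_root:
  fixes X :: "'a::euclidean_space \<Rightarrow>\<^sub>L 'a"
  assumes \<rho>: "norm X \<le> \<rho>" "\<rho> < 1" and sym: "\<And>x y. X x \<bullet> y = x \<bullet> X y"
  shows "\<exists>Y. norm Y \<le> \<rho> \<and> (\<forall>x y. blinfun_apply Y x \<bullet> y = x \<bullet> Y y) \<and> 2 *\<^sub>R Y = X + (Y o\<^sub>L Y)"
proof -
  define K where "K = {Y :: 'a \<Rightarrow>\<^sub>L 'a. norm Y \<le> \<rho> \<and> (\<forall>x y. blinfun_apply Y x \<bullet> y = x \<bullet> Y y)}"
  define T where "T Y = (1/2) *\<^sub>R (X + (Y o\<^sub>L Y))" for Y
  have \<rho>0: "0 \<le> \<rho>" using \<rho>(1) norm_ge_zero[of X] by linarith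
  have "\<exists>!Y\<in>K. T Y = Y"
  proof (rule Banach_fix[where c=\<rho>])
    have "closed K" unfolding K_def
      by (intro closed_Collect_conj closed_Collect_all closed_Collect_eq closed_Collect_le continuous_intros)
    then show "complete K" by (simp add: complete_eq_closed)
    have "X \<in> K" using assms by (simp add: K_def)
    then show "K \<noteq> {}" by blast
    show "T ` K \<subseteq> K"
    proof safe
      fix Y assume "Y \<in> K"
      then have Y: "norm Y \<le> \<rho>" "\<And>x y. blinfun_apply Y x \<bullet> y = x \<bullet> Y y" by (auto simp: K_def)
      have "norm (Y o\<^sub>L Y) \<le> \<rho> * \<rho>"
        using norm_blinfun_compose[of Y Y] Y(1) \<rho>0 by (meson mult_mono norm_ge_zero order_trans)
      also have "\<dots> \<le> \<rho>" using \<rho>0 \<rho>(2) by (simp add: mult_left_le)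
      finally have "norm (X + (Y o\<^sub>L Y)) \<le> 2 * \<rho>" using norm_triangle_ineq[of X "Y o\<^sub>L Y"] \<rho>(1) by linarith
      then have "norm (T Y) \<le> \<rho>" by (simp add: T_def)
      moreover have "T Y x \<bullet> y = x \<bullet> T Y y" for x y
        by (simp add: T_def blinfun.add_left blinfun.scaleR_left inner_add_left inner_add_right sym Y(2))
      ultimately show "T Y \<in> K" by (simp add: K_def)
    qed
    fix Y Z assume "Y \<in> K" "Z \<in> K"
    then have YZ: "norm Y \<le> \<rho>" "norm Z \<le> \<rho>" by (auto simp: K_def)
    have "T Y - T Z = (1/2) *\<^sub>R ((Y o\<^sub>L (Y - Z)) + ((Y - Z) o\<^sub>L Z))"
      by (rule blinfun_eqI)
         (simp add: T_def blinfun.diff_left blinfun.add_left blinfun.scaleR_left blinfun.diff_right algebra_simps)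
    then have "norm (T Y - T Z) = (1/2) * norm ((Y o\<^sub>L (Y - Z)) + ((Y - Z) o\<^sub>L Z))" by simp
    also have "norm ((Y o\<^sub>L (Y - Z)) + ((Y - Z) o\<^sub>L Z)) \<le> norm Y * norm (Y - Z) + norm (Y - Z) * norm Z"
      using norm_triangle_ineq[of "Y o\<^sub>L (Y - Z)" "(Y - Z) o\<^sub>L Z"] norm_blinfun_compose[of Y "Y - Z"] norm_blinfun_compose[of "Y - Z" Z]
      by linarith
    also have "\<dots> \<le> \<rho> * norm (Y - Z) + norm (Y - Z) * \<rho>"
      using YZ by (intro add_mono mult_right_mono mult_left_mono) auto
    finally show "dist (T Y) (T Z) \<le> \<rho> * dist Y Z" by (simp add: dist_norm)
  qed (use \<rho>0 \<rho> in auto)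
  then obtain Y where Y: "Y \<in> K" "T Y = Y" by blast
  have "2 *\<^sub>R Y = 2 *\<^sub>R T Y" using Y(2) by simp
  also have "\<dots> = X + (Y o\<^sub>L Y)" by (simp add: T_def)
  finally show ?thesis using Y(1) by (auto simp: K_def)
qed

lemma bounded_linear_matrix_vector: "bounded_linear ((*v) (N :: real^'n^'n))"
  by (simp add: linear_linear)

text \<open>
  With \<open>N = c (I - X)\<close> and \<open>\<parallel>X\<parallel> < 1\<close>, a root of \<open>I - X\<close> is sought as \<open>I - Y\<close>; this is the fixed
  point equation \<open>2 Y = X + Y\<^sup>2\<close>.
\<close>

lemma mat_sqrt_properties:
  fixes N :: "real^'n^'n"
  assumes sym: "transpose N = N" and c: "0 < c0"
    and ell: "\<And>x. c0 * (x \<bullet> x) \<le> x \<bullet> (N *v x)" "\<And>x. x \<bullet> (N *v x) \<le> c1 * (x \<bullet> x)"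
  shows "transpose (mat_sqrt N) = mat_sqrt N" "mat_sqrt N ** mat_sqrt N = N"
proof -
  have N1: "c0 \<le> c1"
  proof -
    obtain x :: "real^'n" where "norm x = 1" using vector_choose_size[of 1] by auto
    then show ?thesis using order_trans[OF ell(1)[of x] ell(2)[of x]] by (simp add: dot_square_norm)
  qed
  then have c1: "c1 > 0" using c by simp
  define P where "P = mat 1 - (1 / c1) *\<^sub>R N"
  have Pv: "P *v x = x - (1 / c1) *\<^sub>R (N *v x)" for x
    by (simp add: P_def matrix_vector_mult_diff_rdistrib scaleR_matrix_vector_assoc[symmetric])
  have tP: "transpose P = P" using sym by (simp add: P_def transpose_def vec_eq_iff mat_def)
  \<comment> \<open>The quadratic form of P = I - N / c1 lies between 0 and 1 - c0 / c1 times
    |x|^2.\<close>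
  define \<rho> where "\<rho> = 1 - c0 / c1"
  have \<rho>: "0 \<le> \<rho>" "\<rho> < 1" using c c1 N1 by (auto simp: \<rho>_def)
  have P_le: "norm (P *v x) \<le> \<rho> * norm x" for x
  proof (rule norm_psd_matrix_le[OF tP])
    fix x
    have "x \<bullet> (N *v x) / c1 \<le> x \<bullet> x" using ell(2)[of x] c1 by (simp add: field_simps)
    then show "0 \<le> x \<bullet> (P *v x)" by (simp add: Pv inner_diff_right)
    have "c0 / c1 * (x \<bullet> x) \<le> x \<bullet> (N *v x) / c1" using ell(1)[of x] c1 by (simp add: field_simps)
    then show "x \<bullet> (P *v x) \<le> \<rho> * (x \<bullet> x)" by (simp add: Pv \<rho>_def inner_diff_right algebra_simps)
  qed
  define X where "X = Blinfun ((*v) P)"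
  have X: "blinfun_apply X x = P *v x" for x
    by (simp add: X_def bounded_linear_Blinfun_apply bounded_linear_matrix_vector)
  have "norm X \<le> \<rho>" using P_le \<rho> by (intro norm_blinfun_bound) (auto simp: X)
  moreover have "X x \<bullet> y = x \<bullet> X y" for x y by (simp add: X symmetric_matrix_inner[OF tP])
  ultimately obtain Y where Y: "norm Y \<le> \<rho>" "\<And>x y. blinfun_apply Y x \<bullet> y = x \<bullet> Y y" "2 *\<^sub>R Y = X + (Y o\<^sub>L Y)"
    using blinfun_symmetric_square_root \<rho> by metis
  \<comment> \<open>The root sought: its square is c1 (I - 2 Y + Y^2) = c1 (I - X) = N.\<close>
  define B where "B x = sqrt c1 *\<^sub>R (x - Y x)" for x
  have linB: "linear B"
    unfolding B_def by (intro linear_compose_scale_right linear_compose_sub linear_ident bounded_linear.linear) 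
      (simp add: blinfun.bounded_linear_right)
  define R where "R = matrix B"
  have R: "R *v x = B x" for x using matrix_vector_mul(2)[OF linB] by (simp add: R_def fun_eq_iff)
  have R1: "transpose R = R"
  proof -
    have "(transpose R *v x) \<bullet> y = (R *v x) \<bullet> y" for x y
    proof -
      have "(transpose R *v x) \<bullet> y = x \<bullet> (R *v y)" by (simp add: dot_lmul_matrix)
      also have "\<dots> = (R *v x) \<bullet> y" by (simp add: R B_def inner_diff_left inner_diff_right Y(2))
      finally show ?thesis .
    qed
    then have "transpose R *v x = R *v x" for x by (metis vector_eq_rdot)
    then show ?thesis by (subst matrix_eq) blast
  qed
  have R2: "0 \<le> x \<bullet> (R *v x)" for x
  proof -
    have "x \<bullet> Y x \<le> norm x * norm (Y x)" using Cauchy_Schwarz_ineq2[of x "Y x"] by simp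
    also have "\<dots> \<le> norm x * (1 * norm x)"
      using norm_blinfun[of Y x] Y(1) \<rho> by (intro mult_left_mono) (meson mult_right_mono norm_ge_zero order_trans less_imp_le, simp)
    also have "\<dots> = x \<bullet> x" by (simp add: dot_square_norm power2_eq_square)
    finally show ?thesis using c1 by (simp add: R B_def inner_diff_right)
  qed
  have R3: "R ** R = N"
  proof -
    have "(R ** R) *v x = N *v x" for x
    proof -
      have "2 *\<^sub>R Y x = X x + Y (Y x)"
        using arg_cong[OF Y(3), of "\<lambda>Z. blinfun_apply Z x"] by (simp add: blinfun.add_left blinfun.scaleR_left)
      then have YY: "Y (Y x) = 2 *\<^sub>R Y x - X x" by simp
      have "(R ** R) *v x = B (B x)" by (simp add: matrix_vector_mul_assoc[symmetric] R)
      also have "\<dots> = c1 *\<^sub>R (x - 2 *\<^sub>R Y x + Y (Y x))"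
        using c1 by (simp add: B_def blinfun.scaleR_right blinfun.diff_right scaleR_diff_right[symmetric] scaleR_2)
      also have "\<dots> = c1 *\<^sub>R (x - X x)" by (simp add: YY)
      also have "\<dots> = N *v x" using c1 by (simp add: X Pv)
      finally show ?thesis .
    qed
    then show ?thesis by (subst matrix_eq) blast
  qed
  have "transpose (mat_sqrt N) = mat_sqrt N \<and> (\<forall>\<xi>. 0 \<le> \<xi> \<bullet> (mat_sqrt N *v \<xi>)) \<and> mat_sqrt N ** mat_sqrt N = N"
    unfolding mat_sqrt_def by (rule someI[of _ R]) (use R1 R2 R3 in blast)
  then show "transpose (mat_sqrt N) = mat_sqrt N" "mat_sqrt N ** mat_sqrt N = N" by blast+
qed

lemma matrix_inv_cancel:
  fixes N :: "real^'n^'n"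
  assumes "\<And>x. N *v x = 0 \<Longrightarrow> x = 0"
  shows "N *v (matrix_inv N *v x) = x" "matrix_inv N *v (N *v x) = x"
proof -
  have "invertible N" using assms matrix_left_invertible_ker[of N] by (auto simp: invertible_left_inverse)
  then have "N ** matrix_inv N = mat 1 \<and> matrix_inv N ** N = mat 1"
    unfolding matrix_inv_def invertible_def by (rule someI_ex)
  then show "N *v (matrix_inv N *v x) = x" "matrix_inv N *v (N *v x) = x"
    by (simp_all add: matrix_vector_mul_assoc)
qed

text \<open>For the square root R, the identity |R x|^2 = x . N x turns the ellipticity bounds into
  bounds for R and for its inverse.\<close>

lemma elliptic_matrix_bounds:
  fixes N :: "real^'n^'n"
  assumes sym: "transpose N = N" and c: "0 < c0"
    and ell: "\<And>x. c0 * (x \<bullet> x) \<le> x \<bullet> (N *v x)" "\<And>x. x \<bullet> (N *v x) \<le> c1 * (x \<bullet> x)"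
  shows "norm (N *v x) \<le> c1 * norm x" "N *v (matrix_inv N *v x) = x" "matrix_inv N *v (N *v x) = x"
    "norm (mat_sqrt N *v x) \<le> sqrt c1 * norm x" "norm (matrix_inv (mat_sqrt N) *v x) \<le> 1 / sqrt c0 * norm x"
proof -
  have pos: "0 \<le> x \<bullet> (N *v x)" for x
    using ell(1)[of x] c by (smt (verit) inner_ge_zero mult_nonneg_nonneg)
  show "norm (N *v x) \<le> c1 * norm x" by (rule norm_psd_matrix_le[OF sym pos ell(2)])
  have ker: "x = 0" if "N *v x = 0" for x
    using ell(1)[of x] that c by (simp add: mult_le_0_iff dot_square_norm)
  show "N *v (matrix_inv N *v x) = x" by (rule matrix_inv_cancel(1)) (rule ker)
  show "matrix_inv N *v (N *v x) = x" by (rule matrix_inv_cancel(2)) (rule ker)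
  note R = mat_sqrt_properties[OF sym c ell]
  have norm_R: "(norm (mat_sqrt N *v x))\<^sup>2 = x \<bullet> (N *v x)" for x
    using symmetric_matrix_inner[OF R(1), of x "mat_sqrt N *v x"]
    by (simp add: power2_norm_eq_inner matrix_vector_mul_assoc R(2))
  have "sqrt ((norm (mat_sqrt N *v x))\<^sup>2) \<le> sqrt (c1 * (x \<bullet> x))"
    unfolding norm_R by (intro real_sqrt_le_mono ell)
  then show "norm (mat_sqrt N *v x) \<le> sqrt c1 * norm x" by (simp add: real_sqrt_mult norm_eq_sqrt_inner)
  have kerR: "x = 0" if "mat_sqrt N *v x = 0" for x
    using norm_R[of x] that ell(1)[of x] c by (simp add: mult_le_0_iff dot_square_norm)
  define y where "y = matrix_inv (mat_sqrt N) *v x"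
  have "mat_sqrt N *v y = x" unfolding y_def by (rule matrix_inv_cancel(1)) (rule kerR)
  then have "c0 * (norm y)\<^sup>2 \<le> (norm x)\<^sup>2" using norm_R[of y] ell(1)[of y] by (simp add: dot_square_norm)
  then have "sqrt (c0 * (norm y)\<^sup>2) \<le> sqrt ((norm x)\<^sup>2)" by (rule real_sqrt_le_mono)
  then have "sqrt c0 * norm y \<le> norm x" by (simp add: real_sqrt_mult)
  then show "norm (matrix_inv (mat_sqrt N) *v x) \<le> 1 / sqrt c0 * norm x"
    using c by (simp add: y_def[symmetric] field_simps)
qed

lemma borel_measurable_matrix_vector:
  fixes A :: "'a \<Rightarrow> real^'n^'n"
  assumes "A \<in> borel_measurable M" "p \<in> borel_measurable M"
  shows "(\<lambda>x. A x *v p x) \<in> borel_measurable M"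
proof (rule borel_measurable_continuous_Pair[OF assms])
  show "continuous_on UNIV (\<lambda>z. fst z *v snd z :: real^'n)"
    unfolding matrix_vector_mult_def by (intro continuous_intros)
qed

section \<open>Solvability for functionals on \<open>H1_D\<close>\<close>

text \<open>Lebesgue measure is complete, so measurability passes to every function that agrees
  almost everywhere. In this way integrands with \<open>matrix_inv (A x)\<close> inherit
  measurability from the functions they are identified with.\<close>

lemma (in bounded_open) M_measurable_AE:
  fixes f g :: "'a \<Rightarrow> real"
  assumes f: "f \<in> borel_measurable M" and ae: "AE x in M. f x = g x"
  shows "g \<in> borel_measurable M"
proof -
  have "(\<lambda>x. indicator \<Omega> x *\<^sub>R f x) \<in> borel_measurable lebesgue"
    using f borel_measurable_restrict_space_iff[OF sets_\<Omega>(2), of f] by (simp add: ac_simps)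
  moreover have "AE x in lebesgue. indicator \<Omega> x *\<^sub>R f x = indicator \<Omega> x *\<^sub>R g x"
    using ae unfolding AE_restrict_space_iff[OF sets_\<Omega>(2)] by eventually_elim (auto simp: indicator_def)
  ultimately have "(\<lambda>x. indicator \<Omega> x *\<^sub>R g x) \<in> borel_measurable lebesgue" by (rule borel_measurable_AE)
  then show ?thesis using borel_measurable_restrict_space_iff[OF sets_\<Omega>(2), of g] by (simp add: ac_simps)
qed

lemma (in bounded_open) integral_M_cong_AE:
  fixes f g :: "'a \<Rightarrow> real"
  assumes "f \<in> borel_measurable M" "AE x in M. g x = f x"
  shows "(\<integral>x. g x \<partial>M) = (\<integral>x. f x \<partial>M)"
proof (rule integral_cong_AE)
  have "AE x in M. f x = g x" using assms(2) by eventually_elim simp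
  then show "g \<in> borel_measurable M" by (rule M_measurable_AE[OF assms(1)])
qed (use assms in auto)

locale elliptic_problem = lipschitz_domain \<Omega> for \<Omega> :: "(real^'d) set" +
  fixes \<Gamma>D :: "(real^'d) set" and A :: "real^'d \<Rightarrow> real^'d^'d" and b :: "real^'d \<Rightarrow> real^'d"
    and a :: "real^'d \<Rightarrow> real" and \<Lambda>0 \<Lambda>1 Ka Kb Ki :: real
  assumes \<Gamma>D: "\<Gamma>D \<subseteq> frontier \<Omega>" "\<Gamma>D \<in> sets borel"
    and A_measurable: "A \<in> borel_measurable M"
    and A_symmetric: "AE x in M. transpose (A x) = A x"
    and \<Lambda>0: "0 < \<Lambda>0"
    and A_elliptic: "AE x in M. \<forall>\<xi>. \<Lambda>0 * (\<xi> \<bullet> \<xi>) \<le> \<xi> \<bullet> (A x *v \<xi>) \<and> \<xi> \<bullet> (A x *v \<xi>) \<le> \<Lambda>1 * (\<xi> \<bullet> \<xi>)"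
    and b_measurable: "b \<in> borel_measurable M" and b_bounded: "AE x in M. norm (b x) \<le> Kb"
    and a_measurable: "a \<in> borel_measurable M" and a_bounded: "AE x in M. \<bar>a x\<bar> \<le> Ka"
    and a_nonzero: "AE x in M. a x \<noteq> 0"
    and a_inverse_bounded: "AE x in M. \<bar>inverse (a x)\<bar> \<le> Ki"
    and constants: "0 \<le> Ka" "0 \<le> Kb" "0 \<le> Ki" "0 \<le> \<Lambda>1"
    and primal_well_posed: "H2_well_posed \<Omega> (primal_solution \<Omega> \<Gamma>D A b a)"
    and dual_well_posed: "H2_well_posed \<Omega> (dual_solution \<Omega> \<Gamma>D A b a)"
begin

section \<open>Multiplication by the coefficients on \<open>L2\<close>\<close>

abbreviation V where "V \<equiv> H1_D \<Omega> \<Gamma>D"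
abbreviation wg where "wg \<equiv> weak_grad \<Omega>"

lemma V_H1: "v \<in> V \<Longrightarrow> v \<in> H1 \<Omega>" by (rule H1_D_H1)

lemma A_facts:
  "AE x in M. \<forall>\<xi>. norm (A x *v \<xi>) \<le> \<Lambda>1 * norm \<xi> \<and> A x *v (matrix_inv (A x) *v \<xi>) = \<xi> \<and>
    matrix_inv (A x) *v (A x *v \<xi>) = \<xi> \<and> norm (mat_sqrt (A x) *v \<xi>) \<le> sqrt \<Lambda>1 * norm \<xi> \<and>
    norm (matrix_inv (mat_sqrt (A x)) *v \<xi>) \<le> 1 / sqrt \<Lambda>0 * norm \<xi>"
  using A_symmetric A_elliptic
proof eventually_elim
  case (elim x)
  show ?case using elliptic_matrix_bounds[OF elim(1) \<Lambda>0, of \<Lambda>1] elim(2) by simp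
qed

lemma A_L2:
  assumes p: "p \<in> L2 M"
  shows "(\<lambda>x. A x *v p x) \<in> L2 M" "L2_norm M (\<lambda>x. A x *v p x) \<le> \<Lambda>1 * L2_norm M p"
proof -
  have meas: "(\<lambda>x. A x *v p x) \<in> borel_measurable M"
    by (intro borel_measurable_matrix_vector A_measurable L2_measurable p)
  have "AE x in M. norm (A x *v p x) \<le> \<Lambda>1 * norm (p x)" using A_facts by eventually_elim blast
  from L2_bounded_by[OF meas p this] show "(\<lambda>x. A x *v p x) \<in> L2 M" "L2_norm M (\<lambda>x. A x *v p x) \<le> \<Lambda>1 * L2_norm M p"
    using constants by auto
qed

lemma A_inner_commute:
  assumes "p \<in> L2 M" "q \<in> L2 M"
  shows "L2_inner M (\<lambda>x. A x *v p x) q = L2_inner M p (\<lambda>x. A x *v q x)"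
  unfolding L2_inner_def
proof (rule integral_cong_AE)
  show "AE x in M. (A x *v p x) \<bullet> q x = p x \<bullet> (A x *v q x)"
    using A_symmetric by eventually_elim (rule symmetric_matrix_inner)
qed (intro borel_measurable_inner L2_measurable A_L2 assms)+

lemma b_L2:
  assumes p: "p \<in> L2 M" shows "(\<lambda>x. b x \<bullet> p x) \<in> L2 M" "L2_norm M (\<lambda>x. b x \<bullet> p x) \<le> Kb * L2_norm M p"
proof -
  have meas: "(\<lambda>x. b x \<bullet> p x) \<in> borel_measurable M"
    by (intro borel_measurable_inner b_measurable L2_measurable p)
  have "AE x in M. norm (b x \<bullet> p x) \<le> Kb * norm (p x)"
    using b_bounded
  proof eventually_elim
    case (elim x)
    have "norm (b x \<bullet> p x) \<le> norm (b x) * norm (p x)" using Cauchy_Schwarz_ineq2 by simp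
    also have "\<dots> \<le> Kb * norm (p x)" using elim by (intro mult_right_mono) auto
    finally show ?case .
  qed
  from L2_bounded_by[OF meas p this] show "(\<lambda>x. b x \<bullet> p x) \<in> L2 M" "L2_norm M (\<lambda>x. b x \<bullet> p x) \<le> Kb * L2_norm M p"
    using constants by auto
qed

lemma b_scale_L2:
  assumes v: "v \<in> L2 M" shows "(\<lambda>x. v x *\<^sub>R b x) \<in> L2 M" "L2_norm M (\<lambda>x. v x *\<^sub>R b x) \<le> Kb * L2_norm M v"
proof -
  have meas: "(\<lambda>x. v x *\<^sub>R b x) \<in> borel_measurable M"
    by (intro borel_measurable_scaleR b_measurable L2_measurable v)
  have "AE x in M. norm (v x *\<^sub>R b x) \<le> Kb * norm (v x)"
    using b_bounded by eventually_elim (auto simp: mult.commute[of Kb] intro!: mult_left_mono)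
  from L2_bounded_by[OF meas v this] show "(\<lambda>x. v x *\<^sub>R b x) \<in> L2 M" "L2_norm M (\<lambda>x. v x *\<^sub>R b x) \<le> Kb * L2_norm M v"
    using constants by auto
qed

lemma a_L2:
  assumes v: "v \<in> L2 M" shows "(\<lambda>x. a x * v x) \<in> L2 M" "L2_norm M (\<lambda>x. a x * v x) \<le> Ka * L2_norm M v"
proof -
  have meas: "(\<lambda>x. a x * v x) \<in> borel_measurable M"
    by (intro borel_measurable_times a_measurable L2_measurable v)
  have "AE x in M. norm (a x * v x) \<le> Ka * norm (v x)"
    using a_bounded by eventually_elim (auto simp: abs_mult intro!: mult_right_mono)
  from L2_bounded_by[OF meas v this] show "(\<lambda>x. a x * v x) \<in> L2 M" "L2_norm M (\<lambda>x. a x * v x) \<le> Ka * L2_norm M v"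
    using constants by auto
qed

lemma a_inverse_L2:
  assumes v: "v \<in> L2 M" shows "(\<lambda>x. inverse (a x) * v x) \<in> L2 M"
proof -
  have meas: "(\<lambda>x. inverse (a x) * v x) \<in> borel_measurable M"
    by (intro borel_measurable_times borel_measurable_inverse a_measurable L2_measurable v)
  have "AE x in M. norm (inverse (a x) * v x) \<le> Ki * norm (v x)"
    using a_inverse_bounded by eventually_elim (auto simp: abs_mult intro!: mult_right_mono)
  from L2_bounded_by[OF meas v this] show ?thesis by auto
qed

section \<open>The bilinear form of the elliptic problems\<close>

definition flux :: "(real^'d \<Rightarrow> real) \<Rightarrow> real^'d \<Rightarrow> real^'d" where
  "flux v x = A x *v wg v x + v x *\<^sub>R b x"

lemma flux_L2:
  assumes "v \<in> H1 \<Omega>"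
  shows "flux v \<in> L2 M" "L2_norm M (flux v) \<le> (\<Lambda>1 + Kb) * H1_norm \<Omega> v"
proof -
  note A = A_L2[OF weak_grad_H1(1)[OF assms]] and b = b_scale_L2[OF H1_L2[OF assms]]
  show "flux v \<in> L2 M" unfolding flux_def[abs_def] by (intro L2_add A b)
  have "L2_norm M (flux v) \<le> L2_norm M (\<lambda>x. A x *v wg v x) + L2_norm M (\<lambda>x. v x *\<^sub>R b x)"
    unfolding flux_def[abs_def] by (intro L2_norm_add A b)
  also have "\<dots> \<le> \<Lambda>1 * L2_norm M (wg v) + Kb * L2_norm M v" using A(2) b(2) by linarith
  also have "\<dots> \<le> \<Lambda>1 * H1_norm \<Omega> v + Kb * H1_norm \<Omega> v"
    using constants by (intro add_mono mult_left_mono L2_norm_le_H1_norm)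
  finally show "L2_norm M (flux v) \<le> (\<Lambda>1 + Kb) * H1_norm \<Omega> v" by (simp add: algebra_simps)
qed

text \<open>The left-hand side of both problems: the primal one has its unknown in the first
  argument, the dual one in the second. \<open>aform_primal\<close> rewrites it with b on the side
  of the first argument.\<close>

definition aform :: "(real^'d \<Rightarrow> real) \<Rightarrow> (real^'d \<Rightarrow> real) \<Rightarrow> real" where
  "aform u v = L2_inner M (wg u) (flux v) + L2_inner M u (\<lambda>x. a x * v x)"

lemma aform_primal:
  assumes u: "u \<in> H1 \<Omega>" and v: "v \<in> H1 \<Omega>"
  shows "aform u v = L2_inner M (\<lambda>x. A x *v wg u x) (wg v) + L2_inner M (\<lambda>x. b x \<bullet> wg u x + a x * u x) v"
proof -
  note L2s = weak_grad_H1(1)[OF u] weak_grad_H1(1)[OF v] H1_L2[OF u] H1_L2[OF v]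
  have "L2_inner M (wg u) (flux v) = L2_inner M (wg u) (\<lambda>x. A x *v wg v x) + L2_inner M (wg u) (\<lambda>x. v x *\<^sub>R b x)"
    unfolding flux_def[abs_def] by (intro L2_inner_add_right A_L2 b_scale_L2 L2s)
  also have "L2_inner M (wg u) (\<lambda>x. A x *v wg v x) = L2_inner M (\<lambda>x. A x *v wg u x) (wg v)"
    by (intro A_inner_commute[symmetric] L2s)
  also have "L2_inner M (wg u) (\<lambda>x. v x *\<^sub>R b x) = L2_inner M (\<lambda>x. b x \<bullet> wg u x) v"
    by (simp add: L2_inner_def inner_commute mult.commute)
  moreover have "L2_inner M u (\<lambda>x. a x * v x) = L2_inner M (\<lambda>x. a x * u x) v"
    by (simp add: L2_inner_def mult_ac)
  moreover have "L2_inner M (\<lambda>x. b x \<bullet> wg u x + a x * u x) v = L2_inner M (\<lambda>x. b x \<bullet> wg u x) v + L2_inner M (\<lambda>x. a x * u x) v"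
    by (intro L2_inner_add_left b_L2 a_L2 L2s)
  ultimately show ?thesis by (simp add: aform_def)
qed

lemma aform_add_left:
  assumes "u \<in> H1 \<Omega>" "u' \<in> H1 \<Omega>" "v \<in> H1 \<Omega>"
  shows "aform (\<lambda>x. u x + u' x) v = aform u v + aform u' v"
  unfolding aform_def
  by (simp add: weak_grad_add_inner L2_inner_add_left assms flux_L2 H1_L2 a_L2)

lemma aform_scale_left:
  assumes "u \<in> H1 \<Omega>" "v \<in> H1 \<Omega>" shows "aform (\<lambda>x. c * u x) v = c * aform u v"
  unfolding aform_def using L2_inner_scaleR_left[of M c u]
  by (simp add: weak_grad_scale_inner assms flux_L2 algebra_simps)

lemma aform_add_right:
  assumes "u \<in> H1 \<Omega>" "v \<in> H1 \<Omega>" "v' \<in> H1 \<Omega>"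
  shows "aform u (\<lambda>x. v x + v' x) = aform u v + aform u v'"
proof -
  note p = A_L2(1)[OF weak_grad_H1(1)[OF assms(1)]]
  note q = L2_add[OF b_L2(1)[OF weak_grad_H1(1)[OF assms(1)]] a_L2(1)[OF H1_L2[OF assms(1)]]]
  show ?thesis
    unfolding aform_primal[OF assms(1) H1_add(1)[OF assms(2,3)]] aform_primal[OF assms(1,2)] aform_primal[OF assms(1,3)]
    using weak_grad_add_inner[OF assms(2,3) p] L2_inner_add_right[OF H1_L2[OF assms(2)] H1_L2[OF assms(3)] q]
    by (simp add: L2_inner_commute[of M "\<lambda>x. A x *v wg u x"])
qed

lemma aform_scale_right:
  assumes "u \<in> H1 \<Omega>" "v \<in> H1 \<Omega>" shows "aform u (\<lambda>x. c * v x) = c * aform u v"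
proof -
  note p = A_L2(1)[OF weak_grad_H1(1)[OF assms(1)]]
  show ?thesis
    unfolding aform_primal[OF assms(1) H1_scale(1)[OF assms(2)]] aform_primal[OF assms]
    using weak_grad_scale_inner[OF assms(2) p] L2_inner_scaleR_right[of M _ c v]
    by (simp add: L2_inner_commute[of M "\<lambda>x. A x *v wg u x"] algebra_simps)
qed

definition acon :: real where "acon = \<Lambda>1 + Kb + Ka"

lemma acon_nonneg: "0 \<le> acon" using constants by (simp add: acon_def)

lemma aform_bound:
  assumes "u \<in> H1 \<Omega>" "v \<in> H1 \<Omega>" shows "\<bar>aform u v\<bar> \<le> acon * H1_norm \<Omega> u * H1_norm \<Omega> v"
proof -
  have "\<bar>aform u v\<bar> \<le> \<bar>L2_inner M (wg u) (flux v)\<bar> + \<bar>L2_inner M u (\<lambda>x. a x * v x)\<bar>"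
    unfolding aform_def by (rule abs_triangle_ineq)
  also have "\<dots> \<le> L2_norm M (wg u) * L2_norm M (flux v) + L2_norm M u * L2_norm M (\<lambda>x. a x * v x)"
    by (intro add_mono L2_Cauchy_Schwarz weak_grad_H1 flux_L2 H1_L2 a_L2 assms)
  also have "L2_norm M (wg u) * L2_norm M (flux v) \<le> H1_norm \<Omega> u * ((\<Lambda>1 + Kb) * H1_norm \<Omega> v)"
    by (rule mult_mono[OF L2_norm_le_H1_norm(2) flux_L2(2)[OF assms(2)] H1_norm_nonneg L2_norm_nonneg])
  also have "L2_norm M u * L2_norm M (\<lambda>x. a x * v x) \<le> H1_norm \<Omega> u * (Ka * H1_norm \<Omega> v)"
  proof (rule mult_mono[OF L2_norm_le_H1_norm(1) _ H1_norm_nonneg L2_norm_nonneg])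
    show "L2_norm M (\<lambda>x. a x * v x) \<le> Ka * H1_norm \<Omega> v"
      using a_L2(2)[OF H1_L2[OF assms(2)]] mult_left_mono[OF L2_norm_le_H1_norm(1)[of v] constants(1)] by linarith
  qed
  finally show ?thesis by (simp add: acon_def algebra_simps)
qed

text \<open>The principal part of \<open>aform\<close> with a mass term added, which makes it
  coercive on all of \<open>H1\<close> with constant \<open>min \<Lambda>0 1\<close> and without
  recourse to a Poincare inequality.\<close>

definition pform :: "(real^'d \<Rightarrow> real) \<Rightarrow> (real^'d \<Rightarrow> real) \<Rightarrow> real" where
  "pform u v = L2_inner M (wg u) (\<lambda>x. A x *v wg v x) + L2_inner M u v"

lemma pform_lower: 
  assumes "u \<in> H1 \<Omega>" shows "min \<Lambda>0 1 * (H1_norm \<Omega> u)\<^sup>2 \<le> pform u u"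
proof -
  note g = weak_grad_H1(1)[OF assms]
  have "\<Lambda>0 * L2_inner M (wg u) (wg u) \<le> L2_inner M (wg u) (\<lambda>x. A x *v wg u x)"
    unfolding L2_inner_def integral_mult_right_zero[symmetric]
  proof (rule integral_mono_AE)
    show "AE x in M. \<Lambda>0 * (wg u x \<bullet> wg u x) \<le> wg u x \<bullet> (A x *v wg u x)"
      using A_elliptic by eventually_elim blast
  qed (intro integrable_mult_right L2_inner_integrable A_L2 g)+
  moreover have "min \<Lambda>0 1 * L2_inner M (wg u) (wg u) \<le> \<Lambda>0 * L2_inner M (wg u) (wg u)"
    by (intro mult_right_mono) (auto simp: L2_inner_def)
  moreover have "min \<Lambda>0 1 * L2_inner M u u \<le> 1 * L2_inner M u u"
    by (intro mult_right_mono) (auto simp: L2_inner_def)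
  ultimately show ?thesis
    by (simp add: pform_def H1_norm_def L2_norm_square[symmetric] algebra_simps)
qed

definition pcon :: real where "pcon = \<Lambda>1 + 1"

lemma pform_bound:
  assumes "u \<in> H1 \<Omega>" "v \<in> H1 \<Omega>" shows "\<bar>pform u v\<bar> \<le> pcon * H1_norm \<Omega> u * H1_norm \<Omega> v"
proof -
  note g = weak_grad_H1(1)[OF assms(1)] weak_grad_H1(1)[OF assms(2)]
  have "\<bar>pform u v\<bar> \<le> \<bar>L2_inner M (wg u) (\<lambda>x. A x *v wg v x)\<bar> + \<bar>L2_inner M u v\<bar>"
    unfolding pform_def by (rule abs_triangle_ineq)
  also have "\<dots> \<le> L2_norm M (wg u) * L2_norm M (\<lambda>x. A x *v wg v x) + L2_norm M u * L2_norm M v"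
    by (intro add_mono L2_Cauchy_Schwarz g A_L2 H1_L2 assms)
  also have "L2_norm M u * L2_norm M v \<le> H1_norm \<Omega> u * H1_norm \<Omega> v"
    by (rule mult_mono[OF L2_norm_le_H1_norm(1) L2_norm_le_H1_norm(1) H1_norm_nonneg L2_norm_nonneg])
  also have "L2_norm M (wg u) * L2_norm M (\<lambda>x. A x *v wg v x) \<le> H1_norm \<Omega> u * (\<Lambda>1 * H1_norm \<Omega> v)"
  proof (rule mult_mono[OF L2_norm_le_H1_norm(2) _ H1_norm_nonneg L2_norm_nonneg])
    show "L2_norm M (\<lambda>x. A x *v wg v x) \<le> \<Lambda>1 * H1_norm \<Omega> v"
      using A_L2(2)[OF g(2)] mult_left_mono[OF L2_norm_le_H1_norm(2)[of v] constants(4)] by linarith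
  qed
  finally show ?thesis by (simp add: pcon_def algebra_simps)
qed

section \<open>Functionals on \<open>H1_D\<close> and their Riesz representatives\<close>

sublocale P: semi_inner_space V "\<lambda>u v x. u x + v x" "\<lambda>c u x. c * u x" pform
proof
  show "V \<noteq> {}" using H1_D_zero by blast
  fix u v w c assume u: "u \<in> V" and w: "w \<in> V"
  note H = V_H1[OF u] V_H1[OF w]
  show "pform u w = pform w u"
    using A_inner_commute[OF weak_grad_H1(1) weak_grad_H1(1), OF H] L2_inner_commute[of M u w]
      L2_inner_commute[of M "wg w" "\<lambda>x. A x *v wg u x"] by (simp add: pform_def)
  show "pform (\<lambda>x. c * u x) w = c * pform u w"
    unfolding pform_def using L2_inner_scaleR_left[of M c u]
    by (simp add: weak_grad_scale_inner H A_L2 weak_grad_H1 algebra_simps)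
  show "0 \<le> pform u u"
  proof -
    have "0 \<le> min \<Lambda>0 1 * (H1_norm \<Omega> u)\<^sup>2" using \<Lambda>0 by simp
    then show ?thesis using pform_lower[OF H(1)] by linarith
  qed
  assume v: "v \<in> V"
  show "pform (\<lambda>x. u x + v x) w = pform u w + pform v w"
    unfolding pform_def by (simp add: weak_grad_add_inner H V_H1[OF v] A_L2 weak_grad_H1 L2_inner_add_left H1_L2)
qed (use H1_D_add H1_D_scale in auto)

lemma P_norm_lower: "u \<in> V \<Longrightarrow> sqrt (min \<Lambda>0 1) * H1_norm \<Omega> u \<le> P.nrm u"
  unfolding P.nrm_def using real_sqrt_le_mono[OF pform_lower[OF V_H1]] by (simp add: real_sqrt_mult H1_norm_nonneg)

lemma P_norm_upper: 
  assumes "u \<in> V" shows "P.nrm u \<le> sqrt pcon * H1_norm \<Omega> u"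
proof -
  have "pform u u \<le> pcon * (H1_norm \<Omega> u)\<^sup>2"
    using pform_bound[OF V_H1 V_H1, OF assms assms] by (simp add: power2_eq_square)
  then have "sqrt (pform u u) \<le> sqrt (pcon * (H1_norm \<Omega> u)\<^sup>2)" by (rule real_sqrt_le_mono)
  then show ?thesis
    unfolding P.nrm_def by (simp add: real_sqrt_mult H1_norm_nonneg)
qed

lemma P_complete: "P.complete_space"
  unfolding P.complete_space_def
proof (intro allI impI)
  fix X :: "nat \<Rightarrow> real^'d \<Rightarrow> real"
  assume X: "\<forall>n. X n \<in> V" and C: "\<forall>e>0. \<exists>N. \<forall>m\<ge>N. \<forall>n\<ge>N. P.nrm (P.sub (X m) (X n)) < e"
  define m where "m = sqrt (min \<Lambda>0 1)"
  have m: "m > 0" using \<Lambda>0 by (simp add: m_def)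
  have sub: "P.sub u v = (\<lambda>x. u x - v x)" for u v by (simp add: P.sub_def)
  have "\<exists>N. \<forall>k\<ge>N. \<forall>n\<ge>N. H1_norm \<Omega> (\<lambda>x. X k x - X n x) < e" if "e > 0" for e
  proof -
    have "m * e > 0" using m that by simp
    then obtain N where N: "\<forall>k\<ge>N. \<forall>n\<ge>N. P.nrm (P.sub (X k) (X n)) < m * e" using C by blast
    have "H1_norm \<Omega> (\<lambda>x. X k x - X n x) < e" if "k \<ge> N" "n \<ge> N" for k n
    proof -
      have "m * H1_norm \<Omega> (\<lambda>x. X k x - X n x) < m * e"
        using N that P_norm_lower[OF H1_D_diff, of "X k" "X n"] X unfolding sub m_def[symmetric] 
        by (meson le_less_trans)
      then show ?thesis using m by simp
    qed
    then show ?thesis by blast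
  qed
  from H1_D_complete[OF \<Gamma>D _ this] X
  obtain l where l: "l \<in> V" "(\<lambda>n. H1_norm \<Omega> (\<lambda>x. X n x - l x)) \<longlonglongrightarrow> 0" by blast
  have "(\<lambda>n. P.nrm (P.sub (X n) l)) \<longlonglongrightarrow> 0"
  proof (rule tendsto_sandwich[OF _ _ tendsto_const])
    show "(\<lambda>n. sqrt pcon * H1_norm \<Omega> (\<lambda>x. X n x - l x)) \<longlonglongrightarrow> 0"
      using tendsto_mult_left[OF l(2), of "sqrt pcon"] by simp
    show "\<forall>\<^sub>F n in sequentially. P.nrm (P.sub (X n) l) \<le> sqrt pcon * H1_norm \<Omega> (\<lambda>x. X n x - l x)"
      unfolding sub using X l by (intro always_eventually allI P_norm_upper H1_D_diff) auto
    show "\<forall>\<^sub>F n in sequentially. 0 \<le> P.nrm (P.sub (X n) l)"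
      using X l by (intro always_eventually allI P.nrm_nonneg P.sub_closed) auto
  qed
  with l(1) show "\<exists>l\<in>V. (\<lambda>n. P.nrm (P.sub (X n) l)) \<longlonglongrightarrow> 0" by blast
qed

text \<open>K is any bound for the norm of F, carried along so that solution estimates come with
  constants independent of F.\<close>

definition functional :: "real \<Rightarrow> ((real^'d \<Rightarrow> real) \<Rightarrow> real) \<Rightarrow> bool" where
  "functional K F \<longleftrightarrow> 0 \<le> K \<and> (\<forall>u\<in>V. \<forall>v\<in>V. F (\<lambda>x. u x + v x) = F u + F v) \<and>
    (\<forall>c. \<forall>u\<in>V. F (\<lambda>x. c * u x) = c * F u) \<and> (\<forall>u\<in>V. \<bar>F u\<bar> \<le> K * H1_norm \<Omega> u)"

lemma functional_add: "functional K F \<Longrightarrow> u \<in> V \<Longrightarrow> v \<in> V \<Longrightarrow> F (\<lambda>x. u x + v x) = F u + F v"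
  by (simp add: functional_def)
lemma functional_scale: "functional K F \<Longrightarrow> u \<in> V \<Longrightarrow> F (\<lambda>x. c * u x) = c * F u"
  by (simp add: functional_def)
lemma functional_bound: "functional K F \<Longrightarrow> u \<in> V \<Longrightarrow> \<bar>F u\<bar> \<le> K * H1_norm \<Omega> u"
  by (simp add: functional_def)
lemma functional_diff: "functional K F \<Longrightarrow> u \<in> V \<Longrightarrow> v \<in> V \<Longrightarrow> F (\<lambda>x. u x - v x) = F u - F v"
  using functional_add[of K F u "\<lambda>x. (-1) * v x"] functional_scale[of K F v "-1"] H1_D_scale[of v \<Gamma>D "-1"] by simp

text \<open>Lets functionals act on solutions that are determined only up to functions of
  \<open>H1\<close> norm 0.\<close>

lemma functional_cong:
  assumes "functional K F" "u \<in> V" "v \<in> V" "H1_norm \<Omega> (\<lambda>x. u x - v x) = 0" shows "F u = F v"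
  using functional_diff[OF assms(1-3)] functional_bound[OF assms(1) H1_D_diff[OF assms(2,3)]] assms(4) by simp

lemma functional_aform_right: "u \<in> H1 \<Omega> \<Longrightarrow> functional (acon * H1_norm \<Omega> u) (aform u)"
  unfolding functional_def using aform_bound
  by (auto simp: aform_add_right aform_scale_right V_H1 acon_nonneg H1_norm_nonneg)

lemma functional_pform: "u \<in> V \<Longrightarrow> functional (pcon * H1_norm \<Omega> u) (pform u)"
  unfolding functional_def using pform_bound[OF V_H1 V_H1, of u] constants P.ip_add_right P.ip_scale_right
  by (simp add: H1_norm_nonneg pcon_def)

text \<open>Two factors 1 / \<open>sqrt (min \<Lambda>0 1)\<close>: one from bounding F in the norm
  of \<open>pform\<close>, one from measuring the representative in \<open>H1\<close> again.\<close>

definition rcon :: real where "rcon = 1 / min \<Lambda>0 1"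

lemma rcon: "0 \<le> rcon" using \<Lambda>0 by (simp add: rcon_def)

lemma Riesz:
  assumes F: "functional K F"
  shows "\<exists>u\<in>V. (\<forall>v\<in>V. pform u v = F v) \<and> H1_norm \<Omega> u \<le> rcon * K"
proof -
  define m where "m = sqrt (min \<Lambda>0 1)"
  have m: "m > 0" "m\<^sup>2 = min \<Lambda>0 1" using \<Lambda>0 by (simp_all add: m_def)
  have K: "0 \<le> K" using F by (simp add: functional_def)
  have bound: "\<bar>F u\<bar> \<le> (K / m) * P.nrm u" if "u \<in> V" for u
  proof -
    have "H1_norm \<Omega> u \<le> P.nrm u / m"
      using P_norm_lower[OF that] m by (simp add: m_def[symmetric] field_simps)
    then have "K * H1_norm \<Omega> u \<le> K * (P.nrm u / m)" using K by (rule mult_left_mono)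
    then show ?thesis using functional_bound[OF F that] by simp
  qed
  from P.Riesz_representation[OF P_complete functional_add[OF F] functional_scale[OF F] bound]
  obtain u where u: "u \<in> V" "\<forall>v\<in>V. pform u v = F v" "P.nrm u \<le> \<bar>K / m\<bar>" by blast
  have "m * H1_norm \<Omega> u \<le> K / m"
    using P_norm_lower[OF u(1)] u(3) K m by (simp add: m_def[symmetric])
  then have "H1_norm \<Omega> u \<le> K / m\<^sup>2" using m(1) by (simp add: power2_eq_square field_simps)
  then show ?thesis using u(1,2) by (auto simp: rcon_def m(2))
qed

section \<open>Primal and dual problems with functionals as data\<close>

lemma primal_solution_iff:
  "primal_solution \<Omega> \<Gamma>D A b a f u \<longleftrightarrow> u \<in> V \<and> (\<forall>v\<in>V. aform u v = L2_inner M f v)"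
  unfolding primal_solution_def using aform_primal[OF V_H1 V_H1] by auto

lemma dual_solution_iff:
  "dual_solution \<Omega> \<Gamma>D A b a f z \<longleftrightarrow> z \<in> V \<and> (\<forall>\<phi>\<in>V. aform \<phi> z = L2_inner M f \<phi>)"
  unfolding dual_solution_def aform_def flux_def[abs_def] by auto

lemma H1_norm_zero_AE:
  assumes "u \<in> H1 \<Omega>" "AE x in M. u x = 0" shows "H1_norm \<Omega> u = 0"
  using H1_norm_cong_AE(3)[OF assms(1) L2_zero assms(2)] H1_norm_zero by simp

lemma primal_unique:
  assumes "u \<in> V" "\<forall>v\<in>V. aform u v = 0" shows "H1_norm \<Omega> u = 0"
proof -
  obtain u0 where u0: "\<And>u'. primal_solution \<Omega> \<Gamma>D A b a (\<lambda>_. 0) u' \<Longrightarrow> AE x in M. u' x = u0 x"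
    using primal_well_posed L2_zero unfolding H2_well_posed_def by metis
  have "aform (\<lambda>x. 0) v = 0" if "v \<in> V" for v
    using aform_scale_left[OF H1_zero V_H1[OF that], of 0] by simp
  then have "primal_solution \<Omega> \<Gamma>D A b a (\<lambda>_. 0) (\<lambda>_. 0)" "primal_solution \<Omega> \<Gamma>D A b a (\<lambda>_. 0) u"
    using assms H1_D_zero by (auto simp: primal_solution_iff L2_inner_def)
  then have "AE x in M. 0 = u0 x" "AE x in M. u x = u0 x" using u0 by blast+
  then have "AE x in M. u x = 0" by eventually_elim simp
  then show ?thesis by (rule H1_norm_zero_AE[OF V_H1[OF assms(1)]])
qed

lemma dual_unique:
  assumes "z \<in> V" "\<forall>\<phi>\<in>V. aform \<phi> z = 0" shows "AE x in M. z x = 0"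
proof -
  obtain u0 where u0: "\<And>u'. dual_solution \<Omega> \<Gamma>D A b a (\<lambda>_. 0) u' \<Longrightarrow> AE x in M. u' x = u0 x"
    using dual_well_posed L2_zero unfolding H2_well_posed_def by metis
  have "aform v (\<lambda>x. 0) = 0" if "v \<in> V" for v
    using aform_scale_right[OF V_H1[OF that] H1_zero, of 0] by simp
  then have "dual_solution \<Omega> \<Gamma>D A b a (\<lambda>_. 0) (\<lambda>_. 0)" "dual_solution \<Omega> \<Gamma>D A b a (\<lambda>_. 0) z"
    using assms H1_D_zero by (auto simp: dual_solution_iff L2_inner_def)
  then have "AE x in M. 0 = u0 x" "AE x in M. z x = u0 x" using u0 by blast+
  then show ?thesis by eventually_elim simp
qed

text \<open>
  The symmetric form \<open>pform\<close> differs from \<open>aform\<close> by terms that are \<open>L2\<close> functionals of the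
  test function, and those are handled by the assumed solvability.
\<close>

theorem primal_solvable:
  "\<exists>C\<ge>0. \<forall>K F. functional K F \<longrightarrow> (\<exists>u\<in>V. (\<forall>v\<in>V. aform u v = F v) \<and> H1_norm \<Omega> u \<le> C * K)"
proof -
  obtain C0 where C0: "\<And>f. f \<in> L2 M \<Longrightarrow> \<exists>u. primal_solution \<Omega> \<Gamma>D A b a f u \<and> H2_norm \<Omega> u \<le> C0 * L2_norm M f"
    using primal_well_posed unfolding H2_well_posed_def by metis
  \<comment> \<open>One summand for each of the three terms of h below.\<close>
  define g where "g = Kb + Ka + 1"
  have g: "0 \<le> g" using constants by (simp add: g_def)
  have "\<exists>u\<in>V. (\<forall>v\<in>V. aform u v = F v) \<and> H1_norm \<Omega> u \<le> (1 + \<bar>C0\<bar> * g) * rcon * K" if F: "functional K F" for K F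
  proof -
    obtain u1 where u1: "u1 \<in> V" "\<And>v. v \<in> V \<Longrightarrow> pform u1 v = F v" "H1_norm \<Omega> u1 \<le> rcon * K"
      using Riesz[OF F] by blast
    note H = V_H1[OF u1(1)]
    note L = b_L2[OF weak_grad_H1(1)[OF H]] a_L2[OF H1_L2[OF H]] H1_L2[OF H]
    \<comment> \<open>h represents \<open>aform u1 v - pform u1 v\<close> as an \<open>L2\<close>
      functional of v, so subtracting the primal solution with right-hand side h leaves F.\<close>
    define h where "h x = (b x \<bullet> wg u1 x + a x * u1 x) - u1 x" for x
    have h: "h \<in> L2 M" unfolding h_def[abs_def] by (intro L2_diff L2_add L)
    have "L2_norm M h \<le> L2_norm M (\<lambda>x. b x \<bullet> wg u1 x + a x * u1 x) + L2_norm M u1"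
      unfolding h_def[abs_def] by (intro L2_norm_diff L2_add L)
    also have "\<dots> \<le> L2_norm M (\<lambda>x. b x \<bullet> wg u1 x) + L2_norm M (\<lambda>x. a x * u1 x) + L2_norm M u1"
      by (intro add_right_mono L2_norm_add L)
    also have "\<dots> \<le> Kb * H1_norm \<Omega> u1 + Ka * H1_norm \<Omega> u1 + 1 * H1_norm \<Omega> u1"
      using L(2,4) mult_left_mono[OF L2_norm_le_H1_norm(2)[of u1] constants(2)]
        mult_left_mono[OF L2_norm_le_H1_norm(1)[of u1] constants(1)] L2_norm_le_H1_norm(1)[of u1]
      by (intro add_mono) auto
    finally have hn: "L2_norm M h \<le> g * H1_norm \<Omega> u1" by (simp add: g_def algebra_simps)
    obtain u2 where "primal_solution \<Omega> \<Gamma>D A b a h u2" and n2: "H2_norm \<Omega> u2 \<le> C0 * L2_norm M h"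
      using C0[OF h] by blast
    then have u2: "u2 \<in> V" "\<And>v. v \<in> V \<Longrightarrow> aform u2 v = L2_inner M h v" by (auto simp: primal_solution_iff)
    have "H1_norm \<Omega> u2 \<le> H2_norm \<Omega> u2"
      unfolding H2_norm_def by (rule real_le_rsqrt) (simp add: sum_nonneg)
    also have "\<dots> \<le> \<bar>C0\<bar> * (g * H1_norm \<Omega> u1)"
      using n2 hn L2_norm_nonneg[of M h] by (meson abs_ge_self abs_ge_zero mult_mono order_trans)
    finally have n2': "H1_norm \<Omega> u2 \<le> \<bar>C0\<bar> * g * H1_norm \<Omega> u1" by (simp add: mult.assoc)
    define u where "u x = u1 x - u2 x" for x
    have uV: "u \<in> V" unfolding u_def[abs_def] by (intro H1_D_diff u1 u2)
    have "aform u v = F v" if v: "v \<in> V" for v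
    proof -
      have "aform u v = aform u1 v - aform u2 v"
        unfolding u_def[abs_def]
        using aform_add_left[OF H H1_scale(1)[OF V_H1[OF u2(1)], of "-1"] V_H1[OF v]] aform_scale_left[OF V_H1[OF u2(1)] V_H1[OF v], of "-1"]
        by simp
      moreover have "L2_inner M h v = L2_inner M (\<lambda>x. b x \<bullet> wg u1 x + a x * u1 x) v - L2_inner M u1 v"
        unfolding h_def[abs_def] by (intro L2_inner_diff_left L2_add L H1_L2 V_H1 v)
      moreover have "L2_inner M (\<lambda>x. A x *v wg u1 x) (wg v) = L2_inner M (wg u1) (\<lambda>x. A x *v wg v x)"
        by (intro A_inner_commute weak_grad_H1 H V_H1 v)
      ultimately show ?thesis
        using u1(2)[OF v] u2(2)[OF v] by (simp add: aform_primal[OF H V_H1[OF v]] pform_def)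
    qed
    moreover have "H1_norm \<Omega> u \<le> (1 + \<bar>C0\<bar> * g) * rcon * K"
    proof -
      have "H1_norm \<Omega> u \<le> H1_norm \<Omega> u1 + H1_norm \<Omega> u2"
        unfolding u_def[abs_def] by (intro H1_norm_diff H V_H1 u2)
      also have "\<dots> \<le> (1 + \<bar>C0\<bar> * g) * H1_norm \<Omega> u1" using n2' by (simp add: algebra_simps)
      also have "\<dots> \<le> (1 + \<bar>C0\<bar> * g) * (rcon * K)" using g by (intro mult_left_mono u1) auto
      finally show ?thesis by (simp add: mult.assoc)
    qed
    ultimately show ?thesis using uV by blast
  qed
  then show ?thesis using g rcon by (intro exI[of _ "(1 + \<bar>C0\<bar> * g) * rcon"]) auto
qed

text \<open>By transposition: \<open>T\<close> inverts the operator of the primal problem, and \<open>z\<close> represents \<open>F \<circ> T\<close>.\<close>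

theorem dual_solvable:
  "\<exists>C\<ge>0. \<forall>K F. functional K F \<longrightarrow> (\<exists>z\<in>V. (\<forall>\<phi>\<in>V. aform \<phi> z = F \<phi>) \<and> H1_norm \<Omega> z \<le> C * K)"
proof -
  obtain C where C: "C \<ge> 0" "\<And>K F. functional K F \<Longrightarrow> \<exists>u\<in>V. (\<forall>v\<in>V. aform u v = F v) \<and> H1_norm \<Omega> u \<le> C * K"
    using primal_solvable by blast
  have "\<forall>\<psi>\<in>V. \<exists>u. u \<in> V \<and> (\<forall>v\<in>V. aform u v = pform \<psi> v) \<and> H1_norm \<Omega> u \<le> C * (pcon * H1_norm \<Omega> \<psi>)"
    using C(2)[OF functional_pform] by blast
  from bchoice[OF this] obtain T where T: "\<And>\<psi>. \<psi> \<in> V \<Longrightarrow> T \<psi> \<in> V" "\<And>\<psi> v. \<psi> \<in> V \<Longrightarrow> v \<in> V \<Longrightarrow> aform (T \<psi>) v = pform \<psi> v"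
    "\<And>\<psi>. \<psi> \<in> V \<Longrightarrow> H1_norm \<Omega> (T \<psi>) \<le> C * (pcon * H1_norm \<Omega> \<psi>)" by blast
  \<comment> \<open>T arises from a separate choice for each \<psi>. Uniqueness for the primal
    problem makes it linear up to functions of \<open>H1\<close> norm 0, which F does not
    see.\<close>
  have unique: "H1_norm \<Omega> (\<lambda>x. u x - w x) = 0" if "u \<in> V" "w \<in> V" "\<And>v. v \<in> V \<Longrightarrow> aform u v = aform w v" for u w
  proof (rule primal_unique)
    show "\<forall>v\<in>V. aform (\<lambda>x. u x - w x) v = 0"
    proof
      fix v assume v: "v \<in> V"
      show "aform (\<lambda>x. u x - w x) v = 0"
        using aform_add_left[OF V_H1[OF that(1)] H1_scale(1)[OF V_H1[OF that(2)], of "-1"] V_H1[OF v]] 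
          aform_scale_left[OF V_H1[OF that(2)] V_H1[OF v], of "-1"] that(3)[OF v] by simp
    qed
  qed (intro H1_D_diff that)
  have pcon: "0 \<le> pcon" using constants by (simp add: pcon_def)
  have "\<exists>z\<in>V. (\<forall>\<phi>\<in>V. aform \<phi> z = F \<phi>) \<and> H1_norm \<Omega> z \<le> (rcon * C * pcon) * K" if F: "functional K F" for K F
  proof -
    have K: "0 \<le> K" using F by (simp add: functional_def)
    have "functional (K * C * pcon) (\<lambda>\<psi>. F (T \<psi>))"
      unfolding functional_def
    proof (intro conjI ballI allI)
      show "0 \<le> K * C * pcon" using K C(1) pcon by simp
      fix \<psi> assume \<psi>: "\<psi> \<in> V"
      show "F (T (\<lambda>x. c * \<psi> x)) = c * F (T \<psi>)" for c
      proof -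
        have "F (T (\<lambda>x. c * \<psi> x)) = F (\<lambda>x. c * T \<psi> x)"
        proof (rule functional_cong[OF F _ _ unique])
          fix v assume v: "v \<in> V"
          show "aform (T (\<lambda>x. c * \<psi> x)) v = aform (\<lambda>x. c * T \<psi> x) v"
            using T(2)[OF H1_D_scale[OF \<psi>] v] T(2)[OF \<psi> v] aform_scale_left[OF V_H1[OF T(1)[OF \<psi>]] V_H1[OF v]] P.ip_scale[OF \<psi> v] by simp
        qed (intro T H1_D_scale \<psi>)+
        then show ?thesis using functional_scale[OF F T(1)[OF \<psi>]] by simp
      qed
      show "\<bar>F (T \<psi>)\<bar> \<le> K * C * pcon * H1_norm \<Omega> \<psi>"
        using functional_bound[OF F T(1)[OF \<psi>]] mult_left_mono[OF T(3)[OF \<psi>] K] by (simp add: mult_ac)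
      fix \<theta> assume \<theta>: "\<theta> \<in> V"
      have "F (T (\<lambda>x. \<psi> x + \<theta> x)) = F (\<lambda>x. T \<psi> x + T \<theta> x)"
      proof (rule functional_cong[OF F _ _ unique])
        fix v assume v: "v \<in> V"
        show "aform (T (\<lambda>x. \<psi> x + \<theta> x)) v = aform (\<lambda>x. T \<psi> x + T \<theta> x) v"
          using T(2)[OF H1_D_add[OF \<psi> \<theta>] v] T(2)[OF \<psi> v] T(2)[OF \<theta> v] P.ip_add[OF \<psi> \<theta> v]
            aform_add_left[OF V_H1[OF T(1)[OF \<psi>]] V_H1[OF T(1)[OF \<theta>]] V_H1[OF v]] by simp
      qed (intro T H1_D_add \<psi> \<theta>)+
      then show "F (T (\<lambda>x. \<psi> x + \<theta> x)) = F (T \<psi>) + F (T \<theta>)"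
        using functional_add[OF F T(1)[OF \<psi>] T(1)[OF \<theta>]] by simp
    qed
    from Riesz[OF this] obtain z where z: "z \<in> V" "\<And>\<psi>. \<psi> \<in> V \<Longrightarrow> pform z \<psi> = F (T \<psi>)" "H1_norm \<Omega> z \<le> rcon * (K * C * pcon)" by blast
    have "aform \<phi> z = F \<phi>" if \<phi>: "\<phi> \<in> V" for \<phi>
    proof -
      \<comment> \<open>Every \<phi> is T \<psi> up to a null function, where \<psi> represents
        \<open>aform \<phi>\<close>. Hence \<open>aform \<phi> z\<close> =
        \<open>pform \<psi> z\<close> = F (T \<psi>) = F \<phi>.\<close>
      from Riesz[OF functional_aform_right[OF V_H1[OF \<phi>]]]
      obtain \<psi> where \<psi>: "\<psi> \<in> V" "\<And>v. v \<in> V \<Longrightarrow> pform \<psi> v = aform \<phi> v" by blast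
      have "F (T \<psi>) = F \<phi>"
        by (rule functional_cong[OF F T(1)[OF \<psi>(1)] \<phi> unique[OF T(1)[OF \<psi>(1)] \<phi>]]) (simp add: T(2)[OF \<psi>(1)] \<psi>(2))
      then show ?thesis using z(2)[OF \<psi>(1)] \<psi>(2)[OF z(1)] P.ip_sym[OF z(1) \<psi>(1)] by simp
    qed
    then show ?thesis using z by (auto simp: mult_ac)
  qed
  then show ?thesis using rcon C(1) pcon by (intro exI[of _ "rcon * C * pcon"]) auto
qed

section \<open>The least-squares formulation\<close>

lemma normal_pairing_add:
  assumes "\<tau> \<in> Hdiv \<Omega>" "u \<in> H1 \<Omega>" "v \<in> H1 \<Omega>"
  shows "normal_pairing \<Omega> \<tau> (\<lambda>x. u x + v x) = normal_pairing \<Omega> \<tau> u + normal_pairing \<Omega> \<tau> v"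
  unfolding normal_pairing_def
  using weak_grad_add_inner[OF assms(2,3) Hdiv_L2[OF assms(1)]]
  by (simp add: L2_inner_commute[of M \<tau>] L2_inner_add_right weak_div_Hdiv assms H1_L2)

lemma normal_pairing_H_N_cong:
  assumes "\<tau> \<in> H_N \<Omega> \<Gamma>D" "u \<in> H1 \<Omega>" "v \<in> V"
  shows "normal_pairing \<Omega> \<tau> (\<lambda>x. u x + v x) = normal_pairing \<Omega> \<tau> u"
  using normal_pairing_add[of \<tau> u v] assms V_H1[OF assms(3)] by (simp add: H_N_def)

lemma pairing_D_eq:
  assumes "\<tau> \<in> H_N \<Omega> \<Gamma>D" "G \<in> H1 \<Omega>" "has_trace_on \<Omega> \<Gamma>D G gD"
  shows "pairing_D \<Omega> \<Gamma>D gD \<tau> = normal_pairing \<Omega> \<tau> G"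
proof -
  define H where "H = (SOME G. G \<in> H1 \<Omega> \<and> has_trace_on \<Omega> \<Gamma>D G gD)"
  have H: "H \<in> H1 \<Omega>" "has_trace_on \<Omega> \<Gamma>D H gD"
    unfolding H_def using someI[of "\<lambda>G. G \<in> H1 \<Omega> \<and> has_trace_on \<Omega> \<Gamma>D G gD" G] assms by blast+
  have "(\<lambda>x. H x - G x) \<in> V"
    using has_trace_on_diff[OF H(1) assms(2) H(2) assms(3)] H1_diff(1)[OF H(1) assms(2)] by (simp add: H1_D_def)
  from normal_pairing_H_N_cong[OF assms(1,2) this] show ?thesis by (simp add: pairing_D_def H_def)
qed

text \<open>The constant is the dual norm, as the a priori estimate demands; the \<open>L2\<close>
  norm of f serves to show that the supremum is finite.\<close>

lemma functional_L2_inner: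
  assumes f: "f \<in> L2 M" shows "functional (H_minus1_norm \<Omega> \<Gamma>D f) (L2_inner M f)"
  unfolding functional_def
proof (intro conjI ballI allI)
  have K: "\<bar>L2_inner M f v\<bar> \<le> L2_norm M f * H1_norm \<Omega> v" if "v \<in> V" for v
    using L2_Cauchy_Schwarz[OF f H1_L2[OF V_H1[OF that]]] mult_left_mono[OF L2_norm_le_H1_norm(1)[of v] L2_norm_nonneg[of M f]]
    by linarith
  have upper: "\<bar>L2_inner M f v\<bar> \<le> H_minus1_norm \<Omega> \<Gamma>D f" if "v \<in> V" "H1_norm \<Omega> v \<le> 1" for v
    unfolding H_minus1_norm_def by (rule dual_norm_upper[where F="L2_inner M f" and V=V and N="H1_norm \<Omega>", OF K H1_norm_nonneg that])
  have "\<bar>L2_inner M f (\<lambda>x. 0)\<bar> \<le> H_minus1_norm \<Omega> \<Gamma>D f"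
    by (rule upper[OF H1_D_zero]) (simp add: H1_norm_zero)
  then show "0 \<le> H_minus1_norm \<Omega> \<Gamma>D f" by linarith
  fix u assume u: "u \<in> V"
  show scale: "L2_inner M f (\<lambda>x. c * u x) = c * L2_inner M f u" for c
    using L2_inner_scaleR_right[of M f c u] by simp
  show "L2_inner M f (\<lambda>x. u x + v x) = L2_inner M f u + L2_inner M f v" if "v \<in> V" for v
    by (intro L2_inner_add_right f H1_L2 V_H1 u that)
  show "\<bar>L2_inner M f u\<bar> \<le> H_minus1_norm \<Omega> \<Gamma>D f * H1_norm \<Omega> u"
  proof (cases "H1_norm \<Omega> u = 0")
    case True
    then show ?thesis using K[OF u] by simp
  next
    case False
    then have c: "0 < H1_norm \<Omega> u" using H1_norm_nonneg[of u] by simp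
    have "\<bar>L2_inner M f (\<lambda>x. inverse (H1_norm \<Omega> u) * u x)\<bar> \<le> H_minus1_norm \<Omega> \<Gamma>D f"
      using c by (intro upper H1_D_scale u) (simp add: H1_norm_scale V_H1 u)
    then show ?thesis using c unfolding scale by (simp add: abs_mult field_simps)
  qed
qed

lemma V_trace_on: "v \<in> V \<Longrightarrow> \<exists>g. has_trace_on \<Omega> \<Gamma> v g"
  unfolding H1_D_def has_trace_on_def by fastforce

lemma functional_pairing_N:
  assumes F: "F \<in> H_minus_half \<Omega> \<Gamma>D \<Gamma>N"
  shows "functional (H_minus_half_norm \<Omega> \<Gamma>D \<Gamma>N F) (pairing_N \<Omega> \<Gamma>N F)"
  unfolding functional_def
proof (intro conjI ballI allI)
  have VH: "V \<subseteq> H1 \<Omega>" using V_H1 by blast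
  have eq: "pairing_N \<Omega> \<Gamma>N F v = F \<psi>" if "v \<in> V" "has_trace_on \<Omega> \<Gamma>N v \<psi>" for v \<psi>
    by (rule pairing_N_eq[OF VH _ _ F that]) (auto intro: H1_D_scale H1_D_add)
  let ?T = "trace_space \<Omega> \<Gamma>N V"
  obtain K where K: "\<And>\<psi>. \<psi> \<in> ?T \<Longrightarrow> \<bar>F \<psi>\<bar> \<le> K * trace_norm \<Omega> \<Gamma>N V \<psi>" using F unfolding dual_def by blast
  \<comment> \<open>A trace of the zero function is an admissible competitor in the dual norm, which
    is therefore nonnegative.\<close>
  obtain g where g: "has_trace_on \<Omega> \<Gamma>N (\<lambda>x. 0) g" using V_trace_on[OF H1_D_zero] by blast
  have "trace_norm \<Omega> \<Gamma>N V g \<le> H1_norm \<Omega> (\<lambda>x. 0)" by (rule trace_norm_le[OF H1_D_zero g])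
  also have "\<dots> \<le> 1" by (simp add: H1_norm_zero)
  finally have gT: "g \<in> ?T" "trace_norm \<Omega> \<Gamma>N V g \<le> 1"
    using H1_D_zero g by (auto simp: trace_space_def)
  have "\<bar>F g\<bar> \<le> H_minus_half_norm \<Omega> \<Gamma>D \<Gamma>N F" by (rule dual_norm_upper[where F=F and V="?T" and N="trace_norm \<Omega> \<Gamma>N V", OF K trace_norm_nonneg gT])
  then show "0 \<le> H_minus_half_norm \<Omega> \<Gamma>D \<Gamma>N F" by linarith
  have lin: "\<forall>u\<in>?T. \<forall>v\<in>?T. F (\<lambda>x. u x + v x) = F u + F v" "\<forall>c. \<forall>v\<in>?T. F (\<lambda>x. c * v x) = c * F v"
    using F unfolding dual_def by blast+
  fix u assume u: "u \<in> V"
  obtain \<psi> where \<psi>: "has_trace_on \<Omega> \<Gamma>N u \<psi>" using V_trace_on[OF u] by blast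
  have \<psi>T: "\<psi> \<in> ?T" using u \<psi> by (auto simp: trace_space_def)
  show "\<bar>pairing_N \<Omega> \<Gamma>N F u\<bar> \<le> H_minus_half_norm \<Omega> \<Gamma>D \<Gamma>N F * H1_norm \<Omega> u"
    unfolding eq[OF u \<psi>] by (rule dual_trace_bound[OF VH _ F u \<psi>]) (rule H1_D_scale)
  show "pairing_N \<Omega> \<Gamma>N F (\<lambda>x. c * u x) = c * pairing_N \<Omega> \<Gamma>N F u" for c
    unfolding eq[OF H1_D_scale[OF u] has_trace_on_scale[OF V_H1[OF u] \<psi>]] eq[OF u \<psi>]
    using lin(2) \<psi>T by blast
  fix v assume v: "v \<in> V"
  obtain \<theta> where \<theta>: "has_trace_on \<Omega> \<Gamma>N v \<theta>" using V_trace_on[OF v] by blast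
  have \<theta>T: "\<theta> \<in> ?T" using v \<theta> by (auto simp: trace_space_def)
  show "pairing_N \<Omega> \<Gamma>N F (\<lambda>x. u x + v x) = pairing_N \<Omega> \<Gamma>N F u + pairing_N \<Omega> \<Gamma>N F v"
    unfolding eq[OF H1_D_add[OF u v] has_trace_on_add[OF V_H1[OF u] V_H1[OF v] \<psi> \<theta>]] eq[OF u \<psi>] eq[OF v \<theta>]
    using lin(1) \<psi>T \<theta>T by blast
qed

section \<open>Surjectivity of the first-order system\<close>

lemma functional_sum:
  assumes "functional K F" "functional L G" shows "functional (K + L) (\<lambda>v. F v + G v)"
  using assms unfolding functional_def
  by (auto simp: algebra_simps intro!: order_trans[OF abs_triangle_ineq] add_mono)

lemma functional_minus: "functional K F \<Longrightarrow> functional K (\<lambda>v. - F v)"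
  unfolding functional_def by auto

text \<open>
  The map \<open>(\<tau>, v) \<mapsto> (\<tau> - (A \<nabla> + b) v, div \<tau> - a v)\<close> is onto: \<open>v\<close> solves a dual problem.
\<close>

theorem first_order_system_solvable:
  "\<exists>C\<ge>0. \<forall>s\<in>L2 M. \<forall>q\<in>L2 M. \<exists>v\<in>V. (\<lambda>x. flux v x + s x) \<in> H_N \<Omega> \<Gamma>D \<and>
     (AE x in M. weak_div \<Omega> (\<lambda>x. flux v x + s x) x = a x * v x + q x) \<and>
     H1_norm \<Omega> v \<le> C * (L2_norm M s + L2_norm M q)"
proof -
  obtain C where C: "C \<ge> 0" "\<And>K F. functional K F \<Longrightarrow> \<exists>z\<in>V. (\<forall>\<phi>\<in>V. aform \<phi> z = F \<phi>) \<and> H1_norm \<Omega> z \<le> C * K"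
    using dual_solvable by blast
  have "\<exists>v\<in>V. (\<lambda>x. flux v x + s x) \<in> H_N \<Omega> \<Gamma>D \<and>
     (AE x in M. weak_div \<Omega> (\<lambda>x. flux v x + s x) x = a x * v x + q x) \<and>
     H1_norm \<Omega> v \<le> C * (L2_norm M s + L2_norm M q)" if s: "s \<in> L2 M" and q: "q \<in> L2 M" for s q
  proof -
    \<comment> \<open>The weak form of div (flux v + s) = a v + q with zero normal component on
      \<Gamma>N: after integration by parts the unknown sits in \<open>aform \<phi> v\<close> and
      the data s, q go to the right.\<close>
    have "functional (L2_norm M s + L2_norm M q) (\<lambda>\<phi>. - (L2_inner M (wg \<phi>) s + L2_inner M \<phi> q))"
    proof (intro functional_minus functional_sum)
      show "functional (L2_norm M s) (\<lambda>\<phi>. L2_inner M (wg \<phi>) s)"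
        unfolding functional_def
      proof (intro conjI ballI allI)
        fix u assume u: "u \<in> V"
        have "\<bar>L2_inner M (wg u) s\<bar> \<le> L2_norm M (wg u) * L2_norm M s"
          by (intro L2_Cauchy_Schwarz weak_grad_H1 V_H1 u s)
        also have "\<dots> \<le> H1_norm \<Omega> u * L2_norm M s" by (intro mult_right_mono L2_norm_le_H1_norm L2_norm_nonneg)
        finally show "\<bar>L2_inner M (wg u) s\<bar> \<le> L2_norm M s * H1_norm \<Omega> u" by (simp add: mult.commute)
      qed (auto simp: L2_norm_nonneg weak_grad_add_inner weak_grad_scale_inner V_H1 s)
      show "functional (L2_norm M q) (\<lambda>\<phi>. L2_inner M \<phi> q)"
        unfolding functional_def
      proof (intro conjI ballI allI)
        fix u assume u: "u \<in> V"
        have "\<bar>L2_inner M u q\<bar> \<le> L2_norm M u * L2_norm M q"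
          by (intro L2_Cauchy_Schwarz H1_L2 V_H1 u q)
        also have "\<dots> \<le> H1_norm \<Omega> u * L2_norm M q" by (intro mult_right_mono L2_norm_le_H1_norm L2_norm_nonneg)
        finally show "\<bar>L2_inner M u q\<bar> \<le> L2_norm M q * H1_norm \<Omega> u" by (simp add: mult.commute)
        show "L2_inner M (\<lambda>x. c * u x) q = c * L2_inner M u q" for c using L2_inner_scaleR_left[of M c u q] by simp
      qed (auto simp: L2_norm_nonneg L2_inner_add_left H1_L2 V_H1 q)
    qed
    from C(2)[OF this] obtain v where v: "v \<in> V" "H1_norm \<Omega> v \<le> C * (L2_norm M s + L2_norm M q)"
      "\<And>\<phi>. \<phi> \<in> V \<Longrightarrow> aform \<phi> v = - (L2_inner M (wg \<phi>) s + L2_inner M \<phi> q)" by blast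
    note vH = V_H1[OF v(1)]
    define \<tau> where "\<tau> x = flux v x + s x" for x
    define d where "d x = a x * v x + q x" for x
    have \<tau>: "\<tau> \<in> L2 M" unfolding \<tau>_def[abs_def] by (intro L2_add flux_L2 vH s)
    have d: "d \<in> L2 M" unfolding d_def[abs_def] by (intro L2_add a_L2 H1_L2 vH q)
    have green: "L2_inner M \<tau> (wg \<phi>) = - L2_inner M d \<phi>" if \<phi>: "\<phi> \<in> V" for \<phi>
    proof -
      note L = weak_grad_H1(1)[OF V_H1[OF \<phi>]] H1_L2[OF V_H1[OF \<phi>]]
      have "L2_inner M (wg \<phi>) \<tau> = L2_inner M (wg \<phi>) (flux v) + L2_inner M (wg \<phi>) s"
        unfolding \<tau>_def[abs_def] by (intro L2_inner_add_right flux_L2 vH s L)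
      moreover have "L2_inner M \<phi> d = L2_inner M \<phi> (\<lambda>x. a x * v x) + L2_inner M \<phi> q"
        unfolding d_def[abs_def] by (intro L2_inner_add_right a_L2 H1_L2 vH q L)
      ultimately show ?thesis
        using v(3)[OF \<phi>] by (simp add: aform_def L2_inner_commute[of M \<tau>] L2_inner_commute[of M d])
    qed
    \<comment> \<open>The identity \<open>green\<close> is used twice: against test functions it
      identifies the divergence, against all of V it then gives the vanishing normal
      component.\<close>
    have "has_weak_div \<Omega> \<tau> d"
      unfolding has_weak_div_def
    proof (intro allI impI)
      fix \<phi> assume \<phi>: "test_function \<Omega> \<phi>"
      note s = test_functionD(1)[OF \<phi>]
      have "L2_inner M \<tau> (grad \<phi>) = L2_inner M \<tau> (wg \<phi>)"
        using smooth_H1(2)[OF s] by (intro L2_inner_cong_AE \<tau> grad_L2 weak_grad_H1 smooth_H1 s) (auto elim: eventually_mono)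
      then show "L2_inner M \<tau> (grad \<phi>) = - L2_inner M d \<phi>"
        using green[OF test_function_H1_D[OF \<phi> \<Gamma>D(1)]] by simp
    qed
    note Hd = Hdiv_I[OF \<tau> d this]
    have "\<tau> \<in> H_N \<Omega> \<Gamma>D"
      unfolding H_N_def
    proof (intro CollectI conjI ballI Hd)
      fix \<phi> assume \<phi>: "\<phi> \<in> V"
      have "L2_inner M (weak_div \<Omega> \<tau>) \<phi> = L2_inner M d \<phi>"
        by (intro L2_inner_cong_AE weak_div_Hdiv Hd d H1_L2 V_H1 \<phi>) auto
      then show "normal_pairing \<Omega> \<tau> \<phi> = 0" using green[OF \<phi>] by (simp add: normal_pairing_def)
    qed
    then show ?thesis using v(1,2) Hd(2) unfolding \<tau>_def d_def by blast
  qed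
  then show ?thesis using C(1) by blast
qed

text \<open>The factors need only agree almost everywhere with \<open>L2\<close> functions, so
  measurability of the expressions with \<open>matrix_inv (A x)\<close> does not have to be checked
  at each use.\<close>

lemma bform_eq:
  assumes Z: "Z \<in> L2 M" "AE x in M. \<eta> x - flux w x = Z x" and D: "D \<in> L2 M" "AE x in M. inverse (a x) * weak_div \<Omega> \<eta> x - w x = D x"
    and Z': "Z' \<in> L2 M" "AE x in M. matrix_inv (A x) *v \<tau> x - (wg v x + v x *\<^sub>R (matrix_inv (A x) *v b x)) = Z' x"
    and D': "D' \<in> L2 M" "AE x in M. weak_div \<Omega> \<tau> x - a x * v x = D' x"
  shows "bform \<Omega> A b a \<eta> w \<tau> v = L2_inner M Z Z' + L2_inner M D D'"
proof -
  have "L2_inner M (\<lambda>x. \<eta> x - (A x *v wg w x + w x *\<^sub>R b x)) (\<lambda>x. matrix_inv (A x) *v \<tau> x - (wg v x + v x *\<^sub>R (matrix_inv (A x) *v b x)))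
      = L2_inner M Z Z'"
    unfolding L2_inner_def
  proof (rule integral_M_cong_AE)
    show "(\<lambda>x. Z x \<bullet> Z' x) \<in> borel_measurable M"
      by (intro borel_measurable_inner L2_measurable Z Z')
    show "AE x in M. (\<eta> x - (A x *v wg w x + w x *\<^sub>R b x)) \<bullet> (matrix_inv (A x) *v \<tau> x - (wg v x + v x *\<^sub>R (matrix_inv (A x) *v b x))) = Z x \<bullet> Z' x"
      using Z(2) Z'(2) by eventually_elim (simp add: flux_def)
  qed
  moreover have "L2_inner M (\<lambda>x. inverse (a x) * weak_div \<Omega> \<eta> x - w x) (\<lambda>x. weak_div \<Omega> \<tau> x - a x * v x) = L2_inner M D D'"
    unfolding L2_inner_def
  proof (rule integral_M_cong_AE)
    show "(\<lambda>x. D x \<bullet> D' x) \<in> borel_measurable M"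
      by (intro borel_measurable_inner L2_measurable D D')
    show "AE x in M. (inverse (a x) * weak_div \<Omega> \<eta> x - w x) \<bullet> (weak_div \<Omega> \<tau> x - a x * v x) = D x \<bullet> D' x"
      using D(2) D'(2) by eventually_elim simp
  qed
  ultimately show ?thesis by (simp add: bform_def)
qed

text \<open>
  Testing with \<open>(\<tau>, v)\<close> that realises \<open>s = A Z\<close> and \<open>q = D\<close>, where \<open>Z\<close> and \<open>D\<close> are the residuals
  of the difference of two solutions, turns the indefinite form into \<open>\<parallel>Z\<parallel>\<^sup>2 + \<parallel>D\<parallel>\<^sup>2\<close>.
\<close>

theorem variational_unique:
  assumes sol: "\<eta>1 \<in> H_N \<Omega> \<Gamma>D" "w1 \<in> V" "\<eta>2 \<in> H_N \<Omega> \<Gamma>D" "w2 \<in> V"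
    and eq: "\<And>\<tau> v. \<tau> \<in> H_N \<Omega> \<Gamma>D \<Longrightarrow> v \<in> V \<Longrightarrow> bform \<Omega> A b a \<eta>1 w1 \<tau> v = bform \<Omega> A b a \<eta>2 w2 \<tau> v"
  shows "AE x in M. \<eta>1 x = \<eta>2 x" "AE x in M. w1 x = w2 x"
proof -
  have Hd: "\<eta>1 \<in> Hdiv \<Omega>" "\<eta>2 \<in> Hdiv \<Omega>" using sol by (auto simp: H_N_def)
  note L = Hdiv_L2[OF Hd(1)] Hdiv_L2[OF Hd(2)] weak_div_Hdiv(1)[OF Hd(1)] weak_div_Hdiv(1)[OF Hd(2)] 
    H1_L2[OF V_H1[OF sol(2)]] H1_L2[OF V_H1[OF sol(4)]] 
    flux_L2(1)[OF V_H1[OF sol(2)]] flux_L2(1)[OF V_H1[OF sol(4)]]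
  define S1 where "S1 x = \<eta>1 x - flux w1 x" for x
  define S2 where "S2 x = \<eta>2 x - flux w2 x" for x
  define D1 where "D1 x = inverse (a x) * weak_div \<Omega> \<eta>1 x - w1 x" for x
  define D2 where "D2 x = inverse (a x) * weak_div \<Omega> \<eta>2 x - w2 x" for x
  have S12: "S1 \<in> L2 M" "S2 \<in> L2 M" "D1 \<in> L2 M" "D2 \<in> L2 M"
    unfolding S1_def[abs_def] S2_def[abs_def] D1_def[abs_def] D2_def[abs_def] by (intro L2_diff a_inverse_L2 L)+
  define Z where "Z x = S1 x - S2 x" for x
  define D where "D x = D1 x - D2 x" for x
  have SD: "Z \<in> L2 M" "D \<in> L2 M" unfolding Z_def[abs_def] D_def[abs_def] by (intro L2_diff S12)+
  obtain v where v: "v \<in> V" and \<tau>: "(\<lambda>x. flux v x + A x *v Z x) \<in> H_N \<Omega> \<Gamma>D"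
    and div: "AE x in M. weak_div \<Omega> (\<lambda>x. flux v x + A x *v Z x) x = a x * v x + D x"
    using first_order_system_solvable A_L2(1)[OF SD(1)] SD(2) by meson
  define \<tau> where "\<tau> x = flux v x + A x *v Z x" for x
  have Z': "AE x in M. matrix_inv (A x) *v \<tau> x - (wg v x + v x *\<^sub>R (matrix_inv (A x) *v b x)) = Z x"
    using A_facts
  proof eventually_elim
    case (elim x)
    then have "matrix_inv (A x) *v \<tau> x = wg v x + v x *\<^sub>R (matrix_inv (A x) *v b x) + Z x"
      by (simp add: \<tau>_def flux_def matrix_vector_right_distrib matrix_vector_mult_scaleR)
    then show ?case by simp
  qed
  have D': "AE x in M. weak_div \<Omega> \<tau> x - a x * v x = D x"
    using div unfolding \<tau>_def[symmetric, abs_def] by eventually_elim simp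
  have "bform \<Omega> A b a \<eta>1 w1 \<tau> v = L2_inner M S1 Z + L2_inner M D1 D"
    by (rule bform_eq[OF _ _ _ _ SD(1) Z' SD(2) D']) (auto simp: S1_def[symmetric] D1_def[symmetric] S12)
  moreover have "bform \<Omega> A b a \<eta>2 w2 \<tau> v = L2_inner M S2 Z + L2_inner M D2 D"
    by (rule bform_eq[OF _ _ _ _ SD(1) Z' SD(2) D']) (auto simp: S2_def[symmetric] D2_def[symmetric] S12)
  moreover have "bform \<Omega> A b a \<eta>1 w1 \<tau> v = bform \<Omega> A b a \<eta>2 w2 \<tau> v"
    using eq[OF \<tau> v] by (simp add: \<tau>_def[abs_def])
  moreover have "L2_inner M Z Z = L2_inner M S1 Z - L2_inner M S2 Z"
    "L2_inner M D D = L2_inner M D1 D - L2_inner M D2 D"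
    by (subst (1) Z_def[abs_def] D_def[abs_def], intro L2_inner_diff_left S12 SD)+
  ultimately have "(L2_norm M Z)\<^sup>2 + (L2_norm M D)\<^sup>2 = 0" unfolding L2_norm_square by linarith
  then have "L2_norm M Z = 0" "L2_norm M D = 0" by (simp_all add: add_nonneg_eq_0_iff)
  then have S0: "AE x in M. Z x = 0" and D0: "AE x in M. D x = 0" using L2_norm_0_imp_AE SD by blast+
  \<comment> \<open>With vanishing residuals, flux w = \<eta>1 - \<eta>2 and a w is the divergence
    of that difference. As both \<eta>1 and \<eta>2 have zero normal component on \<Gamma>N, Green's
    formula gives \<open>aform \<phi> w\<close> = 0: w solves the homogeneous dual problem.\<close>
  define w where "w x = w1 x - w2 x" for x
  have w: "w \<in> V" unfolding w_def[abs_def] by (intro H1_D_diff sol)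
  have gw: "AE x in M. wg w x = wg w1 x - wg w2 x" 
    unfolding w_def[abs_def] by (rule H1_diff(2)[OF V_H1[OF sol(2)] V_H1[OF sol(4)]])
  have fluxw: "AE x in M. flux w x = \<eta>1 x - \<eta>2 x"
    using S0 gw
  proof eventually_elim
    case (elim x)
    have "flux w x = flux w1 x - flux w2 x"
      unfolding flux_def elim(2) by (simp add: w_def matrix_vector_mult_diff_distrib scaleR_diff_left)
    moreover have "(\<eta>1 x - \<eta>2 x) - (flux w1 x - flux w2 x) = Z x"
      by (simp add: Z_def S1_def S2_def algebra_simps)
    ultimately show ?case using elim(1) by simp
  qed
  have divw: "AE x in M. a x * w x = weak_div \<Omega> \<eta>1 x - weak_div \<Omega> \<eta>2 x"
    using D0 a_nonzero
  proof eventually_elim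
    case (elim x)
    have "w x = inverse (a x) * (weak_div \<Omega> \<eta>1 x - weak_div \<Omega> \<eta>2 x)"
      using elim(1) by (simp add: D_def D1_def D2_def w_def algebra_simps)
    then show ?case using elim(2) by simp
  qed
  have w0: "AE x in M. w x = 0"
  proof (rule dual_unique[OF w], intro ballI)
    fix \<phi> assume \<phi>: "\<phi> \<in> V"
    note P = weak_grad_H1(1)[OF V_H1[OF \<phi>]] H1_L2[OF V_H1[OF \<phi>]]
    have "L2_inner M (wg \<phi>) (flux w) = L2_inner M (wg \<phi>) (\<lambda>x. \<eta>1 x - \<eta>2 x)"
      by (intro L2_inner_cong_AE P flux_L2 V_H1 w L2_diff L fluxw) auto
    also have "\<dots> = L2_inner M (wg \<phi>) \<eta>1 - L2_inner M (wg \<phi>) \<eta>2" by (intro L2_inner_diff_right P L)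
    finally have 1: "L2_inner M (wg \<phi>) (flux w) = L2_inner M \<eta>1 (wg \<phi>) - L2_inner M \<eta>2 (wg \<phi>)"
      by (simp add: L2_inner_commute)
    have "L2_inner M \<phi> (\<lambda>x. a x * w x) = L2_inner M \<phi> (\<lambda>x. weak_div \<Omega> \<eta>1 x - weak_div \<Omega> \<eta>2 x)"
      by (intro L2_inner_cong_AE P a_L2 H1_L2 V_H1 w L2_diff L divw) auto
    also have "\<dots> = L2_inner M \<phi> (weak_div \<Omega> \<eta>1) - L2_inner M \<phi> (weak_div \<Omega> \<eta>2)" by (intro L2_inner_diff_right P L)
    finally have 2: "L2_inner M \<phi> (\<lambda>x. a x * w x) = L2_inner M (weak_div \<Omega> \<eta>1) \<phi> - L2_inner M (weak_div \<Omega> \<eta>2) \<phi>"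
      by (simp add: L2_inner_commute)
    have "normal_pairing \<Omega> \<eta>1 \<phi> = 0" "normal_pairing \<Omega> \<eta>2 \<phi> = 0" using sol \<phi> by (auto simp: H_N_def)
    then show "aform \<phi> w = 0" unfolding aform_def 1 2 normal_pairing_def by linarith
  qed
  then show "AE x in M. w1 x = w2 x" by (simp add: w_def)
  \<comment> \<open>A function that vanishes almost everywhere has \<open>H1\<close> norm 0, hence
    zero flux, and the flux of w is \<eta>1 - \<eta>2.\<close>
  have "L2_norm M (flux w) \<le> 0"
    using flux_L2(2)[OF V_H1[OF w]] H1_norm_zero_AE[OF V_H1[OF w] w0] by simp
  then have "L2_norm M (flux w) = 0" using L2_norm_nonneg[of M "flux w"] by simp
  then have "AE x in M. flux w x = 0" by (rule L2_norm_0_imp_AE[OF flux_L2(1)[OF V_H1[OF w]]])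
  with fluxw show "AE x in M. \<eta>1 x = \<eta>2 x" by eventually_elim simp
qed

text \<open>Stated for a function G in \<open>H1\<close> instead of its trace, so that the estimate
  is available for every lift of a Dirichlet datum and the infimum over lifts can be taken
  later.\<close>

theorem variational_solvable:
  "\<exists>C\<ge>0. \<forall>f\<in>L2 M. \<forall>gN\<in>H_minus_half \<Omega> \<Gamma>D \<Gamma>N. \<forall>G\<in>H1 \<Omega>. \<exists>\<eta>\<in>H_N \<Omega> \<Gamma>D. \<exists>w\<in>V.
    (\<forall>\<tau>\<in>H_N \<Omega> \<Gamma>D. \<forall>v\<in>V. bform \<Omega> A b a \<eta> w \<tau> v = L2_inner M f v - pairing_N \<Omega> \<Gamma>N gN v - normal_pairing \<Omega> \<tau> G) \<and>
    H1_norm \<Omega> w + L2_norm M \<eta> + L2_norm M (weak_div \<Omega> \<eta>)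
      \<le> C * (H_minus1_norm \<Omega> \<Gamma>D f + H_minus_half_norm \<Omega> \<Gamma>D \<Gamma>N gN + H1_norm \<Omega> G)"
proof -
  obtain Cp where Cp: "Cp \<ge> 0" "\<And>K F. functional K F \<Longrightarrow> \<exists>u\<in>V. (\<forall>v\<in>V. aform u v = F v) \<and> H1_norm \<Omega> u \<le> Cp * K"
    using primal_solvable by blast
  obtain Cf where Cf: "Cf \<ge> 0" "\<And>s q. s \<in> L2 M \<Longrightarrow> q \<in> L2 M \<Longrightarrow> \<exists>v\<in>V. (\<lambda>x. flux v x + s x) \<in> H_N \<Omega> \<Gamma>D \<and>
     (AE x in M. weak_div \<Omega> (\<lambda>x. flux v x + s x) x = a x * v x + q x) \<and>
     H1_norm \<Omega> v \<le> Cf * (L2_norm M s + L2_norm M q)"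
    using first_order_system_solvable by blast
  \<comment> \<open>C1 bounds w in terms of u, C2 collects the bounds for w, \<eta> and div \<eta>
    in terms of u, and C3 bounds u by the data.\<close>
  define C1 where "C1 = Cf * (\<Lambda>1 + Ka)"
  define C2 where "C2 = C1 + ((\<Lambda>1 + Kb) * C1 + \<Lambda>1) + (Ka * C1 + Ka)"
  define C3 where "C3 = 1 + Cp * (1 + acon)"
  have C: "0 \<le> C1" "0 \<le> C2" "0 \<le> C3" using constants Cp Cf acon_nonneg by (auto simp: C1_def C2_def C3_def)
  have "\<exists>\<eta>\<in>H_N \<Omega> \<Gamma>D. \<exists>w\<in>V.
    (\<forall>\<tau>\<in>H_N \<Omega> \<Gamma>D. \<forall>v\<in>V. bform \<Omega> A b a \<eta> w \<tau> v = L2_inner M f v - pairing_N \<Omega> \<Gamma>N gN v - normal_pairing \<Omega> \<tau> G) \<and>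
    H1_norm \<Omega> w + L2_norm M \<eta> + L2_norm M (weak_div \<Omega> \<eta>)
      \<le> C2 * C3 * (H_minus1_norm \<Omega> \<Gamma>D f + H_minus_half_norm \<Omega> \<Gamma>D \<Gamma>N gN + H1_norm \<Omega> G)"
    if f: "f \<in> L2 M" and gN: "gN \<in> H_minus_half \<Omega> \<Gamma>D \<Gamma>N" and G: "G \<in> H1 \<Omega>" for f gN G
  proof -
    define X where "X = H_minus1_norm \<Omega> \<Gamma>D f + H_minus_half_norm \<Omega> \<Gamma>D \<Gamma>N gN"
    note Ff = functional_L2_inner[OF f] and FN = functional_pairing_N[OF gN]
    have X: "0 \<le> X" using Ff FN by (simp add: X_def functional_def)
    \<comment> \<open>u0 compensates the defect of G, so that u = G + u0 satisfies the primal
      equation with the full data and keeps the trace of G on \<Gamma>D.\<close>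
    have "functional (X + acon * H1_norm \<Omega> G) (\<lambda>v. (L2_inner M f v + - pairing_N \<Omega> \<Gamma>N gN v) + - aform G v)"
      unfolding X_def by (intro functional_sum functional_minus Ff FN functional_aform_right G)
    from Cp(2)[OF this] obtain u0 where u0: "u0 \<in> V"
      "\<And>v. v \<in> V \<Longrightarrow> aform u0 v = L2_inner M f v - pairing_N \<Omega> \<Gamma>N gN v - aform G v"
      "H1_norm \<Omega> u0 \<le> Cp * (X + acon * H1_norm \<Omega> G)" by auto
    define u where "u x = G x + u0 x" for x
    have u: "u \<in> H1 \<Omega>" unfolding u_def[abs_def] by (intro H1_add G V_H1 u0)
    have au: "aform u v = L2_inner M f v - pairing_N \<Omega> \<Gamma>N gN v" if "v \<in> V" for v
      using aform_add_left[OF G V_H1[OF u0(1)] V_H1[OF that]] u0(2)[OF that] by (simp add: u_def[abs_def])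
    have nu: "H1_norm \<Omega> u \<le> C3 * (X + H1_norm \<Omega> G)"
    proof -
      have "H1_norm \<Omega> u \<le> H1_norm \<Omega> G + H1_norm \<Omega> u0"
        unfolding u_def[abs_def] by (intro H1_norm_add G V_H1 u0)
      also have "\<dots> \<le> H1_norm \<Omega> G + Cp * (X + acon * H1_norm \<Omega> G)" using u0(3) by simp
      also have "\<dots> \<le> C3 * (X + H1_norm \<Omega> G)"
        using X Cp(1) acon_nonneg H1_norm_nonneg[of G] mult_nonneg_nonneg[OF Cp(1) X]
          mult_nonneg_nonneg[OF Cp(1) H1_norm_nonneg[of G]] mult_nonneg_nonneg[OF mult_nonneg_nonneg[OF Cp(1) acon_nonneg] X]
        by (simp add: C3_def algebra_simps)
      finally show ?thesis .
    qed
    note uL = weak_grad_H1(1)[OF u] H1_L2[OF u]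
    define s where "s x = - (A x *v wg u x)" for x
    define q where "q x = - (a x * u x)" for x
    have s: "s \<in> L2 M" and q: "q \<in> L2 M" unfolding s_def[abs_def] q_def[abs_def] by (intro L2_uminus A_L2 a_L2 uL)+
    have ns: "L2_norm M s \<le> \<Lambda>1 * H1_norm \<Omega> u"
      unfolding s_def[abs_def] L2_norm_uminus
      using A_L2(2)[OF uL(1)] mult_left_mono[OF L2_norm_le_H1_norm(2)[of u] constants(4)] by linarith
    have nq: "L2_norm M q \<le> Ka * H1_norm \<Omega> u"
      unfolding q_def[abs_def] L2_norm_uminus
      using a_L2(2)[OF uL(2)] mult_left_mono[OF L2_norm_le_H1_norm(1)[of u] constants(1)] by linarith
    obtain w where w: "w \<in> V" "(\<lambda>x. flux w x + s x) \<in> H_N \<Omega> \<Gamma>D"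
      "AE x in M. weak_div \<Omega> (\<lambda>x. flux w x + s x) x = a x * w x + q x"
      "H1_norm \<Omega> w \<le> Cf * (L2_norm M s + L2_norm M q)" using Cf(2)[OF s q] by blast
    define \<eta> where "\<eta> = (\<lambda>x. flux w x + s x)"
    have \<eta>: "\<eta> \<in> H_N \<Omega> \<Gamma>D" "AE x in M. weak_div \<Omega> \<eta> x = a x * w x + q x" using w by (simp_all add: \<eta>_def)
    have Hd: "\<eta> \<in> Hdiv \<Omega>" using \<eta>(1) by (simp add: H_N_def)
    note wH = V_H1[OF w(1)]
    have nw: "H1_norm \<Omega> w \<le> C1 * H1_norm \<Omega> u"
    proof -
      have "Cf * (L2_norm M s + L2_norm M q) \<le> Cf * (\<Lambda>1 * H1_norm \<Omega> u + Ka * H1_norm \<Omega> u)"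
        using Cf(1) ns nq by (intro mult_left_mono) auto
      then show ?thesis using w(4) by (simp add: C1_def algebra_simps)
    qed
    have n\<eta>: "L2_norm M \<eta> \<le> ((\<Lambda>1 + Kb) * C1 + \<Lambda>1) * H1_norm \<Omega> u"
    proof -
      have "L2_norm M \<eta> \<le> L2_norm M (flux w) + L2_norm M s" unfolding \<eta>_def by (intro L2_norm_add flux_L2 wH s)
      also have "\<dots> \<le> (\<Lambda>1 + Kb) * H1_norm \<Omega> w + \<Lambda>1 * H1_norm \<Omega> u" using flux_L2(2)[OF wH] ns by linarith
      also have "(\<Lambda>1 + Kb) * H1_norm \<Omega> w \<le> (\<Lambda>1 + Kb) * (C1 * H1_norm \<Omega> u)"
        using constants nw by (intro mult_left_mono) auto
      finally show ?thesis by (simp add: algebra_simps)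
    qed
    have nd: "L2_norm M (weak_div \<Omega> \<eta>) \<le> (Ka * C1 + Ka) * H1_norm \<Omega> u"
    proof -
      have "L2_norm M (weak_div \<Omega> \<eta>) = L2_norm M (\<lambda>x. a x * w x + q x)"
        by (intro L2_norm_cong_AE weak_div_Hdiv Hd \<eta> L2_add a_L2 q H1_L2 wH)
      also have "\<dots> \<le> L2_norm M (\<lambda>x. a x * w x) + L2_norm M q" by (intro L2_norm_add a_L2 q H1_L2 wH)
      also have "\<dots> \<le> Ka * H1_norm \<Omega> w + Ka * H1_norm \<Omega> u"
        using nq a_L2(2)[OF H1_L2[OF wH]] mult_left_mono[OF L2_norm_le_H1_norm(1)[of w] constants(1)] by linarith
      also have "Ka * H1_norm \<Omega> w \<le> Ka * (C1 * H1_norm \<Omega> u)" using constants nw by (intro mult_left_mono) auto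
      finally show ?thesis by (simp add: algebra_simps)
    qed
    have "H1_norm \<Omega> w + L2_norm M \<eta> + L2_norm M (weak_div \<Omega> \<eta>) \<le> C2 * H1_norm \<Omega> u"
      using nw n\<eta> nd by (simp add: C2_def algebra_simps)
    also have "\<dots> \<le> C2 * (C3 * (X + H1_norm \<Omega> G))" using C nu by (intro mult_left_mono)
    finally have norms: "H1_norm \<Omega> w + L2_norm M \<eta> + L2_norm M (weak_div \<Omega> \<eta>) \<le> C2 * C3 * (X + H1_norm \<Omega> G)"
      by (simp add: mult.assoc)
    have "bform \<Omega> A b a \<eta> w \<tau> v = L2_inner M f v - pairing_N \<Omega> \<Gamma>N gN v - normal_pairing \<Omega> \<tau> G"
      if \<tau>: "\<tau> \<in> H_N \<Omega> \<Gamma>D" and v: "v \<in> V" for \<tau> v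
    proof -
      have \<tau>d: "\<tau> \<in> Hdiv \<Omega>" using \<tau> by (simp add: H_N_def)
      note vH = V_H1[OF v]
      note L = Hdiv_L2[OF \<tau>d] weak_div_Hdiv(1)[OF \<tau>d] flux_L2(1)[OF vH] a_L2(1)[OF H1_L2[OF vH]]
      have "L2_inner M (\<lambda>x. \<eta> x - (A x *v wg w x + w x *\<^sub>R b x)) (\<lambda>x. matrix_inv (A x) *v \<tau> x - (wg v x + v x *\<^sub>R (matrix_inv (A x) *v b x)))
          = L2_inner M (wg u) (\<lambda>x. flux v x - \<tau> x)"
        unfolding L2_inner_def
      proof (rule integral_M_cong_AE)
        show "(\<lambda>x. wg u x \<bullet> (flux v x - \<tau> x)) \<in> borel_measurable M"
          by (intro borel_measurable_inner L2_measurable L2_diff uL L)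
        show "AE x in M. (\<eta> x - (A x *v wg w x + w x *\<^sub>R b x)) \<bullet> (matrix_inv (A x) *v \<tau> x - (wg v x + v x *\<^sub>R (matrix_inv (A x) *v b x)))
            = wg u x \<bullet> (flux v x - \<tau> x)"
          using A_facts A_symmetric
        proof eventually_elim
          case (elim x)
          let ?y = "matrix_inv (A x) *v \<tau> x - (wg v x + v x *\<^sub>R (matrix_inv (A x) *v b x))"
          \<comment> \<open>Symmetry moves the factor A from A \<nabla>u onto \<open>?y\<close>,
            where it cancels the inverse.\<close>
          have "A x *v ?y = \<tau> x - flux v x"
            using elim(1) by (simp add: flux_def matrix_vector_mult_diff_distrib matrix_vector_right_distrib matrix_vector_mult_scaleR)
          moreover have "\<eta> x - (A x *v wg w x + w x *\<^sub>R b x) = - (A x *v wg u x)"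
            by (simp add: \<eta>_def flux_def s_def)
          ultimately show ?case
            using symmetric_matrix_inner[OF elim(2), of "wg u x" ?y] by (simp add: inner_diff_right)
        qed
      qed
      also have "\<dots> = L2_inner M (wg u) (flux v) - L2_inner M (wg u) \<tau>" by (intro L2_inner_diff_right uL L)
      finally have 1: "L2_inner M (\<lambda>x. \<eta> x - (A x *v wg w x + w x *\<^sub>R b x)) (\<lambda>x. matrix_inv (A x) *v \<tau> x - (wg v x + v x *\<^sub>R (matrix_inv (A x) *v b x)))
          = L2_inner M (wg u) (flux v) - L2_inner M \<tau> (wg u)" by (simp add: L2_inner_commute)
      have "L2_inner M (\<lambda>x. inverse (a x) * weak_div \<Omega> \<eta> x - w x) (\<lambda>x. weak_div \<Omega> \<tau> x - a x * v x)
          = L2_inner M u (\<lambda>x. a x * v x - weak_div \<Omega> \<tau> x)"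
        unfolding L2_inner_def
      proof (rule integral_M_cong_AE)
        show "(\<lambda>x. u x \<bullet> (a x * v x - weak_div \<Omega> \<tau> x)) \<in> borel_measurable M"
          by (intro borel_measurable_inner L2_measurable L2_diff uL L)
        show "AE x in M. (inverse (a x) * weak_div \<Omega> \<eta> x - w x) \<bullet> (weak_div \<Omega> \<tau> x - a x * v x) = u x \<bullet> (a x * v x - weak_div \<Omega> \<tau> x)"
          using \<eta>(2) a_nonzero
        proof eventually_elim
          case (elim x)
          then have "inverse (a x) * weak_div \<Omega> \<eta> x - w x = - u x" by (simp add: q_def field_simps)
          then show ?case by (simp only:) (simp add: algebra_simps)
        qed
      qed
      also have "\<dots> = L2_inner M u (\<lambda>x. a x * v x) - L2_inner M u (weak_div \<Omega> \<tau>)" by (intro L2_inner_diff_right uL L)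
      finally have 2: "L2_inner M (\<lambda>x. inverse (a x) * weak_div \<Omega> \<eta> x - w x) (\<lambda>x. weak_div \<Omega> \<tau> x - a x * v x)
          = L2_inner M u (\<lambda>x. a x * v x) - L2_inner M (weak_div \<Omega> \<tau>) u" by (simp add: L2_inner_commute)
      \<comment> \<open>The terms with \<tau> are, up to sign, Green's formula for the pairing of n
        . \<tau> with u; here u may be replaced by G, as u - G = u0 lies in
        \<open>V\<close>.\<close>
      have "bform \<Omega> A b a \<eta> w \<tau> v = aform u v - normal_pairing \<Omega> \<tau> u"
        unfolding bform_def 1 2 aform_def normal_pairing_def by simp
      also have "normal_pairing \<Omega> \<tau> u = normal_pairing \<Omega> \<tau> G"
        unfolding u_def[abs_def] by (rule normal_pairing_H_N_cong[OF \<tau> G u0(1)])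
      finally show ?thesis using au[OF v] by simp
    qed
    then show ?thesis using \<eta>(1) w(1) norms unfolding X_def by blast
  qed
  then show ?thesis using C by (intro exI[of _ "C2 * C3"]) auto
qed

section \<open>The energy norm and the a priori estimate\<close>

lemma sqrt_sum_squares_le:
  assumes "0 \<le> x" "0 \<le> y" "0 \<le> z" "0 \<le> (t::real)"
  shows "sqrt (x\<^sup>2 + y\<^sup>2 + z\<^sup>2 + t\<^sup>2) \<le> x + y + z + t"
proof (rule real_le_lsqrt)
  show "x\<^sup>2 + y\<^sup>2 + z\<^sup>2 + t\<^sup>2 \<le> (x + y + z + t)\<^sup>2"
    using assms mult_nonneg_nonneg[of x y] mult_nonneg_nonneg[of x z] mult_nonneg_nonneg[of x t]
      mult_nonneg_nonneg[of y z] mult_nonneg_nonneg[of y t] mult_nonneg_nonneg[of z t]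
    by (simp add: power2_eq_square algebra_simps)
qed (use assms in auto)

text \<open>One summand per weight in the energy norm: the square roots of the bounds for |a|, for
  A, for the inverse of A and for the inverse of a.\<close>

definition econ :: real where "econ = sqrt Ka + sqrt \<Lambda>1 + 1 / sqrt \<Lambda>0 + sqrt Ki"

lemma econ_nonneg: "0 \<le> econ" using constants \<Lambda>0 by (simp add: econ_def)

lemma energy_norm_le:
  assumes "\<eta> \<in> Hdiv \<Omega>" "w \<in> H1 \<Omega>"
  shows "energy_norm \<Omega> A a \<eta> w \<le> econ * (H1_norm \<Omega> w + L2_norm M \<eta> + L2_norm M (weak_div \<Omega> \<eta>))"
proof -
  note L = H1_L2[OF assms(2)] weak_grad_H1(1)[OF assms(2)] Hdiv_L2[OF assms(1)] weak_div_Hdiv(1)[OF assms(1)]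
  have "AE x in M. norm (sqrt \<bar>a x\<bar> * w x) \<le> sqrt Ka * norm (w x)"
    using a_bounded by eventually_elim (auto simp: abs_mult intro!: mult_right_mono)
  from L2_norm_le_AE[OF L(1) this] have 1: "L2_norm M (\<lambda>x. sqrt \<bar>a x\<bar> * w x) \<le> sqrt Ka * H1_norm \<Omega> w"
    using constants mult_left_mono[OF L2_norm_le_H1_norm(1)[of w], of "sqrt Ka"] by simp
  have "AE x in M. norm (mat_sqrt (A x) *v wg w x) \<le> sqrt \<Lambda>1 * norm (wg w x)"
    using A_facts by eventually_elim blast
  from L2_norm_le_AE[OF L(2) this] have 2: "L2_norm M (\<lambda>x. mat_sqrt (A x) *v wg w x) \<le> sqrt \<Lambda>1 * H1_norm \<Omega> w"
    using constants mult_left_mono[OF L2_norm_le_H1_norm(2)[of w], of "sqrt \<Lambda>1"] by simp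
  have "AE x in M. norm (matrix_inv (mat_sqrt (A x)) *v \<eta> x) \<le> 1 / sqrt \<Lambda>0 * norm (\<eta> x)"
    using A_facts by eventually_elim blast
  from L2_norm_le_AE[OF L(3) this] have 3: "L2_norm M (\<lambda>x. matrix_inv (mat_sqrt (A x)) *v \<eta> x) \<le> 1 / sqrt \<Lambda>0 * L2_norm M \<eta>"
    using \<Lambda>0 by simp
  have "AE x in M. norm (inverse (sqrt \<bar>a x\<bar>) * weak_div \<Omega> \<eta> x) \<le> sqrt Ki * norm (weak_div \<Omega> \<eta> x)"
    using a_inverse_bounded
  proof eventually_elim
    case (elim x)
    then have "sqrt \<bar>inverse (a x)\<bar> \<le> sqrt Ki" by (rule real_sqrt_le_mono)
    then have "inverse (sqrt \<bar>a x\<bar>) \<le> sqrt Ki" by (simp add: abs_inverse real_sqrt_inverse)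
    then show ?case by (auto simp: abs_mult intro!: mult_right_mono)
  qed
  from L2_norm_le_AE[OF L(4) this] have 4: "L2_norm M (\<lambda>x. inverse (sqrt \<bar>a x\<bar>) * weak_div \<Omega> \<eta> x) \<le> sqrt Ki * L2_norm M (weak_div \<Omega> \<eta>)"
    using constants by simp
  define X where "X = H1_norm \<Omega> w + L2_norm M \<eta> + L2_norm M (weak_div \<Omega> \<eta>)"
  have X: "H1_norm \<Omega> w \<le> X" "L2_norm M \<eta> \<le> X" "L2_norm M (weak_div \<Omega> \<eta>) \<le> X"
    using H1_norm_nonneg[of w] L2_norm_nonneg[of M \<eta>] L2_norm_nonneg[of M "weak_div \<Omega> \<eta>"] by (auto simp: X_def)
  have "energy_norm \<Omega> A a \<eta> w \<le> L2_norm M (\<lambda>x. sqrt \<bar>a x\<bar> * w x) + L2_norm M (\<lambda>x. mat_sqrt (A x) *v wg w x)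
      + L2_norm M (\<lambda>x. matrix_inv (mat_sqrt (A x)) *v \<eta> x) + L2_norm M (\<lambda>x. inverse (sqrt \<bar>a x\<bar>) * weak_div \<Omega> \<eta> x)"
    unfolding energy_norm_def by (intro sqrt_sum_squares_le L2_norm_nonneg)
  also have "\<dots> \<le> sqrt Ka * X + sqrt \<Lambda>1 * X + 1 / sqrt \<Lambda>0 * X + sqrt Ki * X"
  proof (intro add_mono)
    show "L2_norm M (\<lambda>x. sqrt \<bar>a x\<bar> * w x) \<le> sqrt Ka * X"
      using 1 mult_left_mono[OF X(1), of "sqrt Ka"] constants by simp
    show "L2_norm M (\<lambda>x. mat_sqrt (A x) *v wg w x) \<le> sqrt \<Lambda>1 * X"
      using 2 mult_left_mono[OF X(1), of "sqrt \<Lambda>1"] constants by simp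
    show "L2_norm M (\<lambda>x. matrix_inv (mat_sqrt (A x)) *v \<eta> x) \<le> 1 / sqrt \<Lambda>0 * X"
      using 3 mult_left_mono[OF X(2), of "1 / sqrt \<Lambda>0"] \<Lambda>0 by simp
    show "L2_norm M (\<lambda>x. inverse (sqrt \<bar>a x\<bar>) * weak_div \<Omega> \<eta> x) \<le> sqrt Ki * X"
      using 4 mult_left_mono[OF X(3), of "sqrt Ki"] constants by simp
  qed
  also have "\<dots> = econ * X" by (simp add: econ_def distrib_right)
  finally show ?thesis by (simp add: X_def)
qed

lemma weak_div_cong_AE:
  assumes "\<eta> \<in> Hdiv \<Omega>" "\<eta>' \<in> Hdiv \<Omega>" "AE x in M. \<eta> x = \<eta>' x"
  shows "AE x in M. weak_div \<Omega> \<eta> x = weak_div \<Omega> \<eta>' x"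
proof (rule has_weak_div_unique)
  show "has_weak_div \<Omega> \<eta> (weak_div \<Omega> \<eta>')"
    unfolding has_weak_div_def
  proof (intro allI impI)
    fix \<phi> assume \<phi>: "test_function \<Omega> \<phi>"
    have "L2_inner M \<eta> (grad \<phi>) = L2_inner M \<eta>' (grad \<phi>)"
      by (intro L2_inner_cong_AE Hdiv_L2 assms grad_L2 test_functionD(1)[OF \<phi>]) auto
    then show "L2_inner M \<eta> (grad \<phi>) = - L2_inner M (weak_div \<Omega> \<eta>') \<phi>"
      using weak_div_Hdiv(2)[OF assms(2)] \<phi> by (simp add: has_weak_div_def)
  qed
qed (intro weak_div_Hdiv assms)+

theorem variational_well_posed:
  "\<exists>C>0. \<forall>f \<in> L2 M. \<forall>gD \<in> H_half \<Omega> \<Gamma>D. \<forall>gN \<in> H_minus_half \<Omega> \<Gamma>D \<Gamma>N.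
    \<exists>\<eta> w. variational_solution \<Omega> \<Gamma>D \<Gamma>N A b a f gD gN \<eta> w \<and>
      (\<forall>\<eta>' w'. variational_solution \<Omega> \<Gamma>D \<Gamma>N A b a f gD gN \<eta>' w' \<longrightarrow>
         (AE x in M. \<eta>' x = \<eta> x) \<and> (AE x in M. w' x = w x)) \<and>
      energy_norm \<Omega> A a \<eta> w \<le>
        C * (H_minus1_norm \<Omega> \<Gamma>D f + H_half_norm \<Omega> \<Gamma>D gD + H_minus_half_norm \<Omega> \<Gamma>D \<Gamma>N gN)"
proof -
  obtain C0 where C0: "C0 \<ge> 0" "\<And>f gN G. f \<in> L2 M \<Longrightarrow> gN \<in> H_minus_half \<Omega> \<Gamma>D \<Gamma>N \<Longrightarrow> G \<in> H1 \<Omega> \<Longrightarrow> \<exists>\<eta>\<in>H_N \<Omega> \<Gamma>D. \<exists>w\<in>V.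
    (\<forall>\<tau>\<in>H_N \<Omega> \<Gamma>D. \<forall>v\<in>V. bform \<Omega> A b a \<eta> w \<tau> v = L2_inner M f v - pairing_N \<Omega> \<Gamma>N gN v - normal_pairing \<Omega> \<tau> G) \<and>
    H1_norm \<Omega> w + L2_norm M \<eta> + L2_norm M (weak_div \<Omega> \<eta>)
      \<le> C0 * (H_minus1_norm \<Omega> \<Gamma>D f + H_minus_half_norm \<Omega> \<Gamma>D \<Gamma>N gN + H1_norm \<Omega> G)"
    using variational_solvable[of \<Gamma>N] by blast
  \<comment> \<open>The summand 1 makes C positive, which the division by C below relies on.\<close>
  define C where "C = econ * C0 + 1"
  have C: "C > 0" using econ_nonneg C0(1) by (simp add: C_def add_nonneg_pos)
  have "\<exists>\<eta> w. variational_solution \<Omega> \<Gamma>D \<Gamma>N A b a f gD gN \<eta> w \<and>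
      (\<forall>\<eta>' w'. variational_solution \<Omega> \<Gamma>D \<Gamma>N A b a f gD gN \<eta>' w' \<longrightarrow>
         (AE x in M. \<eta>' x = \<eta> x) \<and> (AE x in M. w' x = w x)) \<and>
      energy_norm \<Omega> A a \<eta> w \<le>
        C * (H_minus1_norm \<Omega> \<Gamma>D f + H_half_norm \<Omega> \<Gamma>D gD + H_minus_half_norm \<Omega> \<Gamma>D \<Gamma>N gN)"
    if f: "f \<in> L2 M" and gD: "gD \<in> H_half \<Omega> \<Gamma>D" and gN: "gN \<in> H_minus_half \<Omega> \<Gamma>D \<Gamma>N" for f gD gN
  proof -
    define X where "X = H_minus1_norm \<Omega> \<Gamma>D f + H_minus_half_norm \<Omega> \<Gamma>D \<Gamma>N gN"
    let ?sol = "variational_solution \<Omega> \<Gamma>D \<Gamma>N A b a f gD gN"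
    have X: "0 \<le> X" using functional_L2_inner[OF f] functional_pairing_N[OF gN] by (simp add: X_def functional_def)
    have exists: "\<exists>\<eta> w. ?sol \<eta> w \<and> H1_norm \<Omega> w + L2_norm M \<eta> + L2_norm M (weak_div \<Omega> \<eta>) \<le> C0 * (X + H1_norm \<Omega> G)"
      if G: "G \<in> H1 \<Omega>" "has_trace_on \<Omega> \<Gamma>D G gD" for G
    proof -
      obtain \<eta> w where *: "\<eta> \<in> H_N \<Omega> \<Gamma>D" "w \<in> V"
        "\<And>\<tau> v. \<tau> \<in> H_N \<Omega> \<Gamma>D \<Longrightarrow> v \<in> V \<Longrightarrow> bform \<Omega> A b a \<eta> w \<tau> v = L2_inner M f v - pairing_N \<Omega> \<Gamma>N gN v - normal_pairing \<Omega> \<tau> G"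
        "H1_norm \<Omega> w + L2_norm M \<eta> + L2_norm M (weak_div \<Omega> \<eta>) \<le> C0 * (X + H1_norm \<Omega> G)"
        using C0(2)[OF f gN G(1)] unfolding X_def by blast
      have "?sol \<eta> w"
        unfolding variational_solution_def fform_def using * pairing_D_eq[OF _ G] by simp
      with *(4) show ?thesis by blast
    qed
    have unique: "(AE x in M. \<eta>' x = \<eta> x) \<and> (AE x in M. w' x = w x)" if "?sol \<eta> w" "?sol \<eta>' w'" for \<eta> w \<eta>' w'
      using variational_unique[of \<eta>' w' \<eta> w] that unfolding variational_solution_def by simp
    obtain G0 where G0: "G0 \<in> H1 \<Omega>" "has_trace_on \<Omega> \<Gamma>D G0 gD" using gD by (auto simp: trace_space_def)
    obtain \<eta> w where \<eta>w: "?sol \<eta> w" using exists[OF G0] by blast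
    have Hd: "\<eta> \<in> Hdiv \<Omega>" and wH: "w \<in> H1 \<Omega>" using \<eta>w V_H1 by (auto simp: variational_solution_def H_N_def)
    \<comment> \<open>The estimate for the solution built from G passes to the fixed one: the two
      agree almost everywhere, and all three norms respect this.\<close>
    have energy: "energy_norm \<Omega> A a \<eta> w \<le> C * (X + H1_norm \<Omega> G)" if G: "G \<in> H1 \<Omega>" "has_trace_on \<Omega> \<Gamma>D G gD" for G
    proof -
      obtain \<eta>' w' where *: "?sol \<eta>' w'" "H1_norm \<Omega> w' + L2_norm M \<eta>' + L2_norm M (weak_div \<Omega> \<eta>') \<le> C0 * (X + H1_norm \<Omega> G)"
        using exists[OF G] by blast
      have Hd': "\<eta>' \<in> Hdiv \<Omega>" and wH': "w' \<in> H1 \<Omega>" using *(1) V_H1 by (auto simp: variational_solution_def H_N_def)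
      have ae: "AE x in M. \<eta> x = \<eta>' x" "AE x in M. w x = w' x" using unique[OF *(1) \<eta>w] by auto
      have "H1_norm \<Omega> w' = H1_norm \<Omega> w" by (rule H1_norm_cong_AE(3)[OF wH H1_L2[OF wH'] ae(2)])
      moreover have "L2_norm M \<eta> = L2_norm M \<eta>'" by (intro L2_norm_cong_AE Hdiv_L2 Hd Hd' ae)
      moreover have "L2_norm M (weak_div \<Omega> \<eta>) = L2_norm M (weak_div \<Omega> \<eta>')"
        by (intro L2_norm_cong_AE weak_div_Hdiv Hd Hd' weak_div_cong_AE ae)
      ultimately have "energy_norm \<Omega> A a \<eta> w \<le> econ * (H1_norm \<Omega> w' + L2_norm M \<eta>' + L2_norm M (weak_div \<Omega> \<eta>'))"
        using energy_norm_le[OF Hd wH] by simp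
      also have "\<dots> \<le> econ * (C0 * (X + H1_norm \<Omega> G))" using *(2) econ_nonneg by (rule mult_left_mono)
      also have "\<dots> \<le> C * (X + H1_norm \<Omega> G)"
        using X H1_norm_nonneg[of G] by (simp add: C_def distrib_right mult.assoc)
      finally show ?thesis .
    qed
    \<comment> \<open>Solved for the norm of G, the estimate provides a lower bound for the set
      whose infimum is the norm of the Dirichlet datum.\<close>
    have "energy_norm \<Omega> A a \<eta> w / C - X \<le> H_half_norm \<Omega> \<Gamma>D gD"
      unfolding trace_norm_def
    proof (rule cInf_greatest)
      show "{H1_norm \<Omega> v |v. v \<in> H1 \<Omega> \<and> has_trace_on \<Omega> \<Gamma>D v gD} \<noteq> {}" using G0 by blast
      fix y assume "y \<in> {H1_norm \<Omega> v |v. v \<in> H1 \<Omega> \<and> has_trace_on \<Omega> \<Gamma>D v gD}"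
      then obtain G where "y = H1_norm \<Omega> G" "G \<in> H1 \<Omega>" "has_trace_on \<Omega> \<Gamma>D G gD" by blast
      then show "energy_norm \<Omega> A a \<eta> w / C - X \<le> y" using energy[of G] C by (simp add: field_simps)
    qed
    then have "energy_norm \<Omega> A a \<eta> w \<le> C * (X + H_half_norm \<Omega> \<Gamma>D gD)" using C by (simp add: field_simps)
    then have "energy_norm \<Omega> A a \<eta> w \<le> C * (H_minus1_norm \<Omega> \<Gamma>D f + H_half_norm \<Omega> \<Gamma>D gD + H_minus_half_norm \<Omega> \<Gamma>D \<Gamma>N gN)"
      by (simp add: X_def add_ac)
    then show ?thesis using \<eta>w unique by blast
  qed
  then show ?thesis using C by blast
qed

end

theorem theorem2p4:
  fixes \<Omega> \<Gamma>D \<Gamma>N :: "(real^'d) set"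
    and A :: "real^'d \<Rightarrow> real^'d^'d"
    and b :: "real^'d \<Rightarrow> real^'d"
    and a :: "real^'d \<Rightarrow> real"
    and \<Lambda>0 \<Lambda>1 :: real
  assumes dim: "CARD('d) = 2 \<or> CARD('d) = 3"
    and domain: "bounded \<Omega>" "open \<Omega>" "connected \<Omega>" "lipschitz_boundary \<Omega>"
    and boundary: "frontier \<Omega> = closure \<Gamma>D \<union> closure \<Gamma>N"
      "openin (top_of_set (frontier \<Omega>)) \<Gamma>D" "openin (top_of_set (frontier \<Omega>)) \<Gamma>N"
      "\<Gamma>D \<inter> \<Gamma>N = {}"
    and Dirichlet: "emeasure surface_measure \<Gamma>D > 0" "connected \<Gamma>D"
    and A_measurable: "A \<in> borel_measurable (lebesgue_on \<Omega>)"
    and A_symmetric: "AE x in lebesgue_on (closure \<Omega>). transpose (A x) = A x"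
    and A_elliptic: "0 < \<Lambda>0" "\<Lambda>0 \<le> \<Lambda>1"
      "AE x in lebesgue_on (closure \<Omega>). \<forall>\<xi>. \<Lambda>0 * (\<xi> \<bullet> \<xi>) \<le> \<xi> \<bullet> (A x *v \<xi>) \<and>
         \<xi> \<bullet> (A x *v \<xi>) \<le> \<Lambda>1 * (\<xi> \<bullet> \<xi>)"
    and b_bounded: "b \<in> Linf (lebesgue_on \<Omega>)"
    and a_bounded: "a \<in> Linf (lebesgue_on \<Omega>)"
    and a_nonzero: "AE x in lebesgue_on \<Omega>. a x \<noteq> 0" "(\<lambda>x. inverse (a x)) \<in> Linf (lebesgue_on \<Omega>)"
    and primal_well_posed: "H2_well_posed \<Omega> (primal_solution \<Omega> \<Gamma>D A b a)"
    and dual_well_posed: "H2_well_posed \<Omega> (dual_solution \<Omega> \<Gamma>D A b a)"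
  shows "\<exists>C>0. \<forall>f \<in> L2 (lebesgue_on \<Omega>). \<forall>gD \<in> H_half \<Omega> \<Gamma>D. \<forall>gN \<in> H_minus_half \<Omega> \<Gamma>D \<Gamma>N.
    \<exists>\<eta> w. variational_solution \<Omega> \<Gamma>D \<Gamma>N A b a f gD gN \<eta> w \<and>
      (\<forall>\<eta>' w'. variational_solution \<Omega> \<Gamma>D \<Gamma>N A b a f gD gN \<eta>' w' \<longrightarrow>
         (AE x in lebesgue_on \<Omega>. \<eta>' x = \<eta> x) \<and> (AE x in lebesgue_on \<Omega>. w' x = w x)) \<and>
      energy_norm \<Omega> A a \<eta> w \<le>
        C * (H_minus1_norm \<Omega> \<Gamma>D f + H_half_norm \<Omega> \<Gamma>D gD + H_minus_half_norm \<Omega> \<Gamma>D \<Gamma>N gN)"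
proof -
  have \<Gamma>D: "\<Gamma>D \<subseteq> frontier \<Omega>" using openin_imp_subset[OF boundary(2)] .
  \<comment> \<open>A relatively open part of the closed boundary is a Borel set, as completeness of
    \<open>H1_D\<close> requires.\<close>
  obtain U where "open U" "\<Gamma>D = frontier \<Omega> \<inter> U" using boundary(2) unfolding openin_open by blast
  then have \<Gamma>D_sets: "\<Gamma>D \<in> sets borel" by (simp add: borel_closed)
  \<comment> \<open>Symmetry and ellipticity of A are given on the closure of \<Omega>, whereas all
    integrals are over \<Omega>.\<close>
  have restrict: "AE x in lebesgue_on \<Omega>. P x" if "AE x in lebesgue_on (closure \<Omega>). P x" for P
  proof -
    have "\<Omega> \<inter> space lebesgue \<in> sets lebesgue" "closure \<Omega> \<inter> space lebesgue \<in> sets lebesgue" using domain(2) by auto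
    note iff = this[THEN AE_restrict_space_iff]
    show ?thesis using that unfolding iff by eventually_elim (use closure_subset in blast)
  qed
  have Linf: "\<exists>K\<ge>0. AE x in lebesgue_on \<Omega>. norm (g x) \<le> K" if g: "g \<in> Linf (lebesgue_on \<Omega>)" for g :: "real^'d \<Rightarrow> 'b::euclidean_space"
  proof -
    obtain K where "AE x in lebesgue_on \<Omega>. norm (g x) \<le> K" using g unfolding Linf_def by blast
    then have "AE x in lebesgue_on \<Omega>. norm (g x) \<le> \<bar>K\<bar>" by eventually_elim simp
    then show ?thesis by (intro exI[of _ "\<bar>K\<bar>"]) simp
  qed
  obtain Kb where Kb: "Kb \<ge> 0" "AE x in lebesgue_on \<Omega>. norm (b x) \<le> Kb" using Linf[OF b_bounded] by blast
  obtain Ka where Ka: "Ka \<ge> 0" "AE x in lebesgue_on \<Omega>. norm (a x) \<le> Ka" using Linf[OF a_bounded] by blast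
  obtain Ki where Ki: "Ki \<ge> 0" "AE x in lebesgue_on \<Omega>. norm (inverse (a x)) \<le> Ki" using Linf[OF a_nonzero(2)] by blast
  interpret elliptic_problem \<Omega> \<Gamma>D A b a \<Lambda>0 \<Lambda>1 Ka Kb Ki
  proof
    show "2 \<le> DIM(real^'d)" using dim by auto
    show "b \<in> borel_measurable (lebesgue_on \<Omega>)" "a \<in> borel_measurable (lebesgue_on \<Omega>)"
      using b_bounded a_bounded by (auto simp: Linf_def)
    show "AE x in lebesgue_on \<Omega>. \<bar>a x\<bar> \<le> Ka" "AE x in lebesgue_on \<Omega>. \<bar>inverse (a x)\<bar> \<le> Ki"
      using Ka(2) Ki(2) by (simp_all only: real_norm_def)
  qed (use domain \<Gamma>D \<Gamma>D_sets A_measurable restrict[OF A_symmetric] A_elliptic(1,2) restrict[OF A_elliptic(3)]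
      Ka(1) Kb Ki(1) a_nonzero(1) primal_well_posed dual_well_posed in simp_all)
  show ?thesis by (rule variational_well_posed)
qed

end
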